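(* Let $N$ be a prime, $s\in\mathbb{N}$, let $\alpha$ be an even positive integer, and let $\boldsymbol{\gamma}=(\gamma_u)_{u\subseteq 1:s}$ be weights with $\gamma_u\ge0$. Put $\gamma''_u=\gamma_u\left(3/(2^{2\alpha+1}\pi^{2\alpha})\right)^{|u|}$ and $\boldsymbol{\gamma}''^{1/2}=(\gamma_u''^{1/2})_{u\subseteq 1:s}$. The component-by-component (CBC) algorithm using the squared worst-case error $(e^{\mathrm{wor}}(P_{N,\boldsymbol{z}};\mathcal{H}(K_{\alpha/2,\boldsymbol{\gamma}''^{1/2},s}^{\mathrm{kor}})))^2$ as a quality criterion finds a generating vector $\boldsymbol{z}\in\{1,\ldots,N-1\}^s$ such that $$e^{\mathrm{wor}}(P_{N,\boldsymbol{z}}^{\mathrm{sym}};\mathcal{H}(K_{\alpha,\boldsymbol{\gamma},s}^{\mathrm{sob(odd}+\alpha)}))\le\left(e^{\mathrm{wor}}(P_{N,\boldsymbol{z}};\mathcal{H}(K_{\alpha/2,\boldsymbol{\gamma}''^{1/2},s}^{\mathrm{kor}}))\right)^2\le\frac{1}{(N-1)^{1/\lambda}}\left(\sum_{\emptyset\ne u\subseteq 1:s}\gamma_u^{\lambda/2}\left(\frac{3^{\lambda/2}\zeta(\alpha\lambda)}{2^{(2\alpha+1)\lambda/2-1}\pi^{\alpha\lambda}}\right)^{|u|}\right)^{1/\lambda}$$ holds for any $\lambda\in(1/\alpha,1]$, where $\zeta$ is the Riemann zeta function.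
   Context: $\mathbb{N}$ is the set of positive integers, $1:s=\{1,\ldots,s\}$. For a reproducing kernel $K:[0,1]^s\times[0,1]^s\to\mathbb{R}$, $\mathcal{H}(K)$ is the reproducing kernel Hilbert space of real-valued functions with kernel $K$. Point sets are finite multisets (multiplicity counts). For a finite multiset $P\subset[0,1]^s$ and a normed function space $V$, the worst-case error is $$e^{\mathrm{wor}}(P;V)=\sup_{f\in V,\ \|f\|_V\le 1}\left|\frac{1}{|P|}\sum_{\boldsymbol{x}\in P}f(\boldsymbol{x})-\int_{[0,1]^s}f(\boldsymbol{x})\,d\boldsymbol{x}\right|.$$ The rank-1 lattice point set is $P_{N,\boldsymbol{z}}=\{\{n\boldsymbol{z}/N\} : 0\le n<N\}$ (componentwise fractional parts; $N$ points with multiplicity). For $u\subseteq 1:s$ and $\boldsymbol{x}\in[0,1]^s$, $\mathrm{sym}_u(\boldsymbol{x})=(y_1,\ldots,y_s)$ with $y_j=1-x_j$ if $j\in u$ and $y_j=x_j$ otherwise. The symmetrized point set is the multiset union $P_{N,\boldsymbol{z}}^{\mathrm{sym}}=\bigcup_{u\subseteq 1:s}\mathrm{sym}_u(P_{N,\boldsymbol{z}})$, having $2^sN$ points counted with multiplicity. Kernel of the intermediate Sobolev space: with $B_\tau$ the Bernoulli polynomial of degree $\tau$, $$K_{\alpha,1,1}^{\mathrm{sob(odd}+\alpha)}(x,y)=1+\sum_{\substack{1\le\tau\le\alpha\\ \tau\text{ odd or }\tau=\alpha}}\frac{B_\tau(x)B_\tau(y)}{(\tau!)^2}+(-1)^{\alpha+1}\frac{B_{2\alpha}(|x-y|)}{(2\alpha)!},$$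 $$K_{\alpha,\boldsymbol{\gamma},s}^{\mathrm{sob(odd}+\alpha)}(\boldsymbol{x},\boldsymbol{y})=1+\sum_{\emptyset\ne u\subseteq 1:s}\gamma_u\prod_{j\in u}\left[-1+K_{\alpha,1,1}^{\mathrm{sob(odd}+\alpha)}(x_j,y_j)\right].$$ Korobov kernel: for weights $\boldsymbol{\eta}=(\eta_u)$, $\eta_u\ge 0$, and $\beta>1/2$, $$K_{\beta,\boldsymbol{\eta},s}^{\mathrm{kor}}(\boldsymbol{x},\boldsymbol{y})=1+\sum_{\emptyset\ne u\subseteq 1:s}\eta_u\prod_{j\in u}\sum_{h_j\in\mathbb{Z}\setminus\{0\}}\frac{e^{2\pi\mathrm{i}h_j(x_j-y_j)}}{|h_j|^{2\beta}}.$$ CBC algorithm with quality criterion $(e^{\mathrm{wor}}(P_{N,\boldsymbol{z}};\mathcal{H}(K_{\beta,\boldsymbol{\eta},s}^{\mathrm{kor}})))^2$: set $z_1=1$; then for $d=2,\ldots,s$ successively, with $z_1,\ldots,z_{d-1}$ already fixed, choose $z_d\in\{1,\ldots,N-1\}$ minimizing the $d$-dimensional criterion $(e^{\mathrm{wor}}(P_{N,(z_1,\ldots,z_d)};\mathcal{H}(K_{\beta,(\eta_u)_{u\subseteq 1:d},d}^{\mathrm{kor}})))^2$ as a function of $z_d$ (ties broken arbitrarily). The output is $\boldsymbol{z}=(z_1,\ldots,z_s)$. *)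

theory Defs
  imports "HOL-Analysis.Analysis" "HOL-Library.Multiset" "HOL-Computational_Algebra.Primes"
begin

text \<open>
  Functions on a set \<open>X\<close> are represented by elements of \<open>extensional X\<close>, so that equality of
  functions on \<open>X\<close> is HOL equality; hence the \<open>restrict\<close>s below.
\<close>

locale function_hilbert_space =
  fixes X :: "'a set"
    and H :: "('a \<Rightarrow> real) set"
    and ip :: "('a \<Rightarrow> real) \<Rightarrow> ('a \<Rightarrow> real) \<Rightarrow> real"
  assumes extensional: "H \<subseteq> extensional X"
    and zero_mem: "(\<lambda>x\<in>X. 0) \<in> H"
    and add_mem: "\<lbrakk>f \<in> H; g \<in> H\<rbrakk> \<Longrightarrow> (\<lambda>x\<in>X. f x + g x) \<in> H"
    and scale_mem: "f \<in> H \<Longrightarrow> (\<lambda>x\<in>X. c * f x) \<in> H"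
    and ip_commute: "\<lbrakk>f \<in> H; g \<in> H\<rbrakk> \<Longrightarrow> ip f g = ip g f"
    and ip_add_left: "\<lbrakk>f \<in> H; g \<in> H; h \<in> H\<rbrakk> \<Longrightarrow> ip (\<lambda>x\<in>X. f x + g x) h = ip f h + ip g h"
    and ip_scale_left: "\<lbrakk>f \<in> H; g \<in> H\<rbrakk> \<Longrightarrow> ip (\<lambda>x\<in>X. c * f x) g = c * ip f g"
    and ip_nonneg: "f \<in> H \<Longrightarrow> 0 \<le> ip f f"
    and ip_definite: "\<lbrakk>f \<in> H; ip f f = 0\<rbrakk> \<Longrightarrow> f = (\<lambda>x\<in>X. 0)"
    and complete:
      "\<lbrakk>\<And>n :: nat. F n \<in> H;
        \<And>e. 0 < e \<Longrightarrow> \<exists>M. \<forall>m\<ge>M. \<forall>n\<ge>M.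
          sqrt (ip (\<lambda>x\<in>X. F m x - F n x) (\<lambda>x\<in>X. F m x - F n x)) < e\<rbrakk>
       \<Longrightarrow> \<exists>f\<in>H. (\<lambda>n. sqrt (ip (\<lambda>x\<in>X. F n x - f x) (\<lambda>x\<in>X. F n x - f x))) \<longlonglongrightarrow> 0"

locale reproducing_kernel_hilbert_space = function_hilbert_space X H ip
  for X :: "'a set" and H and ip +
  fixes K :: "'a \<Rightarrow> 'a \<Rightarrow> real"
  assumes kernel_mem: "y \<in> X \<Longrightarrow> (\<lambda>x\<in>X. K x y) \<in> H"
    and reproducing: "\<lbrakk>f \<in> H; y \<in> X\<rbrakk> \<Longrightarrow> f y = ip f (\<lambda>x\<in>X. K x y)"

text \<open>
  A normed function space is given by its set of functions and its norm.  By the Moore-Aronszajn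
  theorem the choice below exists for every positive semidefinite \<open>K\<close> and is unique up to the
  irrelevant values of the inner product outside \<open>H\<close>.
\<close>

definition rkhs :: "'a set \<Rightarrow> ('a \<Rightarrow> 'a \<Rightarrow> real) \<Rightarrow> ('a \<Rightarrow> real) set \<times> (('a \<Rightarrow> real) \<Rightarrow> real)" where
  "rkhs X K =
    (let (H, ip) = (SOME (H, ip). reproducing_kernel_hilbert_space X H ip K)
     in (H, \<lambda>f. sqrt (ip f f)))"

text \<open>
  A point of the \<open>s\<close>-dimensional unit cube is an extensional function on \<open>{1..s}\<close>.  The underlying
  set of \<open>cube_measure s\<close>, the product Lebesgue measure, is exactly \<open>unit_cube s\<close>.
\<close>

definition unit_cube :: "nat \<Rightarrow> (nat \<Rightarrow> real) set" where
  "unit_cube s = PiE {1..s} (\<lambda>_. {0..1})"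

definition cube_measure :: "nat \<Rightarrow> (nat \<Rightarrow> real) measure" where
  "cube_measure s = PiM {1..s} (\<lambda>_. restrict_space lborel {0..1})"

text \<open>The supremum is taken in the extended reals, so that it is meaningful also if it is infinite.\<close>

definition worst_case_error ::
    "nat \<Rightarrow> (nat \<Rightarrow> real) multiset \<Rightarrow> ((nat \<Rightarrow> real) \<Rightarrow> real) set \<times> (((nat \<Rightarrow> real) \<Rightarrow> real) \<Rightarrow> real) \<Rightarrow> ereal"
  where
  "worst_case_error s P V =
    (SUP f \<in> {f \<in> fst V. snd V f \<le> 1}.
      ereal \<bar>(\<Sum>x\<in>#P. f x) / real (size P) - (\<integral>x. f x \<partial>cube_measure s)\<bar>)"

definition lattice_points :: "nat \<Rightarrow> nat \<Rightarrow> (nat \<Rightarrow> nat) \<Rightarrow> (nat \<Rightarrow> real) multiset" where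
  "lattice_points s N z =
    image_mset (\<lambda>n. \<lambda>j\<in>{1..s}. frac (real n * real (z j) / real N)) (mset_set {0..<N})"

definition sym_point :: "nat \<Rightarrow> nat set \<Rightarrow> (nat \<Rightarrow> real) \<Rightarrow> (nat \<Rightarrow> real)" where
  "sym_point s u x = (\<lambda>j\<in>{1..s}. if j \<in> u then 1 - x j else x j)"

definition symmetrized_points :: "nat \<Rightarrow> (nat \<Rightarrow> real) multiset \<Rightarrow> (nat \<Rightarrow> real) multiset" where
  "symmetrized_points s P = (\<Sum>u\<in>Pow {1..s}. image_mset (sym_point s u) P)"

text \<open>Bernoulli numbers with the convention \<open>B\<^sub>1 = -1/2\<close>.\<close>

fun bernoulli :: "nat \<Rightarrow> real" where
  "bernoulli 0 = 1"
| "bernoulli (Suc n) = - (\<Sum>k\<le>n. real ((n + 2) choose k) * bernoulli k) / real (n + 2)"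

definition bernpoly :: "nat \<Rightarrow> real \<Rightarrow> real" where
  "bernpoly n x = (\<Sum>k\<le>n. real (n choose k) * bernoulli k * x ^ (n - k))"

definition sobolev_kernel_1 :: "nat \<Rightarrow> real \<Rightarrow> real \<Rightarrow> real" where
  "sobolev_kernel_1 \<alpha> x y =
    1 + (\<Sum>\<tau> | 1 \<le> \<tau> \<and> \<tau> \<le> \<alpha> \<and> (odd \<tau> \<or> \<tau> = \<alpha>). bernpoly \<tau> x * bernpoly \<tau> y / (fact \<tau>)\<^sup>2)
      + (-1) ^ (\<alpha> + 1) * bernpoly (2 * \<alpha>) \<bar>x - y\<bar> / fact (2 * \<alpha>)"

definition sobolev_kernel ::
    "nat \<Rightarrow> (nat set \<Rightarrow> real) \<Rightarrow> nat \<Rightarrow> (nat \<Rightarrow> real) \<Rightarrow> (nat \<Rightarrow> real) \<Rightarrow> real" where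
  "sobolev_kernel \<alpha> \<gamma> s x y =
    1 + (\<Sum>u\<in>Pow {1..s} - {{}}. \<gamma> u * (\<Prod>j\<in>u. - 1 + sobolev_kernel_1 \<alpha> (x j) (y j)))"

text \<open>The bilateral series is real-valued; \<open>Re\<close> only adjusts the type.\<close>

definition korobov_kernel ::
    "real \<Rightarrow> (nat set \<Rightarrow> real) \<Rightarrow> nat \<Rightarrow> (nat \<Rightarrow> real) \<Rightarrow> (nat \<Rightarrow> real) \<Rightarrow> real" where
  "korobov_kernel \<beta> \<eta> s x y =
    1 + (\<Sum>u\<in>Pow {1..s} - {{}}. \<eta> u * (\<Prod>j\<in>u.
      Re (\<Sum>\<^sub>\<infinity>h\<in>UNIV - {0 :: int}.
        exp (2 * of_real pi * \<i> * of_int h * of_real (x j - y j))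
          / of_real (real_of_int \<bar>h\<bar> powr (2 * \<beta>)))))"

abbreviation sobolev_space ::
    "nat \<Rightarrow> (nat set \<Rightarrow> real) \<Rightarrow> nat \<Rightarrow> ((nat \<Rightarrow> real) \<Rightarrow> real) set \<times> (((nat \<Rightarrow> real) \<Rightarrow> real) \<Rightarrow> real)"
  where "sobolev_space \<alpha> \<gamma> s \<equiv> rkhs (unit_cube s) (sobolev_kernel \<alpha> \<gamma> s)"

abbreviation korobov_space ::
    "real \<Rightarrow> (nat set \<Rightarrow> real) \<Rightarrow> nat \<Rightarrow> ((nat \<Rightarrow> real) \<Rightarrow> real) set \<times> (((nat \<Rightarrow> real) \<Rightarrow> real) \<Rightarrow> real)"
  where "korobov_space \<beta> \<eta> s \<equiv> rkhs (unit_cube s) (korobov_kernel \<beta> \<eta> s)"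

definition scaled_weights :: "nat \<Rightarrow> (nat set \<Rightarrow> real) \<Rightarrow> nat set \<Rightarrow> real" where
  "scaled_weights \<alpha> \<gamma> u = \<gamma> u * (3 / (2 ^ (2 * \<alpha> + 1) * pi ^ (2 * \<alpha>))) ^ card u"

definition sqrt_scaled_weights :: "nat \<Rightarrow> (nat set \<Rightarrow> real) \<Rightarrow> nat set \<Rightarrow> real" where
  "sqrt_scaled_weights \<alpha> \<gamma> u = sqrt (scaled_weights \<alpha> \<gamma> u)"

text \<open>
  \<open>crit d z\<close> is the \<open>d\<close>-dimensional quality criterion, depending on \<open>z 1, \<dots>, z d\<close> only.  The
  predicate characterises the possible outputs of the algorithm under all ways of breaking ties;
  the values of \<open>z\<close> outside \<open>{1..s}\<close> are immaterial.
\<close>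

definition cbc_output ::
    "(nat \<Rightarrow> (nat \<Rightarrow> nat) \<Rightarrow> 'b :: ord) \<Rightarrow> nat \<Rightarrow> nat \<Rightarrow> (nat \<Rightarrow> nat) \<Rightarrow> bool" where
  "cbc_output crit N s z \<longleftrightarrow>
    z 1 = 1 \<and>
    (\<forall>d\<in>{2..s}. is_arg_min (\<lambda>k. crit d (z(d := k))) (\<lambda>k. k \<in> {1..N - 1}) (z d))"

definition korobov_criterion ::
    "real \<Rightarrow> (nat set \<Rightarrow> real) \<Rightarrow> nat \<Rightarrow> nat \<Rightarrow> (nat \<Rightarrow> nat) \<Rightarrow> ereal" where
  "korobov_criterion \<beta> \<eta> N d z =
    (worst_case_error d (lattice_points d N z) (korobov_space \<beta> \<eta> d))\<^sup>2"

text \<open>The Riemann zeta function, for real \<open>t > 1\<close> only.\<close>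

definition zeta :: "real \<Rightarrow> real" where
  "zeta t = (\<Sum>n. 1 / real (Suc n) powr t)"

end

theory Submission
  imports Defs
begin

text \<open>
  In a reproducing kernel Hilbert space whose kernel \<open>K\<close> has mean one in each variable, the squared
  worst-case error of \<open>P\<close> is the double average of \<open>K\<close> over \<open>P\<close>, minus one.  For the Korobov kernel
  and a lattice this double average is \<open>\<Sum>\<^sub>u \<eta>\<^sub>u D\<^sub>u\<close>, where \<open>D\<^sub>u\<close> sums \<open>\<Prod>\<^sub>j \<bar>h\<^sub>j\<bar> powr - 2\<beta>\<close>
  over the dual lattice.  Collecting the frequencies by their residues modulo \<open>N\<close> turns \<open>D\<^sub>u\<close> into a
  finite sum, and the averaging argument for the component-by-component algorithm (Jensen's
  inequality for the exponent \<open>\<lambda>\<close>, then the mean over the new component) only needs that the weights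
  in that sum are natural numbers.

  Symmetrization kills the odd Bernoulli polynomials; by the Fourier expansions of \<open>B\<^sub>\<alpha>\<close> and
  \<open>B\<^bsub>2\<alpha>\<^esub>\<close> the symmetrized Sobolev kernel is a double cosine series whose coefficients are dominated by
  a product of two copies of the Korobov coefficients.  As the lattice averages of products of cosines
  are nonnegative, each summand of the squared Sobolev error is at most the square of the
  corresponding Korobov summand.
\<close>

text \<open>\<open>rkhs\<close> picks its space by choice, so the existence of a Hilbert space with
  the given kernel has to be proved before any worst-case error can be computed; hence the
  construction from a positive semidefinite kernel. The constant in the scaled weights arises as
  follows. Put q = 1 / (2 pi)^(2 \<alpha>). After symmetrization the polynomial of degree \<alpha>
  contributes 4 q to the coefficient of a product of two cosines, and the one of degree 2 \<alpha>
  contributes 2 q on the diagonal, where its weight is dominated by the product of the two Korobov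
  weights; together 6 q. Squaring the Korobov summand brings 2 * 2 = 4 per coordinate, and 6 q / 4 =
  3 / (2^(2 \<alpha> + 1) pi^(2 \<alpha>)). The Korobov weights are square roots because a sum of
  squares of nonnegative numbers is at most the square of their sum; this is why an unsquared error
  is bounded by a squared one. Primality of \<open>N\<close> makes multiplication by a nonzero
  residue permute the nonzero residues, so that only the class 0 is special when a new component is
  averaged out.\<close>

section \<open>Finite formal combinations of point evaluations\<close>

definition lin :: "(real \<times> 'a) list \<Rightarrow> ('a \<Rightarrow> real) \<Rightarrow> real" where
  "lin l f = (\<Sum>(c, x)\<leftarrow>l. c * f x)"

definition scale_comb :: "real \<Rightarrow> (real \<times> 'a) list \<Rightarrow> (real \<times> 'a) list" where
  "scale_comb t = map (\<lambda>(c, x). (t * c, x))"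

lemma lin_Nil [simp]: "lin [] f = 0"
  and lin_Cons [simp]: "lin ((c, x) # l) f = c * f x + lin l f"
  and lin_append [simp]: "lin (l @ m) f = lin l f + lin m f"
  by (simp_all add: lin_def)

lemma lin_scale [simp]: "lin (scale_comb t l) f = t * lin l f"
  by (induction l) (auto simp: scale_comb_def algebra_simps)

lemma lin_add: "lin l (\<lambda>x. f x + g x) = lin l f + lin l g"
  and lin_diff: "lin l (\<lambda>x. f x - g x) = lin l f - lin l g"
  and lin_cmult: "lin l (\<lambda>x. c * f x) = c * lin l f"
  and lin_zero: "lin l (\<lambda>x. 0) = 0"
  by (induction l; auto simp: algebra_simps)+

lemma lin_cong: "snd ` set l \<subseteq> X \<Longrightarrow> (\<And>x. x \<in> X \<Longrightarrow> f x = g x) \<Longrightarrow> lin l f = lin l g"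
  by (induction l) auto

lemma lin_tendsto:
  "snd ` set l \<subseteq> X \<Longrightarrow> (\<And>x. x \<in> X \<Longrightarrow> ((\<lambda>n. f n x) \<longlongrightarrow> g x) F) \<Longrightarrow> ((\<lambda>n. lin l (f n)) \<longlongrightarrow> lin l g) F"
  by (induction l) (auto intro!: tendsto_intros)

lemma lin_swap: "lin l (\<lambda>x. lin m (\<lambda>y. F x y)) = lin m (\<lambda>y. lin l (\<lambda>x. F x y))"
  by (induction l) (auto simp: lin_zero lin_add lin_cmult)

text \<open>Lists may repeat a point, so that concatenation adds two combinations and distinctness
  never has to be carried along.\<close>

definition psd :: "'a set \<Rightarrow> ('a \<Rightarrow> 'a \<Rightarrow> real) \<Rightarrow> bool" where
  "psd X K \<longleftrightarrow> (\<forall>x\<in>X. \<forall>y\<in>X. K x y = K y x) \<and>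
     (\<forall>l. snd ` set l \<subseteq> X \<longrightarrow> 0 \<le> lin l (\<lambda>x. lin l (K x)))"

text \<open>Solutions of Cauchy's functional equation are linear once they satisfy some regularity
  condition. A lower bound on one interval suffices, and in \<open>ip_scale\<close> the
  nonnegativity of squared norms supplies it.\<close>

lemma additive_bounded_below_linear:
  fixes \<psi> :: "real \<Rightarrow> real"
  assumes add: "\<And>u v. \<psi> (u + v) = \<psi> u + \<psi> v"
    and bd: "\<And>t. 0 \<le> t \<Longrightarrow> t \<le> 1 \<Longrightarrow> C \<le> \<psi> t"
  shows "\<psi> t = t * \<psi> 1"
proof -
  define \<delta> where "\<delta> t = \<psi> t - t * \<psi> 1" for t
  have cadd: "\<delta> (u + v) = \<delta> u + \<delta> v" for u v
    by (simp add: \<delta>_def add algebra_simps)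
  have c0: "\<delta> 0 = 0" using cadd[of 0 0] by simp
  have cmin: "\<delta> (- t) = - \<delta> t" for t using cadd[of t "- t"] c0 by simp
  have cnat: "\<delta> (real n * t) = real n * \<delta> t" for n t
    by (induction n) (auto simp: c0 cadd distrib_right)
  have cint1: "\<delta> (real_of_int k) = 0" for k
  proof (cases "k \<ge> 0")
    case True
    then show ?thesis using cnat[of "nat k" 1] by (simp add: \<delta>_def)
  next
    case False
    then show ?thesis using cnat[of "nat (- k)" 1] cmin[of "real_of_int k"] by (simp add: \<delta>_def)
  qed
  \<comment> \<open>\<open>\<delta>\<close> has period 1, so the lower bound on \<open>[0, 1]\<close> holds everywhere.\<close>
  have lb: "\<delta> t \<ge> C - \<bar>\<psi> 1\<bar>" for t
  proof -
    have "\<delta> t = \<delta> (frac t)" using cadd[of "frac t" "of_int \<lfloor>t\<rfloor>"] cint1 by (simp add: frac_def)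
    moreover have "C \<le> \<psi> (frac t)" using bd[of "frac t"] by (simp add: less_imp_le[OF frac_lt_1])
    moreover have "frac t * \<psi> 1 \<le> 1 * \<bar>\<psi> 1\<bar>"
      by (rule order_trans[OF mult_left_mono[OF abs_ge_self] mult_right_mono]) (auto simp: less_imp_le[OF frac_lt_1])
    ultimately show ?thesis by (simp add: \<delta>_def)
  qed
  \<comment> \<open>A negative value at \<open>t\<close> would be multiplied beyond the bound at
    \<open>n * t\<close>; oddness then excludes positive values.\<close>
  have nn: "\<delta> t \<ge> 0" for t
  proof (rule ccontr)
    assume "\<not> \<delta> t \<ge> 0"
    then obtain n :: nat where "real n * (- \<delta> t) > - (C - \<bar>\<psi> 1\<bar>)"
      using reals_Archimedean3[of "- \<delta> t"] by auto
    then show False using lb[of "real n * t"] cnat[of n t] by auto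
  qed
  have "\<delta> t = 0" using nn[of t] nn[of "- t"] cmin[of t] by auto
  then show ?thesis by (simp add: \<delta>_def)
qed

subsection \<open>The Hilbert space of a positive semidefinite kernel\<close>

locale psd_kernel =
  fixes X :: "'a set" and K :: "'a \<Rightarrow> 'a \<Rightarrow> real"
  assumes psd: "psd X K"
begin

definition combs :: "(real \<times> 'a) list set" where
  "combs = {l. snd ` set l \<subseteq> X}"

definition quad :: "(real \<times> 'a) list \<Rightarrow> real" where
  "quad l = lin l (\<lambda>x. lin l (K x))"

text \<open>The squared norm is the Legendre transform of the quadratic form of \<open>K\<close>; this form makes both
  the parallelogram law and completeness immediate.\<close>

definition J :: "('a \<Rightarrow> real) \<Rightarrow> (real \<times> 'a) list \<Rightarrow> real" where
  "J f l = 2 * lin l f - quad l"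

definition bd :: "('a \<Rightarrow> real) \<Rightarrow> bool" where
  "bd f \<longleftrightarrow> bdd_above (J f ` combs)"

definition Q :: "('a \<Rightarrow> real) \<Rightarrow> real" where
  "Q f = Sup (J f ` combs)"

definition H :: "('a \<Rightarrow> real) set" where
  "H = {f \<in> extensional X. bd f}"

text \<open>Polarization; its bilinearity is the Jordan-von Neumann theorem, obtained in
  \<open>ip_add\<close> and \<open>ip_scale\<close>.\<close>

definition ip :: "('a \<Rightarrow> real) \<Rightarrow> ('a \<Rightarrow> real) \<Rightarrow> real" where
  "ip f g = (Q (\<lambda>x. f x + g x) - Q (\<lambda>x. f x - g x)) / 4"

lemma combs_simps [simp]:
  "[] \<in> combs" "l @ m \<in> combs \<longleftrightarrow> l \<in> combs \<and> m \<in> combs"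
  "(c, x) # l \<in> combs \<longleftrightarrow> x \<in> X \<and> l \<in> combs"
  by (auto simp: combs_def)

lemma combs_scale [simp]: "l \<in> combs \<Longrightarrow> scale_comb t l \<in> combs"
  by (auto simp: combs_def scale_comb_def)

lemma K_sym: "x \<in> X \<Longrightarrow> y \<in> X \<Longrightarrow> K x y = K y x"
  using psd by (auto simp: psd_def)

lemma quad_nonneg: "l \<in> combs \<Longrightarrow> 0 \<le> quad l"
  using psd by (auto simp: psd_def quad_def combs_def)

lemma bil_sym: "l \<in> combs \<Longrightarrow> m \<in> combs \<Longrightarrow> lin l (\<lambda>x. lin m (K x)) = lin m (\<lambda>x. lin l (K x))"
  unfolding lin_swap[of l m] by (intro lin_cong[of _ X]) (auto simp: combs_def K_sym)

lemma quad_append: "l \<in> combs \<Longrightarrow> m \<in> combs \<Longrightarrow> quad (l @ m) = quad l + 2 * lin l (\<lambda>x. lin m (K x)) + quad m"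
  by (simp add: quad_def lin_add bil_sym[of l m])

lemma quad_scale: "quad (scale_comb t l) = t\<^sup>2 * quad l"
  by (simp add: quad_def lin_cmult power2_eq_square)

lemma J_cong: "(\<And>x. x \<in> X \<Longrightarrow> f x = g x) \<Longrightarrow> l \<in> combs \<Longrightarrow> J f l = J g l"
  using lin_cong[of l X f g] by (auto simp: J_def combs_def)

lemma bd_Q_cong: assumes "\<And>x. x \<in> X \<Longrightarrow> f x = g x" shows "bd f = bd g" "Q f = Q g"
  using J_cong[of f g] assms by (simp_all add: bd_def Q_def cong: image_cong)

lemma J_le_Q: "bd f \<Longrightarrow> l \<in> combs \<Longrightarrow> J f l \<le> Q f"
  by (auto simp: bd_def Q_def intro: cSUP_upper)

lemma Q_le: "(\<And>l. l \<in> combs \<Longrightarrow> J f l \<le> B) \<Longrightarrow> Q f \<le> B"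
  unfolding Q_def by (intro cSUP_least) (auto intro: combs_simps(1))

lemma bdI: "(\<And>l. l \<in> combs \<Longrightarrow> J f l \<le> B) \<Longrightarrow> bd f"
  unfolding bd_def by (auto intro!: bdd_aboveI2)

lemma J_Nil [simp]: "J f [] = 0" by (simp add: J_def quad_def)

lemma Q_nonneg: "bd f \<Longrightarrow> 0 \<le> Q f"
  using J_le_Q[of f "[]"] by simp

lemma J_scale: "t \<noteq> 0 \<Longrightarrow> J (\<lambda>x. t * f x) l = t\<^sup>2 * J f (scale_comb (1 / t) l)"
  by (simp add: J_def lin_cmult quad_scale power2_eq_square right_diff_distrib)

lemma bd_zero: "bd (\<lambda>x. 0)" and Q_zero: "Q (\<lambda>x. 0) = 0"
proof -
  have *: "J (\<lambda>x. 0) l \<le> 0" if "l \<in> combs" for l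
    using quad_nonneg[OF that] by (simp add: J_def lin_zero)
  show "bd (\<lambda>x. 0)" by (rule bdI[OF *])
  then show "Q (\<lambda>x. 0) = 0" using Q_le[OF *] Q_nonneg by (simp add: order_antisym)
qed

lemma bd_scale: assumes "bd f" shows "bd (\<lambda>x. t * f x)"
proof (cases "t = 0")
  case False
  show ?thesis using J_le_Q[OF assms] False
    by (intro bdI[of _ "t\<^sup>2 * Q f"]) (simp add: J_scale mult_left_mono)
qed (simp add: bd_zero)

lemma Q_scale_le: assumes "bd f" "t \<noteq> 0" shows "Q (\<lambda>x. t * f x) \<le> t\<^sup>2 * Q f"
  using J_le_Q[OF assms(1)] assms(2) by (intro Q_le) (simp add: J_scale mult_left_mono)

lemma Q_scale: assumes "bd f" shows "Q (\<lambda>x. t * f x) = t\<^sup>2 * Q f"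
proof (cases "t = 0")
  case False
  have "Q f \<le> (1 / t)\<^sup>2 * Q (\<lambda>x. t * f x)"
    using Q_scale_le[OF bd_scale[OF assms, of t], of "1 / t"] False by simp
  then have "t\<^sup>2 * Q f \<le> Q (\<lambda>x. t * f x)"
    using False by (simp add: field_simps)
  then show ?thesis using Q_scale_le[OF assms False] by simp
qed (simp add: Q_zero)

text \<open>The parallelogram law of the quadratic form, for the half sum and the half difference of
  \<open>l\<close> and \<open>m\<close>, carries over to the Legendre transform by this change of
  variables.\<close>

lemma J_parallelogram:
  assumes "l \<in> combs" "m \<in> combs"
  shows "J (\<lambda>x. f x + g x) l + J (\<lambda>x. f x - g x) m =
    2 * J f (scale_comb (1/2) (l @ m)) + 2 * J g (scale_comb (1/2) (l @ scale_comb (-1) m))"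
proof -
  have "lin l (\<lambda>x. lin (scale_comb (-1) m) (K x)) = - lin l (\<lambda>x. lin m (K x))"
    using lin_cmult[of l "-1"] by simp
  with assms show ?thesis
    unfolding J_def quad_scale by (simp add: lin_add lin_diff quad_append quad_scale)
      (simp add: power2_eq_square field_simps)
qed

text \<open>Once the right side of \<open>J_parallelogram\<close> is bounded by suprema,
  \<open>l\<close> and \<open>m\<close> can be varied independently on the left. The empty
  combination, where \<open>J\<close> vanishes, isolates either term.\<close>

lemma assumes "bd f" "bd g"
  shows bd_add: "bd (\<lambda>x. f x + g x)" and bd_diff: "bd (\<lambda>x. f x - g x)"
    and Q_parallelogram_le: "Q (\<lambda>x. f x + g x) + Q (\<lambda>x. f x - g x) \<le> 2 * Q f + 2 * Q g"
proof -
  have *: "J (\<lambda>x. f x + g x) l + J (\<lambda>x. f x - g x) m \<le> 2 * Q f + 2 * Q g"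
    if "l \<in> combs" "m \<in> combs" for l m
  proof -
    have "J f (scale_comb (1/2) (l @ m)) \<le> Q f" "J g (scale_comb (1/2) (l @ scale_comb (-1) m)) \<le> Q g"
      using that assms by (intro J_le_Q combs_scale; simp)+
    then show ?thesis unfolding J_parallelogram[OF that] by linarith
  qed
  show "bd (\<lambda>x. f x + g x)" by (rule bdI) (use *[of _ "[]"] in simp)
  show "bd (\<lambda>x. f x - g x)" by (rule bdI) (use *[of "[]"] in simp)
  have "Q (\<lambda>x. f x + g x) \<le> 2 * Q f + 2 * Q g - J (\<lambda>x. f x - g x) m" if "m \<in> combs" for m
    by (intro Q_le) (use *[OF _ that] in \<open>simp add: le_diff_eq\<close>)
  then have "J (\<lambda>x. f x - g x) m \<le> 2 * Q f + 2 * Q g - Q (\<lambda>x. f x + g x)" if "m \<in> combs" for m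
    using that by (force simp: algebra_simps)
  from Q_le[OF this] show "Q (\<lambda>x. f x + g x) + Q (\<lambda>x. f x - g x) \<le> 2 * Q f + 2 * Q g"
    by simp
qed

text \<open>Taking \<open>f + g\<close> and \<open>f - g\<close> for \<open>f\<close> and
  \<open>g\<close> reverses the inequality, by homogeneity of degree 2.\<close>

lemma Q_parallelogram:
  assumes "bd f" "bd g"
  shows "Q (\<lambda>x. f x + g x) + Q (\<lambda>x. f x - g x) = 2 * Q f + 2 * Q g"
proof -
  have eq: "(\<lambda>x. f x + g x + (f x - g x)) = (\<lambda>x. 2 * f x)" "(\<lambda>x. f x + g x - (f x - g x)) = (\<lambda>x. 2 * g x)"
    by auto
  show ?thesis
    using Q_parallelogram_le[OF assms] Q_parallelogram_le[OF bd_add[OF assms] bd_diff[OF assms]]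
    unfolding eq Q_scale[OF assms(1)] Q_scale[OF assms(2)] by simp
qed

lemma Q_minus: "bd f \<Longrightarrow> Q (\<lambda>x. - f x) = Q f"
  using Q_scale[of f "-1"] by simp

lemma Q_diff_commute: "bd f \<Longrightarrow> bd g \<Longrightarrow> Q (\<lambda>x. g x - f x) = Q (\<lambda>x. f x - g x)"
  using Q_minus[OF bd_diff[of f g]] by simp

lemma ip_comm: "bd f \<Longrightarrow> bd g \<Longrightarrow> ip f g = ip g f"
  unfolding ip_def by (simp add: Q_diff_commute[of f g] add.commute)

lemma ip_self: "bd f \<Longrightarrow> ip f f = Q f"
proof -
  assume "bd f"
  moreover have "(\<lambda>x. f x + f x) = (\<lambda>x. 2 * f x)" by auto
  ultimately show ?thesis using Q_scale[of f 2] by (simp add: ip_def Q_zero)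
qed

text \<open>The difference of two parallelogram laws with the same \<open>h\<close>, one for
  \<open>f + g\<close> and one for \<open>f - g\<close>.\<close>

lemma ip_double_sum:
  assumes "bd f" "bd g" "bd h"
  shows "ip (\<lambda>x. f x + h x) g + ip (\<lambda>x. f x - h x) g = 2 * ip f g"
proof -
  have add: "Q (\<lambda>x. f x + g x + h x) + Q (\<lambda>x. f x + g x - h x) = 2 * Q (\<lambda>x. f x + g x) + 2 * Q h"
    by (intro Q_parallelogram bd_add assms)
  have diff: "Q (\<lambda>x. f x - g x + h x) + Q (\<lambda>x. f x - g x - h x) = 2 * Q (\<lambda>x. f x - g x) + 2 * Q h"
    by (intro Q_parallelogram bd_diff assms)
  have *: "(a - c) / 4 + (b - d) / 4 = 2 * ((p - q) / 4)"
    if "a + b = 2 * p + 2 * r" "c + d = 2 * q + 2 * r" for a b c d p q r :: real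
    using that by (simp add: field_simps)
  have "(\<lambda>x. f x - h x + g x) = (\<lambda>x. f x + g x - h x)" "(\<lambda>x. f x + h x + g x) = (\<lambda>x. f x + g x + h x)"
    "(\<lambda>x. f x - h x - g x) = (\<lambda>x. f x - g x - h x)" "(\<lambda>x. f x + h x - g x) = (\<lambda>x. f x - g x + h x)"
    by auto
  then show ?thesis unfolding ip_def using *[OF add diff] by (simp only:)
qed

lemma ip_add:
  assumes "bd f" "bd g" "bd h"
  shows "ip (\<lambda>x. f x + g x) h = ip f h + ip g h"
proof -
  have z: "ip (\<lambda>x. 0) h = 0" using Q_minus[OF assms(3)] by (simp add: ip_def)
  have two: "ip (\<lambda>x. 2 * f x) h = 2 * ip f h" if "bd f" for f
  proof -
    have "(\<lambda>x. f x + f x) = (\<lambda>x. 2 * f x)" "(\<lambda>x. f x - f x) = (\<lambda>x. 0)" by auto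
    then show ?thesis using ip_double_sum[OF that assms(3) that] z by (simp only: add_0_right)
  qed
  \<comment> \<open>Half sum and half difference turn \<open>ip_double_sum\<close> into
    additivity.\<close>
  let ?p = "\<lambda>x. (1/2) * (f x + g x)" and ?q = "\<lambda>x. (1/2) * (f x - g x)"
  have b: "bd ?p" "bd ?q" using assms by (intro bd_scale bd_add bd_diff; simp)+
  have e: "(\<lambda>x. ?p x + ?q x) = f" "(\<lambda>x. ?p x - ?q x) = g" "(\<lambda>x. 2 * ?p x) = (\<lambda>x. f x + g x)"
    by (auto simp: field_simps intro!: ext)
  show ?thesis using ip_double_sum[OF b(1) assms(3) b(2)] two[OF b(1)] unfolding e by simp
qed

lemma ip_scale:
  assumes f: "bd f" and g: "bd g"
  shows "ip (\<lambda>x. t * f x) g = t * ip f g"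
proof -
  define \<phi> where "\<phi> t = Q (\<lambda>x. t * f x + g x)" for t
  have par: "\<phi> (t + s) + \<phi> (t - s) = 2 * \<phi> t + 2 * s\<^sup>2 * Q f" for t s
    using Q_parallelogram[of "\<lambda>x. t * f x + g x" "\<lambda>x. s * f x"] f g
    by (simp add: \<phi>_def bd_add bd_scale Q_scale algebra_simps)
  \<comment> \<open>For a true inner product this is \<open>2 * t * ip f g\<close>: the quadratic
    part and the constant \<open>Q g\<close> are removed.\<close>
  define \<psi> where "\<psi> t = \<phi> t - t\<^sup>2 * Q f - \<phi> 0" for t
  have psi0: "\<psi> 0 = 0" by (simp add: \<psi>_def)
  have mid: "\<psi> (t + s) + \<psi> (t - s) = 2 * \<psi> t" for t s
    using par[of t s] by (simp add: \<psi>_def power2_eq_square algebra_simps)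
  have add: "\<psi> (u + v) = \<psi> u + \<psi> v" for u v
  proof -
    have "(u + v) / 2 + (u - v) / 2 = u" "(u + v) / 2 - (u - v) / 2 = v" by (simp_all add: field_simps)
    then show ?thesis
      using mid[of "(u + v) / 2" "(u - v) / 2"] mid[of "(u + v) / 2" "(u + v) / 2"] psi0 by simp
  qed
  have "\<psi> t \<ge> - Q f - \<phi> 0" if "0 \<le> t" "t \<le> 1" for t
  proof -
    have "\<phi> t \<ge> 0" unfolding \<phi>_def using f g by (intro Q_nonneg bd_add bd_scale)
    moreover have "t\<^sup>2 * Q f \<le> Q f"
      using that Q_nonneg[OF f] by (intro mult_left_le_one_le) (auto simp: power_le_one)
    ultimately show ?thesis by (simp add: \<psi>_def)
  qed
  from additive_bounded_below_linear[of \<psi>, OF add this] have lin: "\<psi> t = t * \<psi> 1" for t .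
  have four: "4 * ip (\<lambda>x. t * f x) g = \<phi> t - \<phi> (- t)" for t
  proof -
    have "Q (\<lambda>x. t * f x - g x) = Q (\<lambda>x. g x - t * f x)"
      using f g by (intro Q_diff_commute bd_scale)
    also have "(\<lambda>x. g x - t * f x) = (\<lambda>x. (- t) * f x + g x)" by auto
    finally show ?thesis by (simp add: ip_def \<phi>_def)
  qed
  have "\<phi> t - \<phi> (- t) = 2 * t * \<psi> 1" for t
    using lin[of t] lin[of "- t"] by (simp add: \<psi>_def)
  from this[of t] this[of 1] four[of t] four[of 1] show ?thesis by simp algebra
qed

text \<open>Adding \<open>t\<close> times the section at \<open>y\<close> to \<open>f\<close> shifts
  the argument of the Legendre transform by the pair \<open>(t, y)\<close> and adds a constant. Both
  suprema run over all combinations, so they differ by that constant; polarization with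
  \<open>t = 1\<close> and \<open>t = -1\<close> then yields the reproducing property.\<close>

lemma
  fixes t :: real
  assumes f: "bd f" and y: "y \<in> X"
  shows Q_add_kernel: "Q (\<lambda>x. f x + t * K x y) = Q f + 2 * t * f y + t\<^sup>2 * K y y"
    and bd_kernel: "bd (\<lambda>x. K x y)"
proof -
  have shift: "J (\<lambda>x. f x + t * K x y) ((t, y) # l) = J f l + 2 * t * f y + t\<^sup>2 * K y y"
    if "l \<in> combs" for l f t
  proof -
    have "lin l (\<lambda>x. K x y) = lin l (K y)"
      using that y by (intro lin_cong[of l X]) (auto simp: combs_def K_sym)
    then show ?thesis using quad_append[of "[(t, y)]" l] that y
      by (simp add: J_def lin_add lin_cmult quad_def power2_eq_square algebra_simps)
  qed
  have J_shift: "J (\<lambda>x. f x + t * K x y) l = J f ((- t, y) # l) + 2 * t * f y + t\<^sup>2 * K y y"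
    if "l \<in> combs" for l f t
    using shift[of l "\<lambda>x. f x + t * K x y" "- t"] that by (simp add: power2_eq_square algebra_simps)
  have b: "bd (\<lambda>x. f x + t * K x y)" if "bd f" for f t
    by (rule bdI[where B = "Q f + 2 * t * f y + t\<^sup>2 * K y y"]) (use J_shift J_le_Q[OF that] y in simp)
  show "bd (\<lambda>x. K x y)" using b[OF bd_zero, of 1] by simp
  have "Q (\<lambda>x. f x + t * K x y) \<le> Q f + 2 * t * f y + t\<^sup>2 * K y y"
    by (rule Q_le) (use J_shift J_le_Q[OF f] y in simp)
  moreover have "Q f \<le> Q (\<lambda>x. f x + t * K x y) - 2 * t * f y - t\<^sup>2 * K y y"
    by (rule Q_le) (use shift[of _ f t] J_le_Q[OF b[OF f, of t], of "(t, y) # _"] y in fastforce)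
  ultimately show "Q (\<lambda>x. f x + t * K x y) = Q f + 2 * t * f y + t\<^sup>2 * K y y" by simp
qed

lemma ip_kernel: "bd f \<Longrightarrow> y \<in> X \<Longrightarrow> ip f (\<lambda>x. K x y) = f y"
  using Q_add_kernel[where f = f and y = y and t = 1] Q_add_kernel[where f = f and y = y and t = "-1"] by (simp add: ip_def)

text \<open>By \<open>Q_add_kernel\<close> a quadratic polynomial in \<open>t\<close> is a squared
  norm and hence nonnegative; the bound is the condition on its discriminant.\<close>

lemma eval_bound:
  assumes "bd f" "y \<in> X" shows "(f y)\<^sup>2 \<le> Q f * K y y"
proof -
  have nn: "0 \<le> Q f + 2 * t * f y + t\<^sup>2 * K y y" for t
    using Q_nonneg[OF bd_add[OF assms(1) bd_scale[OF bd_kernel[OF assms]], of t]]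
    unfolding Q_add_kernel[OF assms] .
  have K0: "0 \<le> K y y" using quad_nonneg[of "[(1, y)]"] assms by (simp add: quad_def)
  show ?thesis
  proof (cases "K y y = 0")
    case True
    have "f y = 0"
    proof (rule ccontr)
      assume "f y \<noteq> 0"
      \<comment> \<open>At this \<open>t\<close> the polynomial, affine because
        \<open>K y y = 0\<close>, equals -1.\<close>
      then show False using nn[of "- (Q f + 1) / (2 * f y)"] True by (simp add: field_simps)
    qed
    then show ?thesis using True by simp
  next
    case False
    then show ?thesis using nn[of "- f y / K y y"] K0 by (simp add: field_simps power2_eq_square)
  qed
qed

lemma ip_cong: "(\<And>x. x \<in> X \<Longrightarrow> f x = f' x) \<Longrightarrow> (\<And>x. x \<in> X \<Longrightarrow> g x = g' x) \<Longrightarrow> ip f g = ip f' g'"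
  unfolding ip_def using bd_Q_cong(2)[of "\<lambda>x. f x + g x" "\<lambda>x. f' x + g' x"]
    bd_Q_cong(2)[of "\<lambda>x. f x - g x" "\<lambda>x. f' x - g' x"] by simp

lemma bd_restrict [simp]: "bd (restrict f X) = bd f"
  by (rule bd_Q_cong) simp

text \<open>The limit is taken pointwise, which \<open>eval_bound\<close> permits. Each value of
  \<open>J\<close> involves only finitely many points, so a bound on \<open>J\<close> that is
  uniform in \<open>l\<close> survives pointwise limits and bounds the supremum.\<close>

lemma Q_complete:
  fixes F :: "nat \<Rightarrow> 'a \<Rightarrow> real"
  assumes F: "\<And>n. bd (F n)"
    and cauchy: "\<And>e. 0 < e \<Longrightarrow> \<exists>M. \<forall>m\<ge>M. \<forall>n\<ge>M. sqrt (Q (\<lambda>x. F m x - F n x)) < e"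
  shows "\<exists>f. bd f \<and> (\<lambda>n. sqrt (Q (\<lambda>x. F n x - f x))) \<longlonglongrightarrow> 0"
proof -
  have K0: "0 \<le> K y y" if "y \<in> X" for y
    using quad_nonneg[of "[(1, y)]"] that by (simp add: quad_def)
  have "Cauchy (\<lambda>n. F n y)" if y: "y \<in> X" for y
  proof (rule metric_CauchyI)
    fix e :: real assume e: "0 < e"
    \<comment> \<open>The 1 keeps the denominator positive when \<open>K y y = 0\<close>.\<close>
    define d where "d = e / (sqrt (K y y) + 1)"
    have "d > 0" using e K0[OF y] by (simp add: d_def add_nonneg_pos)
    then obtain M where M: "\<And>m n. m \<ge> M \<Longrightarrow> n \<ge> M \<Longrightarrow> sqrt (Q (\<lambda>x. F m x - F n x)) < d"
      using cauchy by blast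
    have "dist (F m y) (F n y) < e" if "m \<ge> M" "n \<ge> M" for m n
    proof -
      have "\<bar>F m y - F n y\<bar> \<le> sqrt (Q (\<lambda>x. F m x - F n x) * K y y)"
        using eval_bound[OF bd_diff[OF F F] y, of m n] real_le_rsqrt by fastforce
      also have "\<dots> = sqrt (Q (\<lambda>x. F m x - F n x)) * sqrt (K y y)" by (simp add: real_sqrt_mult)
      also have "\<dots> \<le> d * sqrt (K y y)"
        using M[OF that] K0[OF y] by (intro mult_right_mono) auto
      also have "\<dots> < d * (sqrt (K y y) + 1)" using \<open>d > 0\<close> by simp
      also have "\<dots> = e" using K0[OF y] by (simp add: d_def add_nonneg_pos[THEN less_imp_neq, symmetric])
      finally show ?thesis by (simp add: dist_real_def)
    qed
    then show "\<exists>M. \<forall>m\<ge>M. \<forall>n\<ge>M. dist (F m y) (F n y) < e" by blast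
  qed
  then obtain f where f: "\<And>y. y \<in> X \<Longrightarrow> (\<lambda>n. F n y) \<longlonglongrightarrow> f y"
    unfolding Cauchy_convergent_iff convergent_def by metis
  have key: "\<exists>M. \<forall>n\<ge>M. \<forall>l\<in>combs. J (\<lambda>x. F n x - f x) l \<le> e\<^sup>2" if e: "0 < e" for e
  proof -
    obtain M where M: "\<And>m n. m \<ge> M \<Longrightarrow> n \<ge> M \<Longrightarrow> sqrt (Q (\<lambda>x. F m x - F n x)) < e"
      using cauchy[OF e] by blast
    have "J (\<lambda>x. F n x - f x) l \<le> e\<^sup>2" if n: "n \<ge> M" and l: "l \<in> combs" for n l
    proof (rule LIMSEQ_le_const2)
      have "(\<lambda>m. lin l (\<lambda>x. F n x - F m x)) \<longlonglongrightarrow> lin l (\<lambda>x. F n x - f x)"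
        using l by (intro lin_tendsto[of _ X]) (auto simp: combs_def intro!: tendsto_intros f)
      then show "(\<lambda>m. J (\<lambda>x. F n x - F m x) l) \<longlonglongrightarrow> J (\<lambda>x. F n x - f x) l"
        unfolding J_def by (intro tendsto_intros)
      have "J (\<lambda>x. F n x - F m x) l \<le> e\<^sup>2" if "m \<ge> M" for m
      proof -
        have "J (\<lambda>x. F n x - F m x) l \<le> Q (\<lambda>x. F n x - F m x)"
          by (intro J_le_Q bd_diff F l)
        also have "\<dots> = (sqrt (Q (\<lambda>x. F n x - F m x)))\<^sup>2"
          by (simp add: Q_nonneg bd_diff F)
        also have "\<dots> \<le> e\<^sup>2" using M[OF n that] by (intro power_mono) (auto simp: Q_nonneg bd_diff F)
        finally show ?thesis .
      qed
      then show "\<exists>N. \<forall>m\<ge>N. J (\<lambda>x. F n x - F m x) l \<le> e\<^sup>2" by blast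
    qed
    then show ?thesis by blast
  qed
  obtain M where "\<forall>l\<in>combs. J (\<lambda>x. F M x - f x) l \<le> 1\<^sup>2" using key[of 1] by auto
  then have "bd (\<lambda>x. F M x - f x)" by (intro bdI) auto
  \<comment> \<open>Here \<open>f\<close> is written as \<open>F M\<close> minus the difference
    \<open>F M - f\<close>.\<close>
  from bd_diff[OF F this, of M] have "bd f" by simp
  moreover have "(\<lambda>n. sqrt (Q (\<lambda>x. F n x - f x))) \<longlonglongrightarrow> 0"
  proof (rule LIMSEQ_I)
    fix e :: real assume e: "0 < e"
    obtain M where M: "\<And>n l. n \<ge> M \<Longrightarrow> l \<in> combs \<Longrightarrow> J (\<lambda>x. F n x - f x) l \<le> (e/2)\<^sup>2"
      using key[of "e/2"] e by auto
    have "norm (sqrt (Q (\<lambda>x. F n x - f x)) - 0) < e" if "n \<ge> M" for n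
    proof -
      have "Q (\<lambda>x. F n x - f x) \<le> (e/2)\<^sup>2" by (rule Q_le) (rule M[OF that])
      then have "sqrt (Q (\<lambda>x. F n x - f x)) \<le> e/2" using e by (intro real_le_lsqrt) auto
      then show ?thesis using e Q_nonneg[OF bd_diff[OF F \<open>bd f\<close>]] by simp
    qed
    then show "\<exists>no. \<forall>n\<ge>no. norm (sqrt (Q (\<lambda>x. F n x - f x)) - 0) < e" by blast
  qed
  ultimately show ?thesis by blast
qed

lemma rkhs_axioms: "reproducing_kernel_hilbert_space X H ip K"
proof
  show "H \<subseteq> extensional X" by (auto simp: H_def)
  show "(\<lambda>x\<in>X. 0) \<in> H" by (auto simp: H_def bd_zero)
  show "(\<lambda>x\<in>X. f x + g x) \<in> H" if "f \<in> H" "g \<in> H" for f g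
    using that by (auto simp: H_def bd_add)
  show "(\<lambda>x\<in>X. c * f x) \<in> H" if "f \<in> H" for f c
    using that by (auto simp: H_def bd_scale)
  show "ip f g = ip g f" if "f \<in> H" "g \<in> H" for f g
    using that by (auto simp: H_def ip_comm)
  show "ip (\<lambda>x\<in>X. f x + g x) h = ip f h + ip g h" if "f \<in> H" "g \<in> H" "h \<in> H" for f g h
    using that ip_add[of f g h] ip_cong[of "\<lambda>x\<in>X. f x + g x" "\<lambda>x. f x + g x" h h] by (auto simp: H_def)
  show "ip (\<lambda>x\<in>X. c * f x) g = c * ip f g" if "f \<in> H" "g \<in> H" for f g c
    using that ip_scale[of f g c] ip_cong[of "\<lambda>x\<in>X. c * f x" "\<lambda>x. c * f x" g g] by (auto simp: H_def)
  show "0 \<le> ip f f" if "f \<in> H" for f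
    using that by (auto simp: H_def ip_self Q_nonneg)
  show "f = (\<lambda>x\<in>X. 0)" if "f \<in> H" "ip f f = 0" for f
  proof (rule extensionalityI[of _ X])
    show "f x = (\<lambda>x\<in>X. 0) x" if "x \<in> X" for x
      using eval_bound[of f x] that \<open>f \<in> H\<close> \<open>ip f f = 0\<close> by (auto simp: H_def ip_self)
  qed (use that in \<open>auto simp: H_def\<close>)
  show "\<exists>f\<in>H. (\<lambda>n. sqrt (ip (\<lambda>x\<in>X. F n x - f x) (\<lambda>x\<in>X. F n x - f x))) \<longlonglongrightarrow> 0"
    if FH: "\<And>n :: nat. F n \<in> H" and c: "\<And>e. 0 < e \<Longrightarrow> \<exists>M. \<forall>m\<ge>M. \<forall>n\<ge>M.
          sqrt (ip (\<lambda>x\<in>X. F m x - F n x) (\<lambda>x\<in>X. F m x - F n x)) < e" for F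
  proof -
    have F: "bd (F n)" for n using FH by (auto simp: H_def)
    have ipQ: "ip (\<lambda>x\<in>X. g x - h x) (\<lambda>x\<in>X. g x - h x) = Q (\<lambda>x. g x - h x)" if "bd g" "bd h" for g h
      using ip_cong[of "\<lambda>x\<in>X. g x - h x" "\<lambda>x. g x - h x" "\<lambda>x\<in>X. g x - h x" "\<lambda>x. g x - h x"]
        ip_self[OF bd_diff[OF that]] by simp
    obtain f where f: "bd f" "(\<lambda>n. sqrt (Q (\<lambda>x. F n x - f x))) \<longlonglongrightarrow> 0"
      using Q_complete[of F, OF F] c by (auto simp: ipQ F)
    have "Q (\<lambda>x. F n x - restrict f X x) = Q (\<lambda>x. F n x - f x)" for n by (rule bd_Q_cong) simp
    then have "(\<lambda>n. sqrt (ip (\<lambda>x\<in>X. F n x - restrict f X x) (\<lambda>x\<in>X. F n x - restrict f X x))) \<longlonglongrightarrow> 0"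
      using f by (subst ipQ) (auto simp: F)
    then show ?thesis using f(1) by (intro bexI[of _ "restrict f X"]) (auto simp: H_def)
  qed
  show "(\<lambda>x\<in>X. K x y) \<in> H" if "y \<in> X" for y
    using bd_kernel[OF bd_zero that] by (auto simp: H_def)
  show "f y = ip f (\<lambda>x\<in>X. K x y)" if "f \<in> H" "y \<in> X" for f y
    using ip_kernel[of f y] that ip_cong[of f f "\<lambda>x\<in>X. K x y" "\<lambda>x. K x y"] by (auto simp: H_def)
qed

end

text \<open>The pair obtained is the one chosen in \<open>rkhs\<close>, known only through the
  locale; the space constructed above witnesses that there is something to choose.\<close>

lemma rkhs_obtain:
  assumes "psd X K"
  obtains H ip where "reproducing_kernel_hilbert_space X H ip K" "rkhs X K = (H, \<lambda>f. sqrt (ip f f))"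
proof -
  interpret psd_kernel X K by unfold_locales (rule assms)
  define p where "p = (SOME (H', ip'). reproducing_kernel_hilbert_space X H' ip' K)"
  have "case p of (H', ip') \<Rightarrow> reproducing_kernel_hilbert_space X H' ip' K"
    unfolding p_def by (rule someI[of _ "(H, ip)"]) (simp add: rkhs_axioms)
  then show thesis using that[of "fst p" "snd p"] by (auto simp: rkhs_def p_def split: prod.splits)
qed

subsection \<open>Schur multipliers\<close>

text \<open>Closure under products holds by definition here, so that Schur's product theorem is not needed.\<close>

definition schur :: "'a set \<Rightarrow> ('a \<Rightarrow> 'a \<Rightarrow> real) \<Rightarrow> bool" where
  "schur X L \<longleftrightarrow> (\<forall>K. psd X K \<longrightarrow> psd X (\<lambda>x y. L x y * K x y))"

lemma psd_cong: "psd X K" if "\<And>x y. x \<in> X \<Longrightarrow> y \<in> X \<Longrightarrow> K x y = K' x y" "psd X K'"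
proof -
  have "lin l (\<lambda>x. lin l (K x)) = lin l (\<lambda>x. lin l (K' x))" if "snd ` set l \<subseteq> X" for l
    using that \<open>\<And>x y. x \<in> X \<Longrightarrow> y \<in> X \<Longrightarrow> K x y = K' x y\<close>
    by (intro lin_cong[of _ X] lin_cong[of l X]) auto
  then show ?thesis using that by (simp add: psd_def)
qed

lemma schur_cong: "(\<And>x y. x \<in> X \<Longrightarrow> y \<in> X \<Longrightarrow> K x y = K' x y) \<Longrightarrow> schur X K' \<Longrightarrow> schur X K"
  unfolding schur_def by (metis (no_types, lifting) psd_cong)

lemma schur_const: "0 \<le> c \<Longrightarrow> schur X (\<lambda>x y. c)"
  by (auto simp: schur_def psd_def lin_cmult)

text \<open>The factors \<open>f x\<close> and \<open>f y\<close> are absorbed into the coefficients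
  of the combination.\<close>

lemma schur_rank_one: "schur X (\<lambda>x y. f x * f y)"
  unfolding schur_def
proof (intro allI impI)
  fix K :: "'a \<Rightarrow> 'a \<Rightarrow> real" assume K: "psd X K"
  have *: "lin (map (\<lambda>(c, x). (c * f x, x)) l) g = lin l (\<lambda>x. f x * g x)" for l g
    by (induction l) auto
  have "0 \<le> lin l (\<lambda>x. lin l (\<lambda>y. f x * f y * K x y))" if l: "snd ` set l \<subseteq> X" for l
  proof -
    let ?l = "map (\<lambda>(c, x). (c * f x, x)) l"
    have "0 \<le> lin ?l (\<lambda>x. lin ?l (K x))"
      using K l by (auto simp: psd_def image_image case_prod_beta simp del: map_map)
    also have "\<dots> = lin l (\<lambda>x. lin l (\<lambda>y. f x * f y * K x y))"
      by (simp add: * mult.assoc flip: lin_cmult)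
    finally show ?thesis .
  qed
  then show "psd X (\<lambda>x y. f x * f y * K x y)" using K by (auto simp: psd_def)
qed

lemma psd_add: "psd X K \<Longrightarrow> psd X L \<Longrightarrow> psd X (\<lambda>x y. K x y + L x y)"
  by (auto simp: psd_def lin_add)

lemma schur_add: "schur X K \<Longrightarrow> schur X L \<Longrightarrow> schur X (\<lambda>x y. K x y + L x y)"
  unfolding schur_def distrib_right by (simp add: psd_add)

lemma schur_mult: "schur X K \<Longrightarrow> schur X L \<Longrightarrow> schur X (\<lambda>x y. K x y * L x y)"
  unfolding schur_def by (simp add: mult.assoc)

lemma schur_sum: "finite I \<Longrightarrow> (\<And>i. i \<in> I \<Longrightarrow> schur X (K i)) \<Longrightarrow> schur X (\<lambda>x y. \<Sum>i\<in>I. K i x y)"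
  by (induction I rule: finite_induct) (auto intro: schur_const schur_add)

lemma schur_prod: "finite I \<Longrightarrow> (\<And>i. i \<in> I \<Longrightarrow> schur X (K i)) \<Longrightarrow> schur X (\<lambda>x y. \<Prod>i\<in>I. K i x y)"
  by (induction I rule: finite_induct) (auto intro: schur_const schur_mult)

text \<open>Symmetry at two points and nonnegativity of the form at one combination are closed
  conditions on finitely many kernel values.\<close>

lemma schur_limit:
  assumes "\<And>n :: nat. schur X (K n)" and lim: "\<And>x y. x \<in> X \<Longrightarrow> y \<in> X \<Longrightarrow> (\<lambda>n. K n x y) \<longlonglongrightarrow> L x y"
  shows "schur X L"
  unfolding schur_def
proof (intro allI impI)
  fix J :: "'a \<Rightarrow> 'a \<Rightarrow> real" assume "psd X J"
  then have J: "psd X (\<lambda>x y. K n x y * J x y)" for n using assms by (auto simp: schur_def)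
  have "L x y * J x y = L y x * J y x" if "x \<in> X" "y \<in> X" for x y
  proof (rule LIMSEQ_unique)
    show "(\<lambda>n. K n x y * J x y) \<longlonglongrightarrow> L x y * J x y" using that by (intro tendsto_intros lim)
    have "(\<lambda>n. K n x y * J x y) = (\<lambda>n. K n y x * J y x)" using J that by (auto simp: psd_def)
    then show "(\<lambda>n. K n x y * J x y) \<longlonglongrightarrow> L y x * J y x" using that by (auto intro!: tendsto_intros lim)
  qed
  moreover have "0 \<le> lin l (\<lambda>x. lin l (\<lambda>y. L x y * J x y))" if l: "snd ` set l \<subseteq> X" for l
  proof (rule LIMSEQ_le_const)
    show "(\<lambda>n. lin l (\<lambda>x. lin l (\<lambda>y. K n x y * J x y))) \<longlonglongrightarrow> lin l (\<lambda>x. lin l (\<lambda>y. L x y * J x y))"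
      by (intro lin_tendsto[OF l] tendsto_intros lim)
    show "\<exists>N. \<forall>n\<ge>N. 0 \<le> lin l (\<lambda>x. lin l (\<lambda>y. K n x y * J x y))"
      using J l by (auto simp: psd_def)
  qed
  ultimately show "psd X (\<lambda>x y. L x y * J x y)" by (auto simp: psd_def)
qed

text \<open>The multiplier acts on the constant kernel 1, whose quadratic form is the square of the
  sum of the coefficients.\<close>

lemma schur_imp_psd: "schur X K \<Longrightarrow> psd X K"
proof -
  have "psd X (\<lambda>x y. 1)"
    unfolding psd_def
  proof (intro conjI ballI allI impI)
    show "0 \<le> lin l (\<lambda>x. lin l (\<lambda>y. 1))" for l :: "(real \<times> 'a) list"
      using lin_cmult[of l "lin l (\<lambda>y. 1)" "\<lambda>x. 1"] by simp
  qed simp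
  moreover assume "schur X K"
  ultimately have "psd X (\<lambda>x y. K x y * 1)" unfolding schur_def by blast
  then show ?thesis by simp
qed

subsection \<open>Reproducing kernel Hilbert spaces\<close>

context function_hilbert_space
begin

lemma ip_add_right: "f \<in> H \<Longrightarrow> g \<in> H \<Longrightarrow> h \<in> H \<Longrightarrow> ip h (\<lambda>x\<in>X. f x + g x) = ip h f + ip h g"
  using ip_add_left[of f g h] add_mem by (simp add: ip_commute)

lemma ip_scale_right: "f \<in> H \<Longrightarrow> g \<in> H \<Longrightarrow> ip g (\<lambda>x\<in>X. c * f x) = c * ip g f"
  using ip_scale_left[of f g c] scale_mem by (simp add: ip_commute)

lemma cauchy_schwarz:
  assumes "f \<in> H" "g \<in> H" shows "(ip f g)\<^sup>2 \<le> ip f f * ip g g"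
proof -
  have nn: "0 \<le> ip f f + 2 * t * ip f g + t\<^sup>2 * ip g g" for t
  proof -
    let ?g = "\<lambda>x\<in>X. t * g x"
    have g: "?g \<in> H" using assms scale_mem by blast
    have "0 \<le> ip (\<lambda>x\<in>X. f x + ?g x) (\<lambda>x\<in>X. f x + ?g x)"
      using assms g by (intro ip_nonneg add_mem)
    also have "\<dots> = ip f f + ip f ?g + (ip f ?g + ip ?g ?g)"
      using assms g ip_commute[of ?g f] by (simp only: ip_add_left ip_add_right add_mem)
    also have "\<dots> = ip f f + 2 * t * ip f g + t\<^sup>2 * ip g g"
      using assms g by (simp only: ip_scale_left ip_scale_right) (simp add: power2_eq_square)
    finally show ?thesis .
  qed
  show ?thesis
  proof (cases "ip g g = 0")
    case True
    have "ip f g = 0"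
    proof (rule ccontr)
      assume "ip f g \<noteq> 0"
      then show False using nn[of "- (ip f f + 1) / (2 * ip f g)"] True by (simp add: field_simps)
    qed
    then show ?thesis using True by simp
  next
    case False
    then show ?thesis using nn[of "- ip f g / ip g g"] ip_nonneg[OF assms(2)]
      by (simp add: field_simps power2_eq_square)
  qed
qed

end

context reproducing_kernel_hilbert_space
begin

text \<open>The combination of kernel sections is the Riesz representer of the functional
  \<open>lin l\<close>. One induction yields both facts.\<close>

lemma assumes "snd ` set l \<subseteq> X"
  shows comb_mem: "(\<lambda>x\<in>X. lin l (K x)) \<in> H"
    and ip_comb: "\<And>f. f \<in> H \<Longrightarrow> ip f (\<lambda>x\<in>X. lin l (K x)) = lin l f"
proof -
  have "(\<lambda>x\<in>X. lin l (K x)) \<in> H \<and> (\<forall>f\<in>H. ip f (\<lambda>x\<in>X. lin l (K x)) = lin l f)"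
    using assms
  proof (induction l)
    case Nil
    have "ip f (\<lambda>x\<in>X. 0) = 0" if "f \<in> H" for f
      using ip_scale_right[OF zero_mem that, of 0] by simp
    then show ?case using zero_mem unfolding lin_Nil by blast
  next
    case (Cons a l)
    obtain c y where a: "a = (c, y)" by force
    let ?k = "\<lambda>x\<in>X. c * (\<lambda>x\<in>X. K x y) x" and ?l = "\<lambda>x\<in>X. lin l (K x)"
    have y: "y \<in> X" and lX: "snd ` set l \<subseteq> X" using Cons.prems a by auto
    have l: "?l \<in> H" and ipl: "\<And>f. f \<in> H \<Longrightarrow> ip f ?l = lin l f"
      using Cons.IH[OF lX] by blast+
    have k: "?k \<in> H" by (intro scale_mem kernel_mem y)
    have eq: "(\<lambda>x\<in>X. lin (a # l) (K x)) = (\<lambda>x\<in>X. ?k x + ?l x)"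
      by (auto simp: a)
    have "ip f ?k = c * f y" if "f \<in> H" for f
      using ip_scale_right[OF kernel_mem[OF y] that, of c] reproducing[OF that y] by simp
    then show ?case unfolding eq using add_mem[OF k l] ip_add_right[OF k l] ipl by (simp only: a lin_Cons) blast
  qed
  then show "(\<lambda>x\<in>X. lin l (K x)) \<in> H" "\<And>f. f \<in> H \<Longrightarrow> ip f (\<lambda>x\<in>X. lin l (K x)) = lin l f" by auto
qed

text \<open>Cauchy-Schwarz against the representer, whose squared norm is the quadratic form of
  \<open>l\<close>.\<close>

lemma lin_bound:
  assumes "snd ` set l \<subseteq> X" "f \<in> H"
  shows "\<bar>lin l f\<bar> \<le> sqrt (ip f f) * sqrt (lin l (\<lambda>x. lin l (K x)))"
proof -
  let ?q = "\<lambda>x\<in>X. lin l (K x)"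
  have "ip ?q ?q = lin l ?q" by (rule ip_comb[OF assms(1) comb_mem[OF assms(1)]])
  also have "\<dots> = lin l (\<lambda>x. lin l (K x))" by (rule lin_cong[OF assms(1)]) simp
  finally have "(lin l f)\<^sup>2 \<le> ip f f * lin l (\<lambda>x. lin l (K x))"
    using cauchy_schwarz[OF assms(2) comb_mem[OF assms(1)]] ip_comb[OF assms] by simp
  then show ?thesis using real_sqrt_le_mono[of "(lin l f)\<^sup>2"] by (fastforce simp: real_sqrt_mult)
qed

end

subsection \<open>Averages over point sets and Riemann sums\<close>

definition avg :: "'a multiset \<Rightarrow> ('a \<Rightarrow> real) \<Rightarrow> real" where
  "avg P f = (\<Sum>x\<in>#P. f x) / real (size P)"

definition grid :: "nat \<Rightarrow> nat \<Rightarrow> (nat \<Rightarrow> real) multiset" where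
  "grid s M = image_mset (\<lambda>g. \<lambda>j\<in>{1..s}. real (g j) / real M) (mset_set (PiE {1..s} (\<lambda>_. {..<M})))"

lemma avg_cong: "(\<And>x. x \<in># P \<Longrightarrow> f x = g x) \<Longrightarrow> avg P f = avg P g"
  by (simp add: avg_def cong: image_mset_cong)

lemma avg_add: "avg P (\<lambda>x. f x + g x) = avg P f + avg P g"
  by (simp add: avg_def sum_mset.distrib add_divide_distrib)

lemma avg_cmult: "avg P (\<lambda>x. c * f x) = c * avg P f"
  by (simp add: avg_def sum_mset_distrib_left[symmetric])

lemma avg_const: "P \<noteq> {#} \<Longrightarrow> avg P (\<lambda>x. c) = c"
  by (simp add: avg_def)

lemma avg_sum: "avg P (\<lambda>x. \<Sum>i\<in>I. f i x) = (\<Sum>i\<in>I. avg P (f i))"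
  by (induction I rule: infinite_finite_induct) (auto simp: avg_add, simp_all add: avg_def)

lemma avg_mono: "(\<And>x. x \<in># P \<Longrightarrow> f x \<le> g x) \<Longrightarrow> avg P f \<le> avg P g"
  unfolding avg_def by (intro divide_right_mono sum_mset_mono) auto

lemma avg_abs: "\<bar>avg P f\<bar> \<le> avg P (\<lambda>x. \<bar>f x\<bar>)"
proof -
  have "\<bar>\<Sum>x\<in>#P. f x\<bar> \<le> (\<Sum>x\<in>#P. \<bar>f x\<bar>)" by (induction P) auto
  then show ?thesis by (simp add: avg_def divide_right_mono)
qed

lemma avg_image_mset: "avg (image_mset h P) f = avg P (\<lambda>x. f (h x))"
  by (simp add: avg_def image_mset.compositionality comp_def)

lemma avg_mset_set: "avg (mset_set A) f = (\<Sum>x\<in>A. f x) / real (card A)"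
  by (simp add: avg_def sum_unfold_sum_mset)

lemma avg_tendsto:
  "(\<And>x. x \<in># P \<Longrightarrow> (\<lambda>n. f n x) \<longlonglongrightarrow> g x) \<Longrightarrow> (\<lambda>n :: nat. avg P (f n)) \<longlonglongrightarrow> avg P g"
proof -
  assume "\<And>x. x \<in># P \<Longrightarrow> (\<lambda>n. f n x) \<longlonglongrightarrow> g x"
  then have "(\<lambda>n. \<Sum>x\<in>#P. f n x) \<longlonglongrightarrow> (\<Sum>x\<in>#P. g x)"
    by (induction P) (auto intro!: tendsto_intros)
  then show ?thesis unfolding avg_def divide_inverse by (intro tendsto_intros)
qed

text \<open>Brings averages into the form that \<open>lin_bound\<close> accepts;
  \<open>c = -1\<close> serves to subtract one average from another.\<close>

lemma avg_lin: "mset xs = P \<Longrightarrow> lin (map (\<lambda>x. (c / real (size P), x)) xs) f = c * avg P f"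
proof -
  have "lin (map (\<lambda>x. (d, x)) xs) f = d * (\<Sum>x\<in>#mset xs. f x)" for d
    by (induction xs) (auto simp: distrib_left)
  then show "mset xs = P \<Longrightarrow> ?thesis" by (simp add: avg_def)
qed

lemma grid_neq_empty: "M > 0 \<Longrightarrow> grid s M \<noteq> {#}"
proof
  assume "M > 0" "grid s M = {#}"
  then have "PiE {1..s} (\<lambda>_. {..<M}) = {}"
    by (auto simp: grid_def mset_set_empty_iff finite_PiE)
  then show False using \<open>M > 0\<close> by (auto simp: PiE_eq_empty_iff)
qed

lemma grid_subset: "x \<in># grid s M \<Longrightarrow> x \<in> unit_cube s"
  by (auto simp: grid_def unit_cube_def finite_PiE PiE_iff divide_le_eq Ball_def less_imp_le)

lemma avg_grid: "avg (grid s M) f = 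
  (\<Sum>g\<in>PiE {1..s} (\<lambda>_. {..<M}). f (\<lambda>j\<in>{1..s}. real (g j) / real M)) / real M ^ s"
  by (simp add: grid_def avg_image_mset avg_mset_set card_PiE)

lemma avg_grid_prod:
  assumes "u \<subseteq> {1..s}" "M > 0"
  shows "avg (grid s M) (\<lambda>x. \<Prod>j\<in>u. F j (x j)) = (\<Prod>j\<in>u. (\<Sum>i<M. F j (real i / real M)) / real M)"
proof -
  \<comment> \<open>The factor 1 outside \<open>u\<close> lets the product run over all coordinates,
    where it can be exchanged with the sum.\<close>
  define G where "G j t = (if j \<in> u then F j t else 1)" for j t
  have fin: "finite u" using assms finite_subset by blast
  have pG: "(\<Prod>j\<in>u. F j (x j)) = (\<Prod>j\<in>{1..s}. G j (x j))" for x
    using assms by (auto simp: G_def prod.If_cases Int_absorb1)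
  have "avg (grid s M) (\<lambda>x. \<Prod>j\<in>u. F j (x j))
      = (\<Sum>g\<in>PiE {1..s} (\<lambda>_. {..<M}). \<Prod>j\<in>{1..s}. G j (real (g j) / real M)) / real M ^ s"
    unfolding avg_grid pG by simp
  also have "\<dots> = (\<Prod>j\<in>{1..s}. \<Sum>i<M. G j (real i / real M)) / real M ^ s"
    by (subst prod_sum_PiE) auto
  also have "\<dots> = (\<Prod>j\<in>{1..s}. (\<Sum>i<M. G j (real i / real M)) / real M)"
    by (simp add: prod_dividef)
  also have "\<dots> = (\<Prod>j\<in>{1..s}. if j \<in> u then (\<Sum>i<M. F j (real i / real M)) / real M else 1)"
    using assms by (intro prod.cong) (auto simp: G_def)
  also have "\<dots> = (\<Prod>j\<in>u. (\<Sum>i<M. F j (real i / real M)) / real M)"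
    using assms by (auto simp: prod.If_cases Int_absorb1)
  finally show ?thesis .
qed

text \<open>The minimum assigns the right end point 1, where the floor is \<open>M\<close>, to the
  last cell.\<close>

definition grid_index :: "nat \<Rightarrow> real \<Rightarrow> nat" where
  "grid_index M t = min (nat \<lfloor>real M * t\<rfloor>) (M - 1)"

lemma grid_index_less: "M > 0 \<Longrightarrow> grid_index M t < M"
  by (auto simp: grid_index_def)

lemma grid_index_cell:
  assumes "i < M" "0 \<le> t" "t \<le> 1"
  shows "grid_index M t = i \<longleftrightarrow>
    (if i = M - 1 then t \<in> {real i / real M..1} else t \<in> {real i / real M..<real (Suc i) / real M})"
proof (cases "i = M - 1")
  case True
  have "grid_index M t = i \<longleftrightarrow> i \<le> nat \<lfloor>real M * t\<rfloor>" using True by (auto simp: grid_index_def)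
  also have "\<dots> \<longleftrightarrow> real i \<le> real M * t"
    using assms by (simp add: nat_le_eq_zle[symmetric] le_nat_iff le_floor_iff)
  finally show ?thesis using True assms by (auto simp: field_simps)
next
  case False
  have "grid_index M t = i \<longleftrightarrow> nat \<lfloor>real M * t\<rfloor> = i" using False assms by (auto simp: grid_index_def)
  also have "\<dots> \<longleftrightarrow> real i \<le> real M * t \<and> real M * t < real i + 1"
    using assms by (auto simp: nat_eq_iff floor_eq_iff)
  finally show ?thesis using False assms by (auto simp: field_simps)
qed

lemma grid_index_tendsto:
  assumes "0 \<le> t" "t \<le> 1"
  shows "(\<lambda>M. real (grid_index (Suc M) t) / real (Suc M)) \<longlonglongrightarrow> t"
proof (rule real_tendsto_sandwich)
  have *: "real (grid_index M t) / real M \<le> t \<and> t \<le> real (grid_index M t) / real M + 1 / real M" if "M > 0" for M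
    using grid_index_cell[OF grid_index_less[OF that] assms, of t] that assms
    by (auto split: if_splits simp: field_simps of_nat_diff)
  show "\<forall>\<^sub>F n in sequentially. t - 1 / real (Suc n) \<le> real (grid_index (Suc n) t) / real (Suc n)"
    using * by (intro always_eventually) (auto simp: algebra_simps simp del: of_nat_Suc)
  show "\<forall>\<^sub>F n in sequentially. real (grid_index (Suc n) t) / real (Suc n) \<le> t"
    using * by (intro always_eventually) (auto simp del: of_nat_Suc)
  have "(\<lambda>n. t - 1 / real (Suc n)) \<longlonglongrightarrow> t - 0"
    by (intro tendsto_intros LIMSEQ_Suc[OF lim_1_over_n])
  then show "(\<lambda>n. t - 1 / real (Suc n)) \<longlonglongrightarrow> t" by simp
qed auto

text \<open>Sequential continuity in the coordinates is what dominated convergence consumes, and it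
  follows directly from convergence of kernel values.\<close>

definition seq_cont :: "nat \<Rightarrow> ((nat \<Rightarrow> real) \<Rightarrow> real) \<Rightarrow> bool" where
  "seq_cont s f \<longleftrightarrow> (\<forall>X x. (\<forall>n. X n \<in> unit_cube s) \<longrightarrow> x \<in> unit_cube s \<longrightarrow>
     (\<forall>j\<in>{1..s}. (\<lambda>n :: nat. X n j) \<longlonglongrightarrow> x j) \<longrightarrow> (\<lambda>n. f (X n)) \<longlonglongrightarrow> f x)"

text \<open>The grid average is the integral of the step function that evaluates \<open>f\<close> at
  the lower corner of the cell of each point; these step functions converge to \<open>f\<close>
  pointwise and are dominated by \<open>B\<close>.\<close>

lemma avg_grid_tendsto_integral:
  assumes cont: "seq_cont s f" and bounded: "\<And>x. x \<in> unit_cube s \<Longrightarrow> \<bar>f x\<bar> \<le> B"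
  shows "(\<lambda>M. avg (grid s (Suc M)) f) \<longlonglongrightarrow> (\<integral>x. f x \<partial>cube_measure s)"
proof -
  let ?I = "restrict_space lborel {0..1 :: real}"
  let ?G = "\<lambda>M. PiE {1..s} (\<lambda>_. {..<Suc M})" and ?pt = "\<lambda>M g. \<lambda>j\<in>{1..s}. real (g j) / real (Suc M)"
  have em: "emeasure ?I A = emeasure lborel A" if "A \<in> sets borel" "A \<subseteq> {0..1}" for A
    using that by (subst emeasure_restrict_space) auto
  have fI: "finite_measure ?I"
    by (rule finite_measureI) (simp add: space_restrict_space em)
  interpret product_sigma_finite "\<lambda>_ :: nat. ?I"
    unfolding product_sigma_finite_def using fI by (simp add: finite_measure.axioms)
  have space: "space (cube_measure s) = unit_cube s"
    by (simp add: cube_measure_def space_PiM space_restrict_space unit_cube_def)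
  have sets_I: "A \<in> sets ?I" if "A \<in> sets borel" "A \<subseteq> {0..1}" for A
    using that by (auto simp: sets_restrict_space image_iff intro!: bexI[of _ A])
  define p where "p M x = (\<lambda>j\<in>{1..s}. real (grid_index (Suc M) (x j)) / real (Suc M))" for M and x :: "nat \<Rightarrow> real"
  define cell where "cell M i = {t \<in> {0..1}. grid_index (Suc M) t = i}" for M i
  let ?box = "\<lambda>M g. PiE {1..s} (\<lambda>j. cell M (g j))" and ?x = "\<lambda>M i. real i / real (Suc M)"
  have cell_eq: "cell M i = (if i = M then {?x M i..1} else {?x M i..<?x M (Suc i)})"
    if "i < Suc M" for M i
  proof -
    have "0 \<le> t \<and> t \<le> 1" if "t \<in> {?x M i..<?x M (Suc i)}" for t
    proof -
      have "0 \<le> ?x M i" by simp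
      moreover have "?x M (Suc i) \<le> 1" using \<open>i < Suc M\<close> by (simp add: divide_le_eq)
      ultimately show ?thesis using that unfolding atLeastLessThan_iff by linarith
    qed
    moreover have "0 \<le> t" if "?x M i \<le> t" for t
      using that by (rule order_trans[rotated]) simp
    ultimately have "t \<in> cell M i \<longleftrightarrow> t \<in> (if i = M then {?x M i..1} else {?x M i..<?x M (Suc i)})" for t
      using grid_index_cell[OF that, of t] by (cases "0 \<le> t \<and> t \<le> 1") (auto simp: cell_def simp del: of_nat_Suc)
    then show ?thesis by blast
  qed
  have cell_sets: "cell M i \<in> sets ?I" if "i < Suc M" for M i
  proof (rule sets_I)
    show "cell M i \<in> sets borel" using that by (simp add: cell_eq)
  qed (auto simp: cell_def)
  have cell_measure: "emeasure ?I (cell M i) = ennreal (1 / real (Suc M))" if "i < Suc M" for M i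
  proof -
    have cell_le: "cell M i \<subseteq> {0..1}" by (auto simp: cell_def)
    have b: "cell M i \<in> sets borel" by (simp add: cell_eq that del: of_nat_Suc)
    have "real i \<le> real (Suc M)" using that by simp
    then show ?thesis
      using em[OF b cell_le] by (auto simp: cell_eq[OF that] field_simps diff_divide_distrib[symmetric])
  qed
  have box_sets: "?box M g \<in> sets (cube_measure s)"
    if "g \<in> ?G M" for M g
    unfolding cube_measure_def using that by (intro sets_PiM_I_finite) (auto intro!: cell_sets)
  have box_measure: "emeasure (cube_measure s) (?box M g) = ennreal (1 / real (Suc M) ^ s)"
    if "g \<in> ?G M" for M g
  proof -
    have "emeasure (cube_measure s) (?box M g) = (\<Prod>j\<in>{1..s}. emeasure ?I (cell M (g j)))"
      unfolding cube_measure_def using that by (intro emeasure_PiM) (auto intro!: cell_sets)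
    also have "\<dots> = (\<Prod>j\<in>{1..s}. ennreal (1 / real (Suc M)))"
      using that by (intro prod.cong cell_measure) auto
    finally show ?thesis by (simp add: ennreal_power power_one_over del: of_nat_Suc)
  qed
  \<comment> \<open>Exactly one box contains \<open>x\<close>, the one indexed by its cell
    numbers.\<close>
  have step: "f (p M x) = (\<Sum>g\<in>?G M. f (?pt M g) *
      indicator (?box M g) x)" if "x \<in> unit_cube s" for M x
  proof -
    define h where "h = (\<lambda>j\<in>{1..s}. grid_index (Suc M) (x j))"
    have h: "h \<in> ?G M" by (auto simp: h_def grid_index_less simp del: less_Suc_eq)
    have ind: "x \<in> ?box M g \<longleftrightarrow> g = h" if "g \<in> ?G M" for g
    proof
      assume "x \<in> ?box M g"
      then show "g = h" using that h by (intro PiE_ext[OF that h]) (auto simp: h_def cell_def PiE_iff)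
    next
      assume "g = h" then show "x \<in> ?box M g"
        using \<open>x \<in> unit_cube s\<close> by (auto simp: unit_cube_def PiE_iff cell_def h_def)
    qed
    have "(\<Sum>g\<in>?G M. f (?pt M g) *
      indicator (?box M g) x) =
      (\<Sum>g\<in>?G M. if g = h then f (?pt M g) else 0)"
      by (rule sum.cong) (simp_all only: indicator_def ind mult_1_right mult_zero_right if_distrib[of "(*) _"] of_bool_def)
    also have "\<dots> = f (\<lambda>j\<in>{1..s}. real (h j) / real (Suc M))"
      using h by (simp add: sum.delta finite_PiE)
    also have "\<dots> = f (p M x)" by (simp add: p_def h_def cong: restrict_cong)
    finally show ?thesis by simp
  qed
  have int_ind: "has_bochner_integral (cube_measure s) (\<lambda>x. c * indicator (?box M g) x) (c * (1 / real (Suc M) ^ s))"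
    if "g \<in> ?G M" for M g and c :: real
  proof (rule has_bochner_integral_mult_right)
    have "has_bochner_integral (cube_measure s) (indicator (?box M g))
      (measure (cube_measure s) (?box M g))"
      by (rule has_bochner_integral_real_indicator[OF box_sets[OF that]]) (simp only: box_measure[OF that], simp)
    then show "has_bochner_integral (cube_measure s) (indicator (?box M g)) (1 / real (Suc M) ^ s)"
      by (simp only: measure_def box_measure[OF that]) simp
  qed
  have hb: "has_bochner_integral (cube_measure s) (\<lambda>x. f (p M x)) (avg (grid s (Suc M)) f)" for M
  proof -
    have "has_bochner_integral (cube_measure s) (\<lambda>x. \<Sum>g\<in>?G M. f (?pt M g) *
      indicator (?box M g) x) (\<Sum>g\<in>?G M. f (?pt M g) * (1 / real (Suc M) ^ s))"
      by (intro has_bochner_integral_sum int_ind)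
    also have "(\<Sum>g\<in>?G M. f (?pt M g) * (1 / real (Suc M) ^ s)) = avg (grid s (Suc M)) f"
      by (simp add: avg_grid sum_divide_distrib del: of_nat_Suc)
    finally show ?thesis
      by (subst has_bochner_integral_cong[OF refl _ refl]) (simp_all only: space step)
  qed
  have p_mem: "p M x \<in> unit_cube s" for M x
    using grid_index_less[of "Suc M"] by (auto simp: p_def unit_cube_def divide_le_eq intro!: less_imp_le simp del: of_nat_Suc less_Suc_eq)
  have lim: "(\<lambda>M. f (p M x)) \<longlonglongrightarrow> f x" if "x \<in> unit_cube s" for x
    using cont that unfolding seq_cont_def
    by (elim allE[of _ "\<lambda>M. p M x"] allE[of _ x]) 
      (auto simp: p_mem, auto simp: p_def unit_cube_def PiE_iff intro!: grid_index_tendsto simp del: of_nat_Suc)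
  have "(\<lambda>M. \<integral>x. f (p M x) \<partial>cube_measure s) \<longlonglongrightarrow> (\<integral>x. f x \<partial>cube_measure s)"
  proof (rule integral_dominated_convergence[where w = "\<lambda>_. B"])
    show "(\<lambda>x. f (p M x)) \<in> borel_measurable (cube_measure s)" for M
      using hb[of M] by (rule borel_measurable_has_bochner_integral)
    \<comment> \<open>Measurability of \<open>f\<close> is inherited from the step functions that
      converge to it.\<close>
    show "f \<in> borel_measurable (cube_measure s)"
      by (rule borel_measurable_LIMSEQ_real[where u = "\<lambda>M x. f (p M x)"])
        (use hb in \<open>auto simp: space intro: lim borel_measurable_has_bochner_integral\<close>)
    have "emeasure (cube_measure s) (space (cube_measure s)) = emeasure (cube_measure s) (PiE {1..s} (\<lambda>_. {0..1}))"
      by (simp add: space unit_cube_def)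
    also have "\<dots> = (\<Prod>j\<in>{1..s}. emeasure ?I {0..1})"
      unfolding cube_measure_def by (intro emeasure_PiM) (auto intro!: sets_I)
    also have "\<dots> = 1" by (simp add: em)
    finally show "integrable (cube_measure s) (\<lambda>_. B)"
      by (intro finite_measure.integrable_const finite_measureI) simp
    show "AE x in cube_measure s. (\<lambda>M. f (p M x)) \<longlonglongrightarrow> f x" by (auto simp: space intro!: AE_I2 lim)
    show "AE x in cube_measure s. norm (f (p M x)) \<le> B" for M
      by (auto simp: space intro!: AE_I2 bounded p_mem)
  qed
  then show ?thesis using has_bochner_integral_integral_eq[OF hb] by simp
qed

subsection \<open>The worst-case error\<close>

text \<open>Mean one is expressed by grid averages with a rate \<delta> that is uniform in the other
  variable. The uniformity is what makes the double average over the grid converge too.\<close>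

locale mean_one_kernel =
  fixes s :: nat and K :: "(nat \<Rightarrow> real) \<Rightarrow> (nat \<Rightarrow> real) \<Rightarrow> real" and B :: real and \<delta> :: "nat \<Rightarrow> real"
  assumes K_psd: "psd (unit_cube s) K"
    and K_bounded: "\<And>x. x \<in> unit_cube s \<Longrightarrow> K x x \<le> B"
    and K_cont: "\<And>x y X Y. \<lbrakk>\<And>n. X n \<in> unit_cube s; \<And>n. Y n \<in> unit_cube s; x \<in> unit_cube s; y \<in> unit_cube s;
      \<And>j. j \<in> {1..s} \<Longrightarrow> (\<lambda>n :: nat. X n j) \<longlonglongrightarrow> x j; \<And>j. j \<in> {1..s} \<Longrightarrow> (\<lambda>n. Y n j) \<longlonglongrightarrow> y j\<rbrakk>
      \<Longrightarrow> (\<lambda>n. K (X n) (Y n)) \<longlonglongrightarrow> K x y"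
    and K_mean: "\<And>M x. x \<in> unit_cube s \<Longrightarrow> \<bar>avg (grid s (Suc M)) (K x) - 1\<bar> \<le> \<delta> M"
    and \<delta>: "\<delta> \<longlonglongrightarrow> 0"
begin

text \<open>The integral is replaced by averages over finer and finer grids: their representers are
  explicit combinations of kernel sections, so neither Riesz representation nor membership of the
  constant function in the space has to be shown.\<close>

theorem worst_case_error_eq:
  assumes P: "P \<noteq> {#}" "set_mset P \<subseteq> unit_cube s"
  shows "worst_case_error s P (rkhs (unit_cube s) K) = ereal (sqrt (avg P (\<lambda>x. avg P (K x)) - 1))"
    and "1 \<le> avg P (\<lambda>x. avg P (K x))"
proof -
  let ?X = "unit_cube s"
  let ?a = "\<lambda>M. avg (grid s (Suc M))" and ?I = "\<lambda>f. \<integral>x. f x \<partial>cube_measure s"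
  let ?KK = "avg P (\<lambda>x. avg P (K x))"
  define E where "E = ?KK - 1"
  obtain H ip where "reproducing_kernel_hilbert_space ?X H ip K"
    and V: "rkhs ?X K = (H, \<lambda>f. sqrt (ip f f))"
    using rkhs_obtain[OF K_psd] by blast
  then interpret reproducing_kernel_hilbert_space ?X H ip K by blast
  have sym: "K x y = K y x" if "x \<in> ?X" "y \<in> ?X" for x y
    using K_psd that by (auto simp: psd_def)
  have conv: "(\<lambda>M. ?a M f) \<longlonglongrightarrow> ?I f" if f: "f \<in> H" for f
  proof (rule avg_grid_tendsto_integral)
    \<comment> \<open>Continuity of \<open>f\<close> comes from the kernel, since
      \<open>f x - f y\<close> is a combination of two evaluations.\<close>
    have bd: "\<bar>f x - f y\<bar> \<le> sqrt (ip f f) * sqrt (K x x - K x y - (K y x - K y y))" if "x \<in> ?X" "y \<in> ?X" for x y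
      using lin_bound[of "[(1, x), (-1, y)]" f] that f by (simp add: algebra_simps)
    show "seq_cont s f" unfolding seq_cont_def
    proof (intro allI impI)
      fix Y :: "nat \<Rightarrow> nat \<Rightarrow> real" and x
      assume Y: "\<forall>n. Y n \<in> ?X" and x: "x \<in> ?X" and lim: "\<forall>j\<in>{1..s}. (\<lambda>n. Y n j) \<longlonglongrightarrow> x j"
      let ?d = "\<lambda>n. sqrt (ip f f) * sqrt (K (Y n) (Y n) - K (Y n) x - (K x (Y n) - K x x))"
      have "(\<lambda>n. K (Y n) (Y n)) \<longlonglongrightarrow> K x x"
        by (rule K_cont) (use Y x lim in blast)+
      moreover have "(\<lambda>n. K (Y n) x) \<longlonglongrightarrow> K x x"
        by (rule K_cont[where Y = "\<lambda>_. x"]) (use Y x lim in \<open>blast intro: tendsto_const\<close>)+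
      moreover have "(\<lambda>n. K x (Y n)) \<longlonglongrightarrow> K x x"
        by (rule K_cont[where X = "\<lambda>_. x"]) (use Y x lim in \<open>blast intro: tendsto_const\<close>)+
      ultimately have "?d \<longlonglongrightarrow> sqrt (ip f f) * sqrt (K x x - K x x - (K x x - K x x))"
        by (intro tendsto_mult tendsto_real_sqrt tendsto_diff tendsto_const)
      then have d0: "?d \<longlonglongrightarrow> 0" by simp
      have "(\<lambda>n. f (Y n) - f x) \<longlonglongrightarrow> 0"
        by (rule Lim_null_comparison[OF always_eventually d0]) (auto intro!: bd Y[rule_format] x)
      then show "(\<lambda>n. f (Y n)) \<longlonglongrightarrow> f x" by (rule LIM_zero_cancel)
    qed
    show "\<bar>f x\<bar> \<le> sqrt (ip f f) * sqrt B" if "x \<in> ?X" for x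
    proof -
      have "\<bar>f x\<bar> \<le> sqrt (ip f f) * sqrt (K x x)" using lin_bound[of "[(1, x)]" f] that f by simp
      also have "\<dots> \<le> sqrt (ip f f) * sqrt B"
        using K_bounded[OF that] ip_nonneg[OF f] by (intro mult_left_mono) auto
      finally show ?thesis .
    qed
  qed
  have "\<exists>xs. mset xs = P" by (rule ex_mset)
  then obtain xs where xs: "mset xs = P" by blast
  have "\<exists>gs. \<forall>M. mset (gs M) = grid s (Suc M)" using ex_mset by (intro choice) blast
  then obtain gs where gs: "\<And>M. mset (gs M) = grid s (Suc M)" by blast
  let ?lG = "\<lambda>M. lin (map (\<lambda>x. (1 / real (size (grid s (Suc M))), x)) (gs M))" and ?lP = "lin (map (\<lambda>x. (1 / real (size P), x)) xs)"
  \<comment> \<open>Average over \<open>P\<close> minus average over the grid: a finite stand-in for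
    the error functional.\<close>
  define l where "l M = map (\<lambda>x. (1 / real (size P), x)) xs @
     map (\<lambda>x. (-1 / real (size (grid s (Suc M))), x)) (gs M)" for M
  have gX: "set (gs M) \<subseteq> ?X" for M using gs[of M] grid_subset[of _ s "Suc M"] by (metis set_mset_mset subsetI)
  have l_X: "snd ` set (l M) \<subseteq> ?X" for M
    using xs P(2) gX[of M] by (auto simp: l_def image_image)
  have lin_l: "lin (l M) f = avg P f - ?a M f" for M f
    unfolding l_def lin_append avg_lin[OF xs] avg_lin[OF gs] by simp
  have L_lim: "(\<lambda>M. lin (l M) f) \<longlonglongrightarrow> avg P f - ?I f" if "f \<in> H" for f
    unfolding lin_l by (intro tendsto_intros conv that)
  have mean_P: "(\<lambda>M. ?a M (K x)) \<longlonglongrightarrow> 1" if "x \<in> ?X" for x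
    by (rule LIM_zero_cancel, rule Lim_null_comparison[OF _ \<delta>])
       (use K_mean[OF that] in auto)
  have PgK: "(\<lambda>M. avg P (\<lambda>x. ?a M (K x))) \<longlonglongrightarrow> 1"
    using avg_tendsto[of P "\<lambda>M x. ?a M (K x)" "\<lambda>_. 1"] mean_P P by (auto simp: avg_const)
  have gPK: "?a M (\<lambda>x. avg P (K x)) = avg P (\<lambda>x. ?a M (K x))" for M
  proof -
    have "?a M (\<lambda>x. avg P (K x)) = ?lG M (\<lambda>x. ?lP (K x))"
      unfolding avg_lin[OF xs] avg_lin[OF gs] by simp
    also have "\<dots> = ?lP (\<lambda>y. ?lG M (\<lambda>x. K x y))"
      by (rule lin_swap)
    also have "\<dots> = avg P (\<lambda>y. ?a M (\<lambda>x. K x y))"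
      unfolding avg_lin[OF xs] avg_lin[OF gs] by simp
    also have "\<dots> = avg P (\<lambda>y. ?a M (K y))"
      using P(2) grid_subset by (intro avg_cong sym) auto
    finally show ?thesis .
  qed
  have ggK: "(\<lambda>M. ?a M (\<lambda>x. ?a M (K x))) \<longlonglongrightarrow> 1"
  proof (rule LIM_zero_cancel, rule Lim_null_comparison[OF _ \<delta>], rule always_eventually, rule allI)
    fix M
    have ne: "grid s (Suc M) \<noteq> {#}" by (rule grid_neq_empty) simp
    have "?a M (\<lambda>x. ?a M (K x)) - 1 = ?a M (\<lambda>x. ?a M (K x) + (-1))" by (simp only: avg_add avg_const[OF ne])
    also have "\<bar>\<dots>\<bar> \<le> ?a M (\<lambda>x. \<bar>?a M (K x) + (-1)\<bar>)" by (rule avg_abs)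
    also have "\<dots> \<le> ?a M (\<lambda>x. \<delta> M)" using K_mean grid_subset by (intro avg_mono) fastforce
    also have "\<dots> = \<delta> M" by (rule avg_const[OF ne])
    finally show "norm (?a M (\<lambda>x. ?a M (K x)) - 1) \<le> \<delta> M" by simp
  qed
  \<comment> \<open>The squared norm of this stand-in, as the representer shows.\<close>
  define EM where "EM M = lin (l M) (\<lambda>x. lin (l M) (K x))" for M
  have EM: "EM \<longlonglongrightarrow> E"
  proof -
    have EM_eq: "EM M = ?KK - avg P (\<lambda>x. ?a M (K x))
       - (avg P (\<lambda>x. ?a M (K x)) - ?a M (\<lambda>x. ?a M (K x)))" for M
    proof -
      have d: "avg Q (\<lambda>x. f x - g x) = avg Q f - avg Q g" for Q :: "(nat \<Rightarrow> real) multiset" and f g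
        using avg_add[of Q f "\<lambda>x. (-1) * g x"] by (simp only: avg_cmult) simp
      show ?thesis unfolding EM_def lin_l by (simp add: d gPK)
    qed
    have "EM \<longlonglongrightarrow> ?KK - 1 - (1 - 1)"
      unfolding EM_eq[abs_def] by (intro tendsto_intros PgK ggK)
    then show ?thesis by (simp add: E_def)
  qed
  have EM_nonneg: "0 \<le> EM M" for M using K_psd l_X[of M] by (auto simp: EM_def psd_def)
  have E0: "0 \<le> E" using LIMSEQ_le_const[OF EM, of 0] EM_nonneg by blast
  then show "1 \<le> ?KK" by (simp add: E_def)
  let ?L = "\<lambda>f. avg P f - ?I f"
  have upper: "\<bar>?L f\<bar> \<le> sqrt E" if f: "f \<in> H" "sqrt (ip f f) \<le> 1" for f
  proof (rule LIMSEQ_le)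
    show "(\<lambda>M. \<bar>lin (l M) f\<bar>) \<longlonglongrightarrow> \<bar>?L f\<bar>" by (intro tendsto_intros L_lim f)
    show "(\<lambda>M. sqrt (EM M)) \<longlonglongrightarrow> sqrt E" by (intro tendsto_intros EM)
    have "\<bar>lin (l M) f\<bar> \<le> sqrt (EM M)" for M
    proof -
      have "\<bar>lin (l M) f\<bar> \<le> sqrt (ip f f) * sqrt (EM M)"
        unfolding EM_def by (rule lin_bound[OF l_X f(1)])
      also have "\<dots> \<le> 1 * sqrt (EM M)" by (intro mult_right_mono f) (simp add: EM_nonneg)
      finally show ?thesis by simp
    qed
    then show "\<exists>N. \<forall>n\<ge>N. \<bar>lin (l n) f\<bar> \<le> sqrt (EM n)" by blast
  qed
  have wce: "worst_case_error s P (rkhs ?X K) = (SUP f\<in>{f \<in> H. sqrt (ip f f) \<le> 1}. ereal \<bar>?L f\<bar>)"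
    by (simp add: worst_case_error_def V avg_def)
  let ?S = "SUP f\<in>{f \<in> H. sqrt (ip f f) \<le> 1}. ereal \<bar>?L f\<bar>"
  have "ereal (sqrt E) \<le> ?S"
  \<comment> \<open>For \<open>E = 0\<close> a normalization by \<open>sqrt E\<close> is impossible;
    there the zero function provides the value.\<close>
  proof (cases "E = 0")
    case True
    have "ip (\<lambda>x\<in>?X. 0) (\<lambda>x\<in>?X. 0) = 0" using ip_scale_left[OF zero_mem zero_mem, of 0] by simp
    then have "(\<lambda>x\<in>?X. 0) \<in> {f \<in> H. sqrt (ip f f) \<le> 1}" using zero_mem by (simp only: mem_Collect_eq) simp
    then have "ereal \<bar>?L (\<lambda>x\<in>?X. 0)\<bar> \<le> ?S" by (rule SUP_upper)
    moreover have "ereal (sqrt E) \<le> ereal \<bar>?L (\<lambda>x\<in>?X. 0)\<bar>" using True by simp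
    ultimately show ?thesis by (rule order_trans[rotated])
  next
    case False
    define q where "q M = (\<lambda>x\<in>?X. lin (l M) (K x))" for M
    have q: "q M \<in> H" for M unfolding q_def by (rule comb_mem[OF l_X])
    \<comment> \<open>The representer has integral zero: the coefficients of \<open>l M\<close> sum
      to zero and every kernel section has mean 1.\<close>
    have int_q: "?I (q M) = 0" for M
    proof (rule LIMSEQ_unique[OF conv[OF q]])
      have "?a m (q M) = lin (l M) (\<lambda>y. ?a m (K y))" for m
      proof -
        have "?a m (q M) = ?a m (\<lambda>x. lin (l M) (K x))"
          using grid_subset by (intro avg_cong) (auto simp: q_def)
        also have "\<dots> = ?lG m (\<lambda>x. lin (l M) (K x))"
          unfolding avg_lin[OF gs] by simp
        also have "\<dots> = lin (l M) (\<lambda>y. ?lG m (\<lambda>x. K x y))"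
          by (rule lin_swap)
        also have "\<dots> = lin (l M) (\<lambda>y. ?a m (\<lambda>x. K x y))"
          unfolding avg_lin[OF gs] by simp
        also have "\<dots> = lin (l M) (\<lambda>y. ?a m (K y))"
          using grid_subset by (intro lin_cong[OF l_X] avg_cong sym) auto
        finally show ?thesis .
      qed
      moreover have "(\<lambda>m. lin (l M) (\<lambda>y. ?a m (K y))) \<longlonglongrightarrow> lin (l M) (\<lambda>y. 1)"
        by (intro lin_tendsto[OF l_X] mean_P)
      moreover have "lin (l M) (\<lambda>y. 1) = 0"
        unfolding lin_l using P grid_neq_empty[of "Suc M" s] by (simp add: avg_const)
      ultimately show "(\<lambda>m. ?a m (q M)) \<longlonglongrightarrow> 0" by simp
    qed
    have qq: "ip (q M) (q M) = EM M" for M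
    proof -
      have "ip (q M) (q M) = lin (l M) (q M)" unfolding q_def by (rule ip_comb[OF l_X comb_mem[OF l_X]])
      also have "\<dots> = EM M" unfolding EM_def q_def by (rule lin_cong[OF l_X]) simp
      finally show ?thesis .
    qed
    have avgq: "avg P (q M) = ?KK - avg P (\<lambda>x. ?a M (K x))" for M
    proof -
      have "avg P (q M) = avg P (\<lambda>x. lin (l M) (K x))"
        using P by (intro avg_cong) (auto simp: q_def)
      also have "\<dots> = avg P (\<lambda>x. avg P (K x) + (-1) * ?a M (K x))"
        unfolding lin_l by simp
      finally show ?thesis unfolding avg_add avg_cmult by simp
    qed
    have bound: "ereal (avg P (q M) / sqrt (EM M)) \<le> ?S" if "EM M > 0" for M
    proof -
      let ?f = "\<lambda>x\<in>?X. (1 / sqrt (EM M)) * q M x"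
      have f: "?f \<in> H" by (intro scale_mem q)
      have "ip ?f ?f = 1 / sqrt (EM M) * (1 / sqrt (EM M) * EM M)"
        by (simp only: ip_scale_left[OF q f] ip_scale_right[OF q q] qq)
      then have n: "sqrt (ip ?f ?f) \<le> 1" using that by simp
      have "(\<integral>x. ?f x \<partial>cube_measure s) = (\<integral>x. (1 / sqrt (EM M)) * q M x \<partial>cube_measure s)"
        by (intro Bochner_Integration.integral_cong)
           (auto simp: cube_measure_def space_PiM space_restrict_space unit_cube_def)
      also have "\<dots> = (1 / sqrt (EM M)) * ?I (q M)"
        by (rule integral_mult_right_zero)
      also have "\<dots> = 0" by (simp only: int_q mult_zero_right)
      finally have "?L ?f = avg P ?f" by simp
      also have "\<dots> = avg P (\<lambda>x. (1 / sqrt (EM M)) * q M x)"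
        using P by (intro avg_cong) auto
      also have "\<dots> = avg P (q M) / sqrt (EM M)" unfolding avg_cmult by simp
      finally have "ereal (avg P (q M) / sqrt (EM M)) \<le> ereal \<bar>?L ?f\<bar>"
        by (simp only: ereal_less_eq abs_ge_self)
      also have "\<dots> \<le> ?S" using f n by (intro SUP_upper) blast
      finally show ?thesis .
    qed
    \<comment> \<open>The normalized representers are asymptotically extremal: the numerator tends
      to \<open>E\<close>, the denominator to \<open>sqrt E\<close>.\<close>
    have "(\<lambda>M. avg P (q M) / sqrt (EM M)) \<longlonglongrightarrow> E / sqrt E"
      unfolding avgq E_def[symmetric] using False
      by (intro tendsto_intros EM, unfold E_def) (intro tendsto_intros PgK, simp)
    then have lim: "(\<lambda>M. ereal (avg P (q M) / sqrt (EM M))) \<longlonglongrightarrow> ereal (sqrt E)"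
      using E0 by (simp add: real_div_sqrt)
    have "\<forall>\<^sub>F M in sequentially. EM M > 0"
      using order_tendstoD(1)[OF EM, of 0] E0 False by simp
    then have ev: "\<forall>\<^sub>F M in sequentially. ereal (avg P (q M) / sqrt (EM M)) \<le> ?S"
      by eventually_elim (rule bound)
    show ?thesis by (rule tendsto_upperbound[OF lim ev]) simp
  qed
  moreover have "?S \<le> ereal (sqrt E)" using upper by (intro SUP_least) auto
  ultimately show "worst_case_error s P (rkhs ?X K) = ereal (sqrt (?KK - 1))"
    unfolding wce by (simp add: E_def order_antisym)
qed

end

subsection \<open>Fourier expansion of the Bernoulli polynomials\<close>

lemma bernpoly_deriv: "(bernpoly (Suc n) has_real_derivative real (Suc n) * bernpoly n x) (at x)"
proof -
  have "((\<lambda>x. \<Sum>k\<le>Suc n. real (Suc n choose k) * bernoulli k * x ^ (Suc n - k)) has_real_derivative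
     (\<Sum>k\<le>Suc n. real (Suc n choose k) * bernoulli k * (real (Suc n - k) * x ^ (Suc n - k - 1)))) (at x)"
    by (auto intro!: derivative_eq_intros sum.cong simp: mult_ac simp del: binomial_Suc_Suc)
  also have "(\<Sum>k\<le>Suc n. real (Suc n choose k) * bernoulli k * (real (Suc n - k) * x ^ (Suc n - k - 1)))
    = (\<Sum>k\<le>n. real (Suc n choose k) * bernoulli k * (real (Suc n - k) * x ^ (Suc n - k - 1)))"
    by simp
  also have "\<dots> = (\<Sum>k\<le>n. real (Suc n) * (real (n choose k) * bernoulli k * x ^ (n - k)))"
  proof (intro sum.cong refl)
    fix k assume "k \<in> {..n}"
    have "(Suc n - k) * (Suc n choose k) = Suc n * (n choose k)"
      using binomial_absorb_comp[of "Suc n" k] by simp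
    then have "real (Suc n - k) * real (Suc n choose k) = real (Suc n) * real (n choose k)"
      by (metis of_nat_mult)
    then have "real (Suc n - k) * real (Suc n choose k) * (bernoulli k * x ^ (n - k))
      = real (Suc n) * real (n choose k) * (bernoulli k * x ^ (n - k))" by simp
    then show "real (Suc n choose k) * bernoulli k * (real (Suc n - k) * x ^ (Suc n - k - 1))
      = real (Suc n) * (real (n choose k) * bernoulli k * x ^ (n - k))"
      by (simp only: mult_ac diff_Suc_1 diff_Suc_eq_diff_pred) (simp add: mult_ac)
  qed
  also have "\<dots> = real (Suc n) * bernpoly n x" by (simp add: bernpoly_def sum_distrib_left)
  finally show ?thesis unfolding bernpoly_def[of "Suc n", abs_def] .
qed

lemma bernpoly_at_0: "bernpoly n 0 = bernoulli n"
proof -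
  have "bernpoly n 0 = (\<Sum>k\<le>n. if k = n then bernoulli k else 0)"
    unfolding bernpoly_def by (intro sum.cong) (auto simp: power_0_left)
  then show ?thesis by simp
qed

text \<open>This is the recursion of the Bernoulli numbers in disguise, and it gives the polynomials
  of positive degree mean zero. It starts at degree 2, since in degree 1 the end values are -1/2 and
  1/2.\<close>

lemma bernpoly_ends: "bernpoly (Suc (Suc n)) 1 = bernpoly (Suc (Suc n)) 0"
proof -
  have "bernpoly (Suc (Suc n)) 1 = (\<Sum>k\<le>n. real ((n + 2) choose k) * bernoulli k)
      + real (n + 2) * bernoulli (Suc n) + bernoulli (Suc (Suc n))"
    unfolding bernpoly_def by (simp add: binomial_eq_0_iff del: bernoulli.simps binomial_Suc_Suc)
  also have "real (n + 2) * bernoulli (Suc n) = - (\<Sum>k\<le>n. real ((n + 2) choose k) * bernoulli k)"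
    by (simp del: binomial_Suc_Suc)
  finally show ?thesis by (simp add: bernpoly_at_0)
qed

lemma bernpoly_1: "bernpoly 1 x = x - 1 / 2" and bernpoly_2: "bernpoly 2 x = x\<^sup>2 - x + 1 / 6"
  by (simp_all add: bernpoly_def numeral_2_eq_2 field_simps)

lemma bernpoly_cont [continuous_intros]:
  "continuous_on A f \<Longrightarrow> continuous_on A (\<lambda>x. bernpoly n (f x))"
  unfolding bernpoly_def by (intro continuous_intros)

lemma bernpoly_bounded: "\<exists>L\<ge>0. \<forall>x\<in>{0..1}. \<bar>bernpoly n x\<bar> \<le> L"
proof -
  have "bounded (bernpoly n ` {0..1})"
    by (intro compact_imp_bounded compact_continuous_image continuous_intros) simp
  then obtain L where "\<forall>x\<in>{0..1}. \<bar>bernpoly n x\<bar> \<le> L" by (auto simp: bounded_iff)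
  then show ?thesis by (intro exI[of _ L]) (auto dest: bspec[of _ _ 0])
qed

text \<open>The integral of \<open>f\<close> is \<open>F 1 - F 0 = 0\<close>, so the Riemann sum
  equals its own error. Two uses of the mean value theorem, for \<open>F\<close> and then for
  \<open>f\<close>, bound it by \<open>L / n^2\<close> on each of the \<open>n\<close>
  cells.\<close>

lemma riemann_sum_bound:
  fixes f F f' :: "real \<Rightarrow> real"
  assumes F: "\<And>x. (F has_real_derivative f x) (at x)" and f: "\<And>x. (f has_real_derivative f' x) (at x)"
    and L: "\<And>x. 0 \<le> x \<Longrightarrow> x \<le> 1 \<Longrightarrow> \<bar>f' x\<bar> \<le> L" and ends: "F 1 = F 0"
  shows "\<bar>(\<Sum>i<Suc M. f (real i / real (Suc M))) / real (Suc M)\<bar> \<le> L / real (Suc M)"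
proof -
  let ?n = "real (Suc M)"
  have L0: "0 \<le> L" using L[of 0] by linarith
  have *: "\<bar>F (real (Suc i) / ?n) - F (real i / ?n) - f (real i / ?n) / ?n\<bar> \<le> L / ?n\<^sup>2" if i: "i < Suc M" for i
  proof -
    have le1: "real (Suc i) / ?n \<le> 1" using i by (simp add: divide_le_eq)
    have lt: "real i / ?n < real (Suc i) / ?n" by (simp add: divide_strict_right_mono)
    have w: "real (Suc i) / ?n - real i / ?n = 1 / ?n" by (simp add: diff_divide_distrib[symmetric])
    obtain z where z: "real i / ?n < z" "z < real (Suc i) / ?n"
      "F (real (Suc i) / ?n) - F (real i / ?n) = (real (Suc i) / ?n - real i / ?n) * f z"
      using MVT2[OF lt, of F f] F by blast
    obtain y where y: "real i / ?n < y" "y < z" "f z - f (real i / ?n) = (z - real i / ?n) * f' y"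
      using MVT2[OF z(1), of f f'] f by blast
    have "0 \<le> real i / ?n" by simp
    then have "\<bar>f' y\<bar> \<le> L" using y z le1 by (intro L) linarith+
    have "F (real (Suc i) / ?n) - F (real i / ?n) - f (real i / ?n) / ?n = (f z - f (real i / ?n)) * (1 / ?n)"
      unfolding z(3) w by (simp add: algebra_simps diff_divide_distrib)
    also have "\<bar>\<dots>\<bar> = (z - real i / ?n) * \<bar>f' y\<bar> * (1 / ?n)"
      unfolding y(3) using z(1) by (simp add: abs_mult)
    also have "\<dots> \<le> (1 / ?n) * L * (1 / ?n)"
      using z w \<open>\<bar>f' y\<bar> \<le> L\<close> by (intro mult_right_mono mult_mono) auto
    finally show ?thesis by (simp add: power2_eq_square)
  qed
  have tele: "(\<Sum>i<Suc M. F (real (Suc i) / ?n) - F (real i / ?n)) = 0"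
    using sum_lessThan_telescope[of "\<lambda>i. F (real i / ?n)" "Suc M"] ends by (simp del: of_nat_Suc sum.lessThan_Suc)
  have "(\<Sum>i<Suc M. f (real i / ?n)) / ?n = - (\<Sum>i<Suc M. F (real (Suc i) / ?n) - F (real i / ?n) - f (real i / ?n) / ?n)"
    unfolding sum_subtractf[of "\<lambda>i. F (real (Suc i) / ?n) - F (real i / ?n)"] tele by (simp add: sum_divide_distrib del: sum.lessThan_Suc)
  also have "\<bar>\<dots>\<bar> \<le> (\<Sum>i<Suc M. L / ?n\<^sup>2)"
    unfolding abs_minus_cancel by (rule order_trans[OF sum_abs sum_mono]) (use * in auto)
  also have "\<dots> = L / ?n" by (simp add: power2_eq_square del: sum.lessThan_Suc)
  finally show ?thesis .
qed

lemma bernpoly_riemann: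
  assumes "1 \<le> n"
  shows "\<exists>L. \<forall>M. \<bar>(\<Sum>i<Suc M. bernpoly n (real i / real (Suc M))) / real (Suc M)\<bar> \<le> L / real (Suc M)"
proof -
  obtain m where m: "n = Suc m" using assms by (cases n) auto
  from bernpoly_bounded[of m] obtain L where L: "\<And>x. 0 \<le> x \<Longrightarrow> x \<le> 1 \<Longrightarrow> \<bar>bernpoly m x\<bar> \<le> L" by (meson atLeastAtMost_iff)
  have F: "((\<lambda>x. bernpoly (Suc n) x / real (Suc n)) has_real_derivative bernpoly n x) (at x)" for x
    using DERIV_cdivide[OF bernpoly_deriv[of n x], of "real (Suc n)"] by simp
  have f: "(bernpoly n has_real_derivative real n * bernpoly m x) (at x)" for x
    unfolding m by (rule bernpoly_deriv)
  have ends: "bernpoly (Suc n) 1 / real (Suc n) = bernpoly (Suc n) 0 / real (Suc n)"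
    unfolding m bernpoly_ends ..
  have "\<bar>real n * bernpoly m x\<bar> \<le> real n * L" if "0 \<le> x" "x \<le> 1" for x
    using L[OF that] by (simp add: abs_mult mult_left_mono)
  from riemann_sum_bound[OF F f this ends] show ?thesis by (intro exI allI)
qed

section \<open>The cosine series of the second Bernoulli polynomial\<close>

lemma sin_log_series:
  assumes "0 \<le> r" "r < 1"
  shows "(\<lambda>n. - (r ^ n * sin (2 * pi * real n * t) / real n)) sums Im (Ln (1 - of_real r * cis (2 * pi * t)))"
proof -
  let ?z = "- (of_real r * cis (2 * pi * t))"
  have "cmod ?z < 1" using assms by (simp add: norm_mult)
  from sums_Im[OF Ln_series'[OF this]]
  have "(\<lambda>n. Im (- ((- ?z) ^ n) / of_nat n)) sums Im (Ln (1 + ?z))" .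
  moreover have "Im (- ((- ?z) ^ n) / of_nat n) = - (r ^ n * sin (2 * pi * real n * t) / real n)" for n
  proof -
    have "(- ?z) ^ n = of_real (r ^ n) * cis (2 * pi * real n * t)"
      by (simp add: power_mult_distrib Complex.DeMoivre) (simp add: mult_ac)
    then show ?thesis by (simp add: Im_divide_of_nat)
  qed
  ultimately show ?thesis by (simp only:) simp
qed

text \<open>Polar form: \<open>1 - cis (2 * pi * t)\<close> has modulus
  \<open>2 * sin (pi * t)\<close> and argument \<open>pi * t - pi / 2\<close>. The positive real
  part keeps it off the branch cut of \<open>Ln\<close>.\<close>

lemma Im_Ln_one_minus_cis:
  assumes "0 < t" "t < 1"
  shows "Im (Ln (1 - cis (2 * pi * t))) = pi * t - pi / 2" "Re (1 - cis (2 * pi * t)) > 0"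
proof -
  have s: "sin (pi * t) > 0" using assms by (intro sin_gt_zero) auto
  have "cos (2 * (pi * t)) = 1 - 2 * (sin (pi * t))\<^sup>2" by (rule cos_double_sin)
  then show "Re (1 - cis (2 * pi * t)) > 0" using s by (simp add: mult.assoc)
  let ?w = "Complex (ln (2 * sin (pi * t))) (pi * t - pi / 2)"
  have "exp ?w = 1 - cis (2 * pi * t)"
    using s cos_double_sin[of "pi * t"] sin_double[of "pi * t"]
    by (simp add: exp_eq_polar complex_eq_iff cos_diff sin_diff mult.assoc power2_eq_square)
  moreover have "- pi < Im ?w" "Im ?w \<le> pi" using assms mult_strict_left_mono[of t 1 pi] mult_strict_left_mono[of 0 t pi] pi_gt_zero
    unfolding complex.sel by linarith+
  ultimately have "Ln (1 - cis (2 * pi * t)) = ?w" by (intro Ln_unique)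
  then show "Im (Ln (1 - cis (2 * pi * t))) = pi * t - pi / 2" by simp
qed

text \<open>The series over inverse powers of \<open>n\<close> start at \<open>n = 0\<close>; the
  term there is 0 because division by zero gives 0.\<close>

lemma summable_inverse_squares: "summable (\<lambda>n. 1 / (real n)\<^sup>2)"
  using inverse_power_summable[of 2, where ?'a = real] by (simp add: inverse_eq_divide)

text \<open>Damping gives the differentiated series a geometric majorant; the undamped terms
  \<open>sin / n\<close> have no summable one.\<close>

lemma abel_deriv:
  assumes r: "0 \<le> r" "r < 1"
  shows "((\<lambda>x. \<Sum>n. r ^ n * cos (2 * pi * real n * x) / (real n)\<^sup>2) has_real_derivative
    2 * pi * Im (Ln (1 - of_real r * cis (2 * pi * x)))) (at x)"
proof -
  let ?f' = "\<lambda>n x. 2 * pi * (- (r ^ n * sin (2 * pi * real n * x) / real n))"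
  have "((\<lambda>x. \<Sum>n. r ^ n * cos (2 * pi * real n * x) / (real n)\<^sup>2) has_field_derivative (\<Sum>n. ?f' n x)) (at x)"
  proof (rule has_field_derivative_series'(2)[where S = UNIV and ?x0.0 = x])
    show "((\<lambda>x. r ^ n * cos (2 * pi * real n * x) / (real n)\<^sup>2) has_real_derivative ?f' n x) (at x within UNIV)" for n x
      by (cases "n = 0") (auto intro!: derivative_eq_intros simp: power2_eq_square)
    show "uniformly_convergent_on UNIV (\<lambda>n x. \<Sum>i<n. ?f' i x)"
    proof (rule Weierstrass_m_test')
      show "norm (?f' n x) \<le> 2 * pi * r ^ n" for n x
      proof (cases "n = 0")
        case False
        have "\<bar>sin (2 * pi * real n * x)\<bar> / real n \<le> 1 / 1"
          using False by (intro frac_le) auto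
        then have "2 * pi * r ^ n * (\<bar>sin (2 * pi * real n * x)\<bar> / real n) \<le> 2 * pi * r ^ n * 1"
          using r by (intro mult_left_mono) auto
        then show ?thesis using r by (simp add: abs_mult mult.assoc)
      qed simp
      show "summable (\<lambda>n. 2 * pi * r ^ n)" using r by (intro summable_mult summable_geometric) auto
    qed
    show "summable (\<lambda>n. r ^ n * cos (2 * pi * real n * x) / (real n)\<^sup>2)"
    proof (rule summable_comparison_test'[OF summable_inverse_squares])
      show "norm (r ^ n * cos (2 * pi * real n * x) / (real n)\<^sup>2) \<le> 1 / (real n)\<^sup>2" for n
        using r by (simp add: abs_mult power_le_one mult_le_one divide_right_mono)
    qed
  qed auto
  also have "(\<Sum>n. ?f' n x) = 2 * pi * Im (Ln (1 - of_real r * cis (2 * pi * x)))"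
    using sums_mult[OF sin_log_series[OF r, of x], of "2 * pi"] by (simp add: sums_iff)
  finally show ?thesis .
qed

text \<open>The majorant \<open>b\<close> does not depend on \<open>r\<close>, so convergence is
  uniform on the closed interval and the sum is continuous up to \<open>r = 1\<close>.\<close>

lemma abel_limit:
  fixes c :: "nat \<Rightarrow> real"
  assumes "\<And>n. \<bar>c n\<bar> \<le> b n" "summable b" "\<And>m. 0 \<le> r m" "\<And>m. r m \<le> 1" "r \<longlonglongrightarrow> 1"
  shows "(\<lambda>m. \<Sum>n. r m ^ n * c n) \<longlonglongrightarrow> (\<Sum>n. c n)"
proof -
  have "continuous_on {0..1} (\<lambda>r. \<Sum>n. r ^ n * c n)"
  proof (rule uniform_limit_theorem)
    show "uniform_limit {0..1} (\<lambda>N r. \<Sum>n<N. r ^ n * c n) (\<lambda>r. \<Sum>n. r ^ n * c n) sequentially"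
    proof (rule Weierstrass_m_test[OF _ assms(2)])
      fix n and r :: real assume "r \<in> {0..1}"
      then have "r ^ n * \<bar>c n\<bar> \<le> 1 * \<bar>c n\<bar>" by (intro mult_right_mono power_le_one) auto
      then show "norm (r ^ n * c n) \<le> b n" using assms(1)[of n] \<open>r \<in> _\<close> by (simp add: abs_mult)
    qed
  qed (auto intro!: continuous_intros always_eventually)
  then have "(\<lambda>m. \<Sum>n. r m ^ n * c n) \<longlonglongrightarrow> (\<Sum>n. 1 ^ n * c n)"
    by (rule continuous_on_tendsto_compose) (use assms in auto)
  then show ?thesis by simp
qed

text \<open>Abel summation: for \<open>r < 1\<close> the derivative of the damped series is the imaginary part of
  \<open>Ln (1 - r * cis (2 * pi * x))\<close> up to a factor, and dominated convergence applies as \<open>r\<close> tends to 1.\<close>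

lemma cos_series_2:
  assumes "0 \<le> x" "x \<le> 1"
  shows "(\<Sum>n. cos (2 * pi * real n * x) / (real n)\<^sup>2) = pi\<^sup>2 * bernpoly 2 x"
proof -
  define r where "r m = 1 - 1 / real (m + 2)" for m
  have r: "0 \<le> r m" "r m < 1" for m by (auto simp: r_def)
  have "(\<lambda>m. 1 - 1 / real (m + 2)) \<longlonglongrightarrow> 1 - 0"
    by (intro tendsto_intros LIMSEQ_ignore_initial_segment lim_1_over_n)
  then have r_lim: "r \<longlonglongrightarrow> 1" by (simp add: r_def[abs_def])
  define g where "g r x = (\<Sum>n. r ^ n * cos (2 * pi * real n * x) / (real n)\<^sup>2)" for r x
  define S where "S x = (\<Sum>n. cos (2 * pi * real n * x) / (real n)\<^sup>2)" for x
  have g_lim: "(\<lambda>m. g (r m) x) \<longlonglongrightarrow> S x" for x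
    using abel_limit[of "\<lambda>n. cos (2 * pi * real n * x) / (real n)\<^sup>2" "\<lambda>n. 1 / (real n)\<^sup>2" r] r r_lim
    by (simp add: g_def S_def summable_inverse_squares divide_right_mono less_imp_le)
  let ?f = "\<lambda>m t. 2 * pi * Im (Ln (1 - of_real (r m) * cis (2 * pi * t)))"
  \<comment> \<open>At \<open>t = 0\<close> and \<open>t = 1\<close> the damped logarithm is real,
    so the pointwise limit jumps to 0 there; two points do not affect the integral.\<close>
  let ?h = "\<lambda>t. if t = 0 \<or> t = 1 then 0 else 2 * pi * (pi * t - pi / 2)"
  have FTC: "(?f m has_integral (g (r m) x - g (r m) 0)) {0..x}" for m
    by (rule fundamental_theorem_of_calculus)
      (use assms abel_deriv[OF r] in \<open>auto simp: g_def[abs_def] has_real_derivative_iff_has_vector_derivative[symmetric] intro: DERIV_subset\<close>)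
  have "(\<lambda>m. integral {0..x} (?f m)) \<longlonglongrightarrow> integral {0..x} ?h"
  proof (rule dominated_convergence(2)[where h = "\<lambda>_. 2 * pi * pi"])
    show "?f m integrable_on {0..x}" for m using FTC by (rule has_integral_integrable)
    show "(\<lambda>_. 2 * pi * pi) integrable_on {0..x}" by (rule integrable_const_ivl)
    \<comment> \<open>The principal argument is at most \<open>pi\<close> in modulus, uniformly in
      \<open>m\<close> and \<open>t\<close>.\<close>
    show "norm (?f m t) \<le> 2 * pi * pi" for m t
    proof -
      have "cmod (of_real (r m) * cis (2 * pi * t)) < 1" using r by (simp add: norm_mult)
      then have "1 - of_real (r m) * cis (2 * pi * t) \<noteq> 0" by (metis eq_iff_diff_eq_0 norm_one less_irrefl)
      from mpi_less_Im_Ln[OF this] Im_Ln_le_pi[OF this] show ?thesis by (simp add: abs_mult)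
    qed
    show "(\<lambda>m. ?f m t) \<longlonglongrightarrow> ?h t" if "t \<in> {0..x}" for t
    proof (cases "t = 0 \<or> t = 1")
      case True
      then have "cis (2 * pi * t) = 1" by (auto simp: complex_eq_iff)
      moreover have "Im (Ln (1 - of_real (r m))) = 0" for m
        using r(2)[of m] Ln_of_real[of "1 - r m"] by simp
      ultimately show ?thesis using True by simp
    next
      case False
      then have t: "0 < t" "t < 1" using that assms by auto
      have lim: "(\<lambda>m. 1 - of_real (r m) * cis (2 * pi * t)) \<longlonglongrightarrow> 1 - of_real 1 * cis (2 * pi * t)"
        by (intro tendsto_intros r_lim)
      have "1 - cis (2 * pi * t) \<notin> \<real>\<^sub>\<le>\<^sub>0"
        using Im_Ln_one_minus_cis(2)[OF t] by (auto simp: complex_nonpos_Reals_iff)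
      then have "(\<lambda>m. ?f m t) \<longlonglongrightarrow> 2 * pi * Im (Ln (1 - of_real 1 * cis (2 * pi * t)))"
        by (intro tendsto_intros tendsto_Ln lim) simp
      then show ?thesis using False Im_Ln_one_minus_cis(1)[OF t] by simp
    qed
  qed
  also have "integral {0..x} ?h = pi\<^sup>2 * (x\<^sup>2 - x)"
  proof (rule integral_unique, rule has_integral_spike_finite)
    show "finite {0, 1 :: real}" by simp
    have "((\<lambda>t. 2 * pi * (pi * t - pi / 2)) has_integral (pi\<^sup>2 * (x\<^sup>2 - x) - pi\<^sup>2 * (0\<^sup>2 - 0))) {0..x}"
      using assms by (intro fundamental_theorem_of_calculus)
       (auto intro!: derivative_eq_intros simp: has_real_derivative_iff_has_vector_derivative[symmetric] power2_eq_square algebra_simps)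
    then show "((\<lambda>t. 2 * pi * (pi * t - pi / 2)) has_integral (pi\<^sup>2 * (x\<^sup>2 - x))) {0..x}" by simp
  qed auto
  finally have "(\<lambda>m. g (r m) x - g (r m) 0) \<longlonglongrightarrow> pi\<^sup>2 * (x\<^sup>2 - x)"
    unfolding integral_unique[OF FTC] .
  moreover have "(\<lambda>m. g (r m) x - g (r m) 0) \<longlonglongrightarrow> S x - S 0" by (intro tendsto_intros g_lim)
  ultimately have "S x - S 0 = pi\<^sup>2 * (x\<^sup>2 - x)" using LIMSEQ_unique by blast
  \<comment> \<open>The constant of integration is the Basel sum, matching the constant term 1/6 of
    \<open>bernpoly 2\<close>.\<close>
  moreover have "S 0 = pi\<^sup>2 / 6"
  proof -
    have "(\<lambda>n. 1 / (real n)\<^sup>2) sums (pi\<^sup>2 / 6)"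
      using inverse_squares_sums sums_Suc_iff[of "\<lambda>n. 1 / (real n)\<^sup>2" "pi\<^sup>2 / 6"] by (simp add: add.commute)
    then show ?thesis by (simp add: S_def sums_iff)
  qed
  ultimately show ?thesis by (simp add: S_def bernpoly_2 algebra_simps)
qed

section \<open>Fourier series of the Bernoulli polynomials of higher degree\<close>

lemma cos_periodic_nat: "cos (x + real n * (2 * pi)) = cos (x :: real)"
  using cos.plus_of_nat[of x n] by simp

text \<open>The phase \<open>k * pi / 2\<close> covers even degrees (cosines) and odd degrees
  (sines) by one formula: differentiation lowers \<open>k\<close> by one, and the phase absorbs the
  change of function.\<close>

definition csum :: "nat \<Rightarrow> real \<Rightarrow> real" where
  "csum k x = (\<Sum>n. cos (2 * pi * real n * x - real k * pi / 2) / real n ^ k)"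

lemma csum_bound: "2 \<le> k \<Longrightarrow> norm (cos y / real n ^ k) \<le> 1 / (real n)\<^sup>2"
proof (cases "n = 0")
  case False
  assume "2 \<le> k"
  then have "(real n)\<^sup>2 \<le> real n ^ k" using False by (intro power_increasing) auto
  then show ?thesis using False by (simp add: frac_le)
qed (auto simp: power_0_left)

lemma csum_summable: "2 \<le> k \<Longrightarrow> summable (\<lambda>n. cos (2 * pi * real n * x - y) / real n ^ k)"
  by (rule summable_comparison_test'[OF summable_inverse_squares]) (rule csum_bound)

lemma csum_deriv:
  assumes "2 \<le> k"
  shows "(csum (Suc k) has_real_derivative 2 * pi * csum k x) (at x)"
proof -
  let ?f' = "\<lambda>n x. 2 * pi * (cos (2 * pi * real n * x - real k * pi / 2) / real n ^ k)"
  have "((\<lambda>x. \<Sum>n. cos (2 * pi * real n * x - real (Suc k) * pi / 2) / real n ^ Suc k) has_field_derivative (\<Sum>n. ?f' n x)) (at x)"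
  proof (rule has_field_derivative_series'(2)[where S = UNIV and ?x0.0 = x])
    show "((\<lambda>x. cos (2 * pi * real n * x - real (Suc k) * pi / 2) / real n ^ Suc k) has_real_derivative ?f' n x) (at x within UNIV)" for n x
    proof -
      have "sin (2 * pi * real n * x - real (Suc k) * pi / 2) = sin (2 * pi * real n * x - real k * pi / 2 - pi / 2)"
        by (simp add: algebra_simps add_divide_distrib)
      also have "\<dots> = - cos (2 * pi * real n * x - real k * pi / 2)" by (simp add: sin_diff)
      finally have "- sin (2 * pi * real n * x - real (Suc k) * pi / 2) * (2 * pi * real n) / real n ^ Suc k = ?f' n x"
        using assms by (cases "n = 0") auto
      then show ?thesis using assms
        by (cases "n = 0") (auto intro!: derivative_eq_intros simp: power_0_left simp del: power_Suc of_nat_Suc)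
    qed
    show "uniformly_convergent_on UNIV (\<lambda>n x. \<Sum>i<n. ?f' i x)"
    proof (rule Weierstrass_m_test')
      show "norm (?f' n x) \<le> 2 * pi * (1 / (real n)\<^sup>2)" for n x
        using csum_bound[OF assms, of "2 * pi * real n * x - real k * pi / 2" n]
        unfolding norm_mult by (intro mult_mono) auto
      show "summable (\<lambda>n. 2 * pi * (1 / (real n)\<^sup>2))" by (intro summable_mult summable_inverse_squares)
    qed
    show "summable (\<lambda>n. cos (2 * pi * real n * x - real (Suc k) * pi / 2) / real n ^ Suc k)"
      using assms by (intro csum_summable) simp
  qed auto
  also have "(\<Sum>n. ?f' n x) = 2 * pi * csum k x"
    unfolding csum_def by (intro suminf_mult csum_summable assms)
  finally show ?thesis by (simp add: csum_def[abs_def])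
qed

lemma csum_periodic: "csum k 1 = csum k 0"
proof -
  have "cos (2 * pi * real n * 1 - y) = cos (2 * pi * real n * 0 - y)" for n y
    using cos_periodic_nat[of "- y" n] by (simp add: algebra_simps)
  then show ?thesis by (simp only: csum_def)
qed

text \<open>The difference \<open>D k\<close> of the two sides satisfies \<open>D (k + 1)' = D k = 0\<close>, so \<open>D (k + 1)\<close> is
  constant; it has a zero because it is the derivative of \<open>D (k + 2)\<close>, which agrees at 0 and 1.\<close>

theorem bernpoly_fourier:
  assumes "2 \<le> k" "0 \<le> x" "x \<le> 1"
  shows "bernpoly k x / fact k = - 2 / (2 * pi) ^ k * csum k x"
proof -
  define D where "D k x = bernpoly k x / fact k + 2 / (2 * pi) ^ k * csum k x" for k x
  have D_deriv: "(D (Suc k) has_real_derivative D k x) (at x)" if "2 \<le> k" for k x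
    unfolding D_def[abs_def]
    using DERIV_add[OF DERIV_cdivide[OF bernpoly_deriv[of k x], of "fact (Suc k)"]
      DERIV_cmult[OF csum_deriv[OF that, of x], of "2 / (2 * pi) ^ Suc k"]]
  proof (rule DERIV_cong)
    have "real (Suc k) * bernpoly k x / fact (Suc k) = bernpoly k x / fact k"
      unfolding fact_Suc by (simp del: of_nat_Suc)
    moreover have "2 / (2 * pi) ^ Suc k * (2 * pi * csum k x) = 2 / (2 * pi) ^ k * csum k x" by simp
    ultimately show "real (Suc k) * bernpoly k x / fact (Suc k) + 2 / (2 * pi) ^ Suc k * (2 * pi * csum k x)
      = bernpoly k x / fact k + 2 / (2 * pi) ^ k * csum k x" by simp
  qed
  have D_ends: "D k 1 = D k 0" if k: "2 \<le> k" for k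
  proof -
    obtain m where "k = Suc (Suc m)" using le_Suc_ex[OF k] by (auto simp: numeral_2_eq_2)
    then show ?thesis by (simp only: D_def csum_periodic bernpoly_ends)
  qed
  have "\<forall>x\<in>{0..1}. D k x = 0" using assms(1)
  proof (induction k rule: dec_induct)
    case base
    \<comment> \<open>For \<open>k = 2\<close> the phase is \<open>pi\<close>, which accounts for
      the sign.\<close>
    have "csum 2 x = - (\<Sum>n. cos (2 * pi * real n * x) / (real n)\<^sup>2)" for x
    proof -
      have "cos (2 * pi * real n * x - real 2 * pi / 2) / (real n)\<^sup>2 = - (cos (2 * pi * real n * x) / (real n)\<^sup>2)" for n
        using cos_diff[of "2 * pi * real n * x" pi] by simp
      then show ?thesis unfolding csum_def using csum_summable[of 2 x 0] by (simp only: suminf_minus diff_0_right order_refl)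
    qed
    then have "D 2 x = 0" if "0 \<le> x" "x \<le> 1" for x
      unfolding D_def by (simp only: cos_series_2[OF that]) (simp add: power2_eq_square)
    then show ?case by simp
  next
    case (step k)
    have deriv: "(D (Suc k) has_real_derivative 0) (at y)" if "0 < y" "y < 1" for y
    proof -
      have "D k y = 0" using step.IH that by simp
      then show ?thesis using D_deriv[OF step(1), of y] by (simp only:)
    qed
    have cont: "continuous_on {0..1} (D (Suc k))"
      using DERIV_isCont[OF D_deriv[OF step(1)]] by (rule continuous_at_imp_continuous_on[OF ballI])
    have c: "D (Suc k) x = D (Suc k) 0" if "0 \<le> x" "x \<le> 1" for x
      by (rule DERIV_isconst2[OF zero_less_one cont deriv that])
    have k': "2 \<le> Suc k" using step(1) by simp
    from MVT2[OF zero_less_one D_deriv[OF k']]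
    obtain z where z: "0 < z" "z < 1" "D (Suc (Suc k)) 1 - D (Suc (Suc k)) 0 = (1 - 0) * D (Suc k) z"
      by blast
    have "D (Suc (Suc k)) 1 = D (Suc (Suc k)) 0" by (rule D_ends) simp
    then have "D (Suc k) z = 0" using z(3) by (simp only: diff_self mult_1 diff_0_right)
    then have "D (Suc k) 0 = 0" using c[of z] z by linarith
    then have "D (Suc k) y = 0" if "y \<in> {0..1}" for y using c[of y] that by simp
    then show ?case by blast
  qed
  then have "D k x = 0" using assms by simp
  then show ?thesis unfolding D_def by simp
qed

text \<open>Half of the bilateral Fourier sum over nonzero integers. The real exponent serves both
  the Bernoulli degrees and the exponents produced by \<lambda>.\<close>

definition cos_series :: "real \<Rightarrow> real \<Rightarrow> real" where
  "cos_series \<mu> t = (\<Sum>n. cos (2 * pi * real (Suc n) * t) / real (Suc n) powr \<mu>)"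

lemma bernpoly_even_fourier:
  assumes "even k" "0 < k" "0 \<le> x" "x \<le> 1"
  shows "bernpoly k x / fact k = (-1) ^ (k div 2 + 1) * (2 / (2 * pi) ^ k) * cos_series (real k) x"
proof -
  obtain m where m: "k = 2 * m" using assms by blast
  have k2: "2 \<le> k" using assms m by auto
  have "cos (2 * pi * real n * x - real k * pi / 2) = (-1) ^ m * cos (2 * pi * real n * x)" for n
    by (simp add: m cos_diff cos_npi sin_npi)
  then have "csum k x = (\<Sum>n. (-1) ^ m * (cos (2 * pi * real n * x) / real n ^ k))"
    by (simp add: csum_def)
  also have "\<dots> = (-1) ^ m * (\<Sum>n. cos (2 * pi * real n * x) / real n ^ k)"
    using csum_summable[OF k2, of x 0] by (intro suminf_mult) simp
  also have "(\<Sum>n. cos (2 * pi * real n * x) / real n ^ k) = cos_series (real k) x"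
    using suminf_split_head[OF csum_summable[OF k2, of x 0]] assms
    by (simp add: cos_series_def powr_realpow del: of_nat_Suc)
  finally show ?thesis using bernpoly_fourier[OF k2 assms(3,4)] by (simp add: m)
qed

text \<open>For odd degree the phase makes each term a sine up to sign, and sines change sign under
  reflection. Degree 1 is read off from its formula, as its Fourier series disagrees with it at the
  end points.\<close>

lemma bernpoly_odd_reflect:
  assumes "odd k" "0 \<le> x" "x \<le> 1"
  shows "bernpoly k (1 - x) = - bernpoly k x"
proof (cases "k = 1")
  case True then show ?thesis using bernpoly_1 by simp
next
  case False
  then have k2: "2 \<le> k" using assms by (cases k) auto
  obtain m where m: "k = 2 * m + 1" using assms(1) by (auto elim: oddE)
  have "cos (2 * pi * real n * (1 - x) - real k * pi / 2) = - cos (2 * pi * real n * x - real k * pi / 2)" for n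
  proof -
    let ?a = "2 * pi * real n * x - real k * pi / 2"
    have "2 * pi * real n * (1 - x) - real k * pi / 2 = - (?a + pi + real m * (2 * pi)) + real n * (2 * pi)"
      by (simp add: m algebra_simps add_divide_distrib)
    then have "cos (2 * pi * real n * (1 - x) - real k * pi / 2) = cos (?a + pi + real m * (2 * pi))"
      by (simp only: cos_periodic_nat cos_minus)
    also have "\<dots> = - cos ?a"
      unfolding cos_periodic_nat by (rule cos_periodic_pi)
    finally show ?thesis .
  qed
  then have "csum k (1 - x) = - csum k x"
    unfolding csum_def using csum_summable[OF k2] by (simp add: suminf_minus)
  then have "bernpoly k (1 - x) / fact k = (- bernpoly k x) / fact k"
    using bernpoly_fourier[OF k2, of x] bernpoly_fourier[OF k2, of "1 - x"] assms
    unfolding minus_divide_left[symmetric] by simp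
  then show ?thesis by (simp only: divide_cancel_right fact_nonzero simp_thms)
qed

subsection \<open>Cosine series\<close>

lemma sum_cis:
  assumes "N > 0"
  shows "(\<Sum>n<N. cis (2 * pi * of_int k * real n / real N)) = (if int N dvd k then of_nat N else 0)"
proof -
  define z where "z = cis (2 * pi * of_int k / real N)"
  have zn: "cis (2 * pi * of_int k * real n / real N) = z ^ n" for n
    unfolding z_def Complex.DeMoivre by (simp add: mult_ac)
  have z1: "z = 1 \<longleftrightarrow> int N dvd k"
  proof
    assume "z = 1"
    then have "cos (2 * pi * of_int k / real N) = 1" by (simp add: z_def complex_eq_iff)
    then obtain m :: int where "2 * pi * of_int k / real N = of_int m * 2 * pi"
      using cos_one_2pi_int by auto
    then have "real_of_int k = real_of_int (m * int N)" using assms by (simp add: field_simps)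
    then show "int N dvd k" by (simp only: of_int_eq_iff) simp
  next
    assume "int N dvd k"
    then obtain m where "k = int N * m" by blast
    then have "2 * pi * of_int k / real N = 2 * pi * of_int m" using assms by simp
    then show "z = 1" unfolding z_def using cis_multiple_2pi[of "of_int m"] by (simp only: Ints_of_int)
  qed
  have "z ^ N = cis (2 * pi * of_int k)" using assms zn[of N] by simp
  then have "z ^ N = 1" using cis_multiple_2pi[of "of_int k"] by (simp add: mult.assoc)
  then show ?thesis unfolding zn using z1 by (simp add: sum_gp_strict)
qed

lemma sum_cos_phase:
  assumes "N > 0"
  shows "(\<Sum>n<N. cos (\<phi> + 2 * pi * of_int k * real n / real N)) = (if int N dvd k then real N * cos \<phi> else 0)"
proof -
  have "(\<Sum>n<N. cis (\<phi> + 2 * pi * of_int k * real n / real N)) = cis \<phi> * (\<Sum>n<N. cis (2 * pi * of_int k * real n / real N))"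
    unfolding sum_distrib_left cis_mult ..
  also have "\<dots> = cis \<phi> * (if int N dvd k then of_nat N else 0)" unfolding sum_cis[OF assms] ..
  finally have "Re (\<Sum>n<N. cis (\<phi> + 2 * pi * of_int k * real n / real N)) = Re (cis \<phi> * (if int N dvd k then of_nat N else 0))"
    by (rule arg_cong)
  then show ?thesis by simp
qed

lemma summable_zeta: "1 < \<mu> \<Longrightarrow> summable (\<lambda>n. 1 / real (Suc n) powr \<mu>)"
proof -
  assume "1 < \<mu>"
  then have "summable (\<lambda>n. real n powr - \<mu>)" by (simp add: summable_real_powr_iff)
  then have "summable (\<lambda>n. real (Suc n) powr - \<mu>)" by (subst summable_Suc_iff)
  then show ?thesis by (simp add: powr_minus_divide)
qed

lemma zeta_pos: "1 < \<mu> \<Longrightarrow> 0 < zeta \<mu>"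
  unfolding zeta_def using summable_zeta by (intro suminf_pos) auto

lemma cos_term_bound: "norm (cos y / real (Suc n) powr \<mu>) \<le> 1 / real (Suc n) powr \<mu>"
  by (simp add: divide_right_mono)

lemma cos_series_summable: "1 < \<mu> \<Longrightarrow> summable (\<lambda>n. cos (f n) / real (Suc n) powr \<mu>)"
  by (rule summable_comparison_test'[OF summable_zeta]) (assumption, rule cos_term_bound)

lemma cos_series_0: "cos_series \<mu> 0 = zeta \<mu>"
  by (simp add: cos_series_def zeta_def)

lemma cos_series_cont: assumes "1 < \<mu>" shows "continuous_on A (cos_series \<mu>)"
  unfolding cos_series_def
proof (rule uniform_limit_theorem)
  show "uniform_limit A (\<lambda>N t. \<Sum>n<N. cos (2 * pi * real (Suc n) * t) / real (Suc n) powr \<mu>)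
     (\<lambda>t. \<Sum>n. cos (2 * pi * real (Suc n) * t) / real (Suc n) powr \<mu>) sequentially"
    by (rule Weierstrass_m_test[OF _ summable_zeta[OF assms]]) (rule cos_term_bound)
qed (auto intro!: always_eventually continuous_intros)

lemma cos_series_minus: "cos_series \<mu> (- t) = cos_series \<mu> t"
  by (simp add: cos_series_def)

lemma cos_series_abs: "cos_series \<mu> \<bar>t\<bar> = cos_series \<mu> t"
  by (simp add: abs_if cos_series_minus)

lemma cos_periodic_int: "cos (x + of_int k * (2 * pi)) = cos (x :: real)"
  using cos.plus_of_int[of x k] by simp

lemma cos_series_add_int: "cos_series \<mu> (t + of_int k) = cos_series \<mu> t"
proof -
  have "cos (2 * pi * real (Suc n) * (t + of_int k)) = cos (2 * pi * real (Suc n) * t)" for n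
    using cos_periodic_int[of "2 * pi * real (Suc n) * t" "int (Suc n) * k"] by (simp add: algebra_simps)
  then show ?thesis by (simp only: cos_series_def)
qed

text \<open>Total weight of the positive frequencies in the residue class \<open>a\<close>. At a
  multiple of \<open>1 / N\<close> a cosine depends on its frequency modulo \<open>N\<close> only,
  so the whole class is represented by one term.\<close>

definition rho :: "nat \<Rightarrow> real \<Rightarrow> nat \<Rightarrow> real" where
  "rho N \<mu> a = (\<Sum>n. if Suc n mod N = a then 1 / real (Suc n) powr \<mu> else 0)"

lemma rho_summable: "1 < \<mu> \<Longrightarrow> summable (\<lambda>n. if Suc n mod N = a then 1 / real (Suc n) powr \<mu> else 0)"
  by (rule summable_comparison_test'[OF summable_zeta]) auto

lemma rho_nonneg: "1 < \<mu> \<Longrightarrow> 0 \<le> rho N \<mu> a"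
  unfolding rho_def by (intro suminf_nonneg rho_summable) auto

lemma sum_rho:
  assumes "1 < \<mu>" "N > 0"
  shows "(\<Sum>a<N. rho N \<mu> a) = zeta \<mu>"
proof -
  have "(\<Sum>a<N. rho N \<mu> a) = (\<Sum>n. \<Sum>a<N. if Suc n mod N = a then 1 / real (Suc n) powr \<mu> else 0)"
    unfolding rho_def by (rule suminf_sum[symmetric]) (rule rho_summable[OF assms(1)])
  also have "\<dots> = zeta \<mu>" using assms by (simp add: zeta_def sum.delta' del: of_nat_Suc)
  finally show ?thesis .
qed

lemma rho_zero:
  assumes "1 < \<mu>" "N > 0"
  shows "rho N \<mu> 0 = zeta \<mu> / real N powr \<mu>"
proof -
  let ?f = "\<lambda>n. if Suc n mod N = 0 then 1 / real (Suc n) powr \<mu> else 0"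
  \<comment> \<open>The index of the frequency \<open>N * (k + 1)\<close>; subtracting 1 undoes the
    shift in \<open>Suc n\<close>.\<close>
  let ?g = "\<lambda>k. N * Suc k - 1"
  have S: "Suc (?g k) = N * Suc k" for k using assms by (cases N) auto
  have mono: "strict_mono ?g" unfolding strict_mono_Suc_iff using assms by (auto simp: less_diff_conv)
  have "?f n = 0" if "n \<notin> range ?g" for n
  proof -
    have "\<not> N dvd Suc n"
    proof
      assume "N dvd Suc n"
      then obtain k where k: "Suc n = N * k" by blast
      then have "k = Suc (k - 1)" by (cases k) auto
      then have "n = ?g (k - 1)" using k by simp
      then show False using that by blast
    qed
    then show ?thesis by (simp add: dvd_eq_mod_eq_0)
  qed
  then have "(\<lambda>k. ?f (?g k)) sums rho N \<mu> 0 \<longleftrightarrow> ?f sums rho N \<mu> 0"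
    by (rule sums_mono_reindex[OF mono])
  moreover have "?f sums rho N \<mu> 0" unfolding rho_def by (rule summable_sums[OF rho_summable[OF assms(1)]])
  ultimately have "(\<lambda>k. ?f (?g k)) sums rho N \<mu> 0" by simp
  moreover have "?f (?g k) = 1 / real (Suc k) powr \<mu> / real N powr \<mu>" for k
  proof -
    have "real (N * Suc k) powr \<mu> = real N powr \<mu> * real (Suc k) powr \<mu>"
      unfolding of_nat_mult by (rule powr_mult)
    then show ?thesis unfolding S by (simp del: of_nat_Suc mult_Suc_right of_nat_mult)
  qed
  ultimately have "(\<lambda>k. 1 / real (Suc k) powr \<mu> / real N powr \<mu>) sums rho N \<mu> 0" by simp
  moreover have "(\<lambda>k. 1 / real (Suc k) powr \<mu> / real N powr \<mu>) sums (zeta \<mu> / real N powr \<mu>)"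
    unfolding zeta_def by (intro sums_divide summable_sums summable_zeta assms)
  ultimately show ?thesis by (rule sums_unique2)
qed

text \<open>Weakening \<open>N powr \<mu>\<close> to \<open>N\<close> leaves exactly the estimate
  that controls the class 0 in \<open>dual_sum_sum_le\<close>.\<close>

lemma rho_zero_le:
  assumes "1 < \<mu>" "N > 0"
  shows "rho N \<mu> 0 \<le> zeta \<mu> / real N"
proof -
  have "real N powr 1 \<le> real N powr \<mu>" using assms by (intro powr_mono) auto
  then show ?thesis unfolding rho_zero[OF assms] using assms zeta_pos[OF assms(1)]
    by (intro divide_left_mono) auto
qed

text \<open>Averaging over all shifts by multiples of \<open>1 / N\<close> retains only the
  frequencies divisible by \<open>N\<close>, whose total weight is
  \<open>rho N \<mu> 0\<close>.\<close>

lemma cos_series_grid: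
  assumes "1 < \<mu>" "N > 0"
  shows "\<bar>(\<Sum>i<N. cos_series \<mu> (t - real i / real N)) / real N\<bar> \<le> zeta \<mu> / real N"
proof -
  have inner: "(\<Sum>i<N. cos (2 * pi * real (Suc n) * (t - real i / real N))) =
     (if Suc n mod N = 0 then real N * cos (2 * pi * real (Suc n) * t) else 0)" for n
  proof -
    have "(\<Sum>i<N. cos (2 * pi * real (Suc n) * (t - real i / real N))) =
      (\<Sum>i<N. cos (2 * pi * real (Suc n) * t + 2 * pi * of_int (- int (Suc n)) * real i / real N))"
      by (intro sum.cong refl arg_cong[where f = cos]) (simp add: algebra_simps diff_divide_distrib add_divide_distrib)
    also have "\<dots> = (if int N dvd - int (Suc n) then real N * cos (2 * pi * real (Suc n) * t) else 0)"
      by (rule sum_cos_phase[OF assms(2)])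
    also have "int N dvd - int (Suc n) \<longleftrightarrow> Suc n mod N = 0"
      by (subst dvd_minus_iff, subst of_nat_dvd_iff) (rule dvd_eq_mod_eq_0)
    finally show ?thesis .
  qed
  have "(\<Sum>i<N. cos_series \<mu> (t - real i / real N)) =
      (\<Sum>n. \<Sum>i<N. cos (2 * pi * real (Suc n) * (t - real i / real N)) / real (Suc n) powr \<mu>)"
    unfolding cos_series_def by (rule suminf_sum[symmetric]) (rule cos_series_summable[OF assms(1)])
  also have "\<dots> = (\<Sum>n. real N * (if Suc n mod N = 0 then cos (2 * pi * real (Suc n) * t) / real (Suc n) powr \<mu> else 0))"
    unfolding sum_divide_distrib[symmetric] inner by (intro suminf_cong) auto
  also have "\<dots> = real N * (\<Sum>n. if Suc n mod N = 0 then cos (2 * pi * real (Suc n) * t) / real (Suc n) powr \<mu> else 0)"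
    by (rule suminf_mult, rule summable_comparison_test'[OF summable_zeta[OF assms(1)]])
       (auto simp: divide_right_mono simp del: of_nat_Suc)
  finally have eq: "(\<Sum>i<N. cos_series \<mu> (t - real i / real N)) / real N =
     (\<Sum>n. if Suc n mod N = 0 then cos (2 * pi * real (Suc n) * t) / real (Suc n) powr \<mu> else 0)"
    using assms by simp
  also have "\<bar>\<dots>\<bar> \<le> rho N \<mu> 0"
    unfolding rho_def real_norm_def[symmetric]
    by (rule norm_suminf_le[OF _ rho_summable[OF assms(1)]]) (auto simp: divide_right_mono simp del: of_nat_Suc)
  also have "\<dots> \<le> zeta \<mu> / real N" by (rule rho_zero_le[OF assms])
  finally show ?thesis .
qed

lemma cos_series_lattice:
  assumes \<mu>: "1 < \<mu>" and N: "N > 0"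
  shows "cos_series \<mu> (of_int k / real N) = (\<Sum>a<N. rho N \<mu> a * cos (2 * pi * real a * of_int k / real N))"
proof -
  let ?e = "\<lambda>a. cos (2 * pi * real a * of_int k / real N)" and ?r = "\<lambda>a n. if Suc n mod N = a then 1 / real (Suc n) powr \<mu> else 0"
  have per: "cos (2 * pi * real (Suc n) * (of_int k / real N)) = ?e (Suc n mod N)" for n
  proof -
    have "real (Suc n) = real (Suc n mod N) + real (Suc n div N) * real N"
      by (metis of_nat_add of_nat_mult mod_div_mult_eq)
    then have "2 * pi * real (Suc n) * (of_int k / real N) = 2 * pi * real (Suc n mod N) * of_int k / real N + of_int (int (Suc n div N) * k) * (2 * pi)"
      using N by (simp add: field_simps)
    then show ?thesis by (simp only: cos_periodic_int)
  qed
  have "cos_series \<mu> (of_int k / real N) = (\<Sum>n. \<Sum>a<N. ?r a n * ?e a)"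
    unfolding cos_series_def per
  proof (intro suminf_cong)
    fix n
    have "(\<Sum>a<N. ?r a n * ?e a)
      = (\<Sum>a<N. if Suc n mod N = a then 1 / real (Suc n) powr \<mu> * ?e a else 0)"
      by (intro sum.cong) auto
    also have "\<dots> = ?e (Suc n mod N) / real (Suc n) powr \<mu>"
      using N by (simp add: sum.delta' del: of_nat_Suc)
    finally show "?e (Suc n mod N) / real (Suc n) powr \<mu> =
      (\<Sum>a<N. ?r a n * ?e a)" ..
  qed
  also have "\<dots> = (\<Sum>a<N. rho N \<mu> a * ?e a)"
    unfolding rho_def
    by (subst suminf_sum) (auto intro!: summable_mult2 rho_summable[OF \<mu>] suminf_mult2[symmetric] sum.cong simp del: of_nat_Suc)
  finally show ?thesis .
qed

text \<open>Absolute summability allows splitting the unordered sum into positive and negative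
  frequencies; the real parts of opposite frequencies agree.\<close>

lemma korobov_factor:
  assumes "1 < 2 * \<beta>"
  shows "Re (\<Sum>\<^sub>\<infinity>h\<in>UNIV - {0 :: int}. exp (2 * of_real pi * \<i> * of_int h * of_real t)
          / of_real (real_of_int \<bar>h\<bar> powr (2 * \<beta>))) = 2 * cos_series (2 * \<beta>) t"
proof -
  let ?f = "\<lambda>h :: int. exp (2 * of_real pi * \<i> * of_int h * of_real t) / complex_of_real (real_of_int \<bar>h\<bar> powr (2 * \<beta>))"
  define p q where "p n = int (Suc n)" and "q n = - int (Suc n)" for n
  have inj: "inj p" "inj q" by (auto simp: p_def q_def inj_def)
  have un: "UNIV - {0 :: int} = range p \<union> range q"
  proof (intro set_eqI iffI)
    fix h :: int assume "h \<in> UNIV - {0}"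
    then have "h = p (nat h - 1) \<or> h = q (nat (- h) - 1)" by (auto simp: p_def q_def)
    then show "h \<in> range p \<union> range q" by blast
  qed (auto simp: p_def q_def)
  have fp: "?f (p n) = cis (2 * pi * real (Suc n) * t) / of_real (real (Suc n) powr (2 * \<beta>))" for n
    by (simp add: p_def cis_conv_exp mult_ac)
  have fq: "?f (q n) = cis (- (2 * pi * real (Suc n) * t)) / of_real (real (Suc n) powr (2 * \<beta>))" for n
    unfolding cis_conv_exp by (simp add: q_def mult_ac algebra_simps)
  let ?g = "\<lambda>y n. cis (y n) / complex_of_real (real (Suc n) powr (2 * \<beta>))"
  have sn: "summable (\<lambda>n. norm (?g y n))" for y
  proof -
    have "norm (?g y n) = 1 / real (Suc n) powr (2 * \<beta>)" for n
      unfolding norm_divide norm_cis norm_of_real by simp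
    then show ?thesis using summable_zeta[OF assms] by (simp only:)
  qed
  have hs: "((\<lambda>n. ?g y n) has_sum
    (\<Sum>n. ?g y n)) UNIV" for y
    by (rule norm_summable_imp_has_sum[OF sn summable_sums[OF summable_norm_cancel[OF sn]]])
  have "(?f has_sum (\<Sum>n. ?f (p n))) (range p)"
    unfolding has_sum_reindex[OF inj(1)] o_def fp by (rule hs)
  moreover have "(?f has_sum (\<Sum>n. ?f (q n))) (range q)"
    unfolding has_sum_reindex[OF inj(2)] o_def fq by (rule hs)
  ultimately have "(?f has_sum ((\<Sum>n. ?f (p n)) + (\<Sum>n. ?f (q n)))) (range p \<union> range q)"
    by (rule has_sum_Un_disjoint) (auto simp: p_def q_def)
  then have "(\<Sum>\<^sub>\<infinity>h\<in>UNIV - {0}. ?f h) = (\<Sum>n. ?f (p n)) + (\<Sum>n. ?f (q n))"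
    unfolding un by (rule infsumI)
  moreover have "Re (\<Sum>n. ?g y n) = (\<Sum>n. cos (y n) / real (Suc n) powr (2 * \<beta>))" for y
    by (subst Re_suminf[OF summable_norm_cancel[OF sn]]) (simp only: Re_divide_of_real cis.sel)
  ultimately show ?thesis unfolding fp fq by (simp only: plus_complex.sel cos_series_def cos_minus mult_2[symmetric])
qed

subsection \<open>Products of one-dimensional kernels\<close>

text \<open>What a one-dimensional factor must satisfy for its weighted products to form a
  \<open>mean_one_kernel\<close>. The last assumption is mean zero in the second variable, with a
  rate.\<close>

locale kernel_1d =
  fixes k :: "real \<Rightarrow> real \<Rightarrow> real" and C D :: real
  assumes k_schur: "\<And>s j. j \<in> {1..s} \<Longrightarrow> schur (unit_cube s) (\<lambda>x y. k (x j) (y j))"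
    and k_cont: "\<And>X Y x y. \<lbrakk>\<And>n :: nat. X n \<in> {0..1}; \<And>n. Y n \<in> {0..1}; x \<in> {0..1}; y \<in> {0..1}; X \<longlonglongrightarrow> x; Y \<longlonglongrightarrow> y\<rbrakk>
      \<Longrightarrow> (\<lambda>n. k (X n) (Y n)) \<longlonglongrightarrow> k x y"
    and k_bound: "\<And>x. x \<in> {0..1} \<Longrightarrow> \<bar>k x x\<bar> \<le> C"
    and k_grid: "\<And>x M. x \<in> {0..1} \<Longrightarrow> \<bar>(\<Sum>i<Suc M. k x (real i / real (Suc M))) / real (Suc M)\<bar> \<le> D / real (Suc M)"

definition product_kernel ::
    "(real \<Rightarrow> real \<Rightarrow> real) \<Rightarrow> (nat set \<Rightarrow> real) \<Rightarrow> nat \<Rightarrow> (nat \<Rightarrow> real) \<Rightarrow> (nat \<Rightarrow> real) \<Rightarrow> real" where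
  "product_kernel k w s x y = 1 + (\<Sum>u\<in>Pow {1..s} - {{}}. w u * (\<Prod>j\<in>u. k (x j) (y j)))"

lemma unit_cube_coord: "x \<in> unit_cube s \<Longrightarrow> j \<in> {1..s} \<Longrightarrow> x j \<in> {0..1}"
  unfolding unit_cube_def by (erule PiE_mem)

text \<open>Grid averages factor over the coordinates, and every factor is of order
  \<open>1 / (M + 1)\<close>. As \<open>u\<close> is nonempty there is at least one factor, so only
  the constant 1 survives in the limit.\<close>

lemma (in kernel_1d) mean_one_product_kernel:
  assumes w: "\<And>u. u \<subseteq> {1..s} \<Longrightarrow> 0 \<le> w u"
  shows "mean_one_kernel s (product_kernel k w s) (1 + (\<Sum>u\<in>Pow {1..s} - {{}}. w u * C ^ card u))
    (\<lambda>M. \<Sum>u\<in>Pow {1..s} - {{}}. w u * (D / real (Suc M)) ^ card u)"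
proof
  let ?U = "Pow {1..s} - {{}}"
  let ?m = "\<lambda>x j M. (\<Sum>i<Suc M. k (x j) (real i / real (Suc M))) / real (Suc M)"
  have fin: "finite u" if "u \<in> ?U" for u using that finite_subset by blast
  have "schur (unit_cube s) (product_kernel k w s)"
    unfolding product_kernel_def using fin
    by (intro schur_add schur_const schur_sum schur_mult schur_prod) (auto intro!: w k_schur)
  then show "psd (unit_cube s) (product_kernel k w s)" by (rule schur_imp_psd)
  show "product_kernel k w s x x \<le> 1 + (\<Sum>u\<in>?U. w u * C ^ card u)" if x: "x \<in> unit_cube s" for x
  proof -
    have "(\<Prod>j\<in>u. k (x j) (x j)) \<le> C ^ card u" if "u \<in> ?U" for u
    proof -
      have "\<bar>\<Prod>j\<in>u. k (x j) (x j)\<bar> \<le> (\<Prod>j\<in>u. C)"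
        unfolding abs_prod using that unit_cube_coord[OF x] by (intro prod_mono) (auto intro!: k_bound simp del: atLeastAtMost_iff)
      then show ?thesis by simp
    qed
    then show ?thesis unfolding product_kernel_def by (intro add_left_mono sum_mono mult_left_mono w) auto
  qed
  show "(\<lambda>n. product_kernel k w s (X n) (Y n)) \<longlonglongrightarrow> product_kernel k w s x y"
    if "\<And>n. X n \<in> unit_cube s" "\<And>n. Y n \<in> unit_cube s" "x \<in> unit_cube s" "y \<in> unit_cube s"
      "\<And>j. j \<in> {1..s} \<Longrightarrow> (\<lambda>n :: nat. X n j) \<longlonglongrightarrow> x j" "\<And>j. j \<in> {1..s} \<Longrightarrow> (\<lambda>n. Y n j) \<longlonglongrightarrow> y j"
    for X Y x y
    unfolding product_kernel_def
  proof (intro tendsto_intros)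
    fix u j assume "u \<in> ?U" "j \<in> u"
    then have "j \<in> {1..s}" by blast
    then show "(\<lambda>n. k (X n j) (Y n j)) \<longlonglongrightarrow> k (x j) (y j)"
      using that by (intro k_cont unit_cube_coord)
  qed
  show "\<bar>avg (grid s (Suc M)) (product_kernel k w s x) - 1\<bar> \<le> (\<Sum>u\<in>?U. w u * (D / real (Suc M)) ^ card u)"
    if x: "x \<in> unit_cube s" for M x
  proof -
    have ne: "grid s (Suc M) \<noteq> {#}" by (rule grid_neq_empty) simp
    have "avg (grid s (Suc M)) (product_kernel k w s x) - 1 = (\<Sum>u\<in>?U. w u * avg (grid s (Suc M)) (\<lambda>y. \<Prod>j\<in>u. k (x j) (y j)))"
      unfolding product_kernel_def avg_add avg_const[OF ne] avg_sum avg_cmult by (rule add_diff_cancel_left')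
    also have "\<dots> = (\<Sum>u\<in>?U. w u * (\<Prod>j\<in>u. ?m x j M))"
      by (intro sum.cong refl arg_cong2[where f = "(*)"] avg_grid_prod) auto
    also have "\<bar>\<dots>\<bar> \<le> (\<Sum>u\<in>?U. \<bar>w u * (\<Prod>j\<in>u. ?m x j M)\<bar>)"
      by (rule sum_abs)
    also have "\<dots> \<le> (\<Sum>u\<in>?U. w u * (D / real (Suc M)) ^ card u)"
    proof (rule sum_mono)
      fix u assume u: "u \<in> ?U"
      have "\<bar>\<Prod>j\<in>u. ?m x j M\<bar> \<le> (\<Prod>j\<in>u. D / real (Suc M))"
        unfolding abs_prod
      proof (rule prod_mono)
        fix j assume "j \<in> u"
        then have "x j \<in> {0..1}" using u unit_cube_coord[OF x] by blast
        from k_grid[OF this] show "0 \<le> \<bar>?m x j M\<bar> \<and>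
           \<bar>?m x j M\<bar> \<le> D / real (Suc M)" by simp
      qed
      then show "\<bar>w u * (\<Prod>j\<in>u. ?m x j M)\<bar> \<le> w u * (D / real (Suc M)) ^ card u"
        using w[of u] u by (simp add: abs_mult mult_left_mono del: of_nat_Suc sum.lessThan_Suc)
    qed
    finally show ?thesis .
  qed
  have "(\<lambda>M. \<Sum>u\<in>?U. w u * (D / real (Suc M)) ^ card u) \<longlonglongrightarrow> (\<Sum>u\<in>?U. w u * 0 ^ card u)"
  proof (intro tendsto_intros)
    have "(\<lambda>M. D * (1 / real (Suc M))) \<longlonglongrightarrow> D * 0"
      by (intro tendsto_intros LIMSEQ_Suc[OF lim_1_over_n])
    then show "(\<lambda>M. D / real (Suc M)) \<longlonglongrightarrow> 0" by simp
  qed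
  also have "(\<Sum>u\<in>?U. w u * 0 ^ card u) = 0"
  proof (rule sum.neutral, rule ballI)
    fix u assume "u \<in> ?U"
    then have "card u \<noteq> 0" using fin by auto
    then show "w u * 0 ^ card u = 0" by (simp add: power_0_left)
  qed
  finally show "(\<lambda>M. \<Sum>u\<in>?U. w u * (D / real (Suc M)) ^ card u) \<longlonglongrightarrow> 0" .
qed

text \<open>The addition theorem for \<open>cos (a - b)\<close> writes every partial sum as a
  nonnegative combination of rank-one kernels.\<close>

lemma schur_cos_series:
  assumes "1 < \<mu>"
  shows "schur X (\<lambda>x y. cos_series \<mu> (x j - y j))"
proof (rule schur_limit)
  let ?c = "\<lambda>n. 1 / real (Suc n) powr \<mu>"
  let ?t = "\<lambda>x y n. ?c n * (cos (2 * pi * real (Suc n) * x j) * cos (2 * pi * real (Suc n) * y j)) +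
      ?c n * (sin (2 * pi * real (Suc n) * x j) * sin (2 * pi * real (Suc n) * y j))"
  show "schur X (\<lambda>x y. \<Sum>n<M. ?t x y n)" for M
    by (intro schur_sum schur_add schur_mult schur_const schur_rank_one finite_lessThan) auto
  show "(\<lambda>M. \<Sum>n<M. ?t x y n) \<longlonglongrightarrow> cos_series \<mu> (x j - y j)" for x y
  proof -
    have "cos (2 * pi * real (Suc n) * (x j - y j)) / real (Suc n) powr \<mu> =
      ?t x y n" for n
      unfolding right_diff_distrib cos_diff by (simp add: add_divide_distrib)
    then show ?thesis
      using summable_LIMSEQ[OF cos_series_summable[OF assms, of "\<lambda>n. 2 * pi * real (Suc n) * (x j - y j)"]]
      by (simp only: cos_series_def)
  qed
qed

lemma cos_series_tendsto: "1 < \<mu> \<Longrightarrow> X \<longlonglongrightarrow> x \<Longrightarrow> (\<lambda>n. cos_series \<mu> (X n)) \<longlonglongrightarrow> cos_series \<mu> x"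
  using continuous_on_tendsto_compose[OF cos_series_cont[of \<mu> UNIV]] by auto

lemma kernel_1d_korobov:
  assumes "1 < 2 * \<beta>"
  shows "kernel_1d (\<lambda>x y. 2 * cos_series (2 * \<beta>) (x - y)) (2 * zeta (2 * \<beta>)) (2 * zeta (2 * \<beta>))"
proof
  show "schur (unit_cube s) (\<lambda>x y. 2 * cos_series (2 * \<beta>) (x j - y j))" for s j
    by (intro schur_mult schur_const schur_cos_series assms) simp
  show "(\<lambda>n. 2 * cos_series (2 * \<beta>) (X n - Y n)) \<longlonglongrightarrow> 2 * cos_series (2 * \<beta>) (x - y)"
    if "X \<longlonglongrightarrow> x" "Y \<longlonglongrightarrow> y" for X Y x y
    using that by (intro tendsto_intros cos_series_tendsto assms)
  show "\<bar>2 * cos_series (2 * \<beta>) (x - x)\<bar> \<le> 2 * zeta (2 * \<beta>)" for x :: real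
    using zeta_pos[OF assms] by (simp add: cos_series_0)
  show "\<bar>(\<Sum>i<Suc M. 2 * cos_series (2 * \<beta>) (x - real i / real (Suc M))) / real (Suc M)\<bar> \<le> 2 * zeta (2 * \<beta>) / real (Suc M)" for x M
    using cos_series_grid[OF assms, of "Suc M" x] unfolding sum_distrib_left[symmetric]
    by (simp add: abs_mult del: of_nat_Suc sum.lessThan_Suc)
qed

lemma korobov_kernel_eq:
  assumes "1 < 2 * \<beta>"
  shows "korobov_kernel \<beta> \<eta> s = product_kernel (\<lambda>x y. 2 * cos_series (2 * \<beta>) (x - y)) \<eta> s"
  unfolding korobov_kernel_def product_kernel_def korobov_factor[OF assms] by blast

definition sob :: "nat \<Rightarrow> real \<Rightarrow> real \<Rightarrow> real" where
  "sob \<alpha> x y = - 1 + sobolev_kernel_1 \<alpha> x y"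

lemma sobolev_kernel_eq: "sobolev_kernel \<alpha> \<gamma> s = product_kernel (sob \<alpha>) \<gamma> s"
  unfolding sobolev_kernel_def product_kernel_def sob_def by blast

text \<open>For even \<alpha> the sign in the kernel cancels the sign in the Fourier expansion of
  degree 2 \<alpha>, so the last summand is a positive multiple of a cosine series.\<close>

lemma sob_eq:
  assumes "even \<alpha>" "0 < \<alpha>" "x \<in> {0..1}" "y \<in> {0..1}"
  shows "sob \<alpha> x y = (\<Sum>\<tau> | 1 \<le> \<tau> \<and> \<tau> \<le> \<alpha> \<and> (odd \<tau> \<or> \<tau> = \<alpha>). 1 / (fact \<tau>)\<^sup>2 * (bernpoly \<tau> x * bernpoly \<tau> y))
      + 2 / (2 * pi) ^ (2 * \<alpha>) * cos_series (2 * real \<alpha>) (x - y)"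
proof -
  have "bernpoly (2 * \<alpha>) \<bar>x - y\<bar> / fact (2 * \<alpha>) = - (2 / (2 * pi) ^ (2 * \<alpha>) * cos_series (real (2 * \<alpha>)) \<bar>x - y\<bar>)"
    using assms by (subst bernpoly_even_fourier) auto
  then show ?thesis using assms(1) by (simp add: sob_def sobolev_kernel_1_def cos_series_abs)
qed

lemma bernpoly_tendsto: "X \<longlonglongrightarrow> x \<Longrightarrow> (\<lambda>n. bernpoly k (X n)) \<longlonglongrightarrow> bernpoly k x"
  unfolding bernpoly_def by (intro tendsto_intros)

lemma kernel_1d_sobolev:
  assumes \<alpha>: "even \<alpha>" "0 < \<alpha>"
  shows "\<exists>C D. kernel_1d (sob \<alpha>) C D"
proof -
  let ?T = "{\<tau>. 1 \<le> \<tau> \<and> \<tau> \<le> \<alpha> \<and> (odd \<tau> \<or> \<tau> = \<alpha>)}"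
  let ?c = "2 / (2 * pi) ^ (2 * \<alpha>)"
  let ?f = "\<lambda>\<tau>. 1 / (fact \<tau>)\<^sup>2 :: real" and ?p = bernpoly and ?C = "cos_series (2 * real \<alpha>)" and ?Z = "zeta (2 * real \<alpha>)"
  have fT: "finite ?T" by simp
  have mu: "1 < 2 * real \<alpha>" using \<alpha> by (cases \<alpha>) auto
  obtain B where B0: "\<And>\<tau>. 0 \<le> B \<tau>" and B: "\<And>\<tau> x. x \<in> {0..1} \<Longrightarrow> \<bar>?p \<tau> x\<bar> \<le> B \<tau>"
    using bernpoly_bounded by metis
  have "\<forall>\<tau>\<in>?T. \<exists>L. \<forall>M. \<bar>(\<Sum>i<Suc M. ?p \<tau> (real i / real (Suc M))) / real (Suc M)\<bar> \<le> L / real (Suc M)"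
    using bernpoly_riemann by blast
  then obtain L where L: "\<And>\<tau> M. \<tau> \<in> ?T \<Longrightarrow> \<bar>(\<Sum>i<Suc M. ?p \<tau> (real i / real (Suc M))) / real (Suc M)\<bar> \<le> L \<tau> / real (Suc M)"
    unfolding bchoice_iff by blast
  have "kernel_1d (sob \<alpha>) ((\<Sum>\<tau>\<in>?T. ?f \<tau> * (B \<tau> * B \<tau>)) + ?c * ?Z)
     ((\<Sum>\<tau>\<in>?T. ?f \<tau> * (B \<tau> * L \<tau>)) + ?c * ?Z)"
  proof
    show "schur (unit_cube s) (\<lambda>x y. sob \<alpha> (x j) (y j))" if j: "j \<in> {1..s}" for s j
    proof (rule schur_cong)
      show "sob \<alpha> (x j) (y j) = (\<Sum>\<tau>\<in>?T. ?f \<tau> * (?p \<tau> (x j) * ?p \<tau> (y j))) + ?c * ?C (x j - y j)"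
        if "x \<in> unit_cube s" "y \<in> unit_cube s" for x y
        by (rule sob_eq[OF \<alpha> unit_cube_coord[OF that(1) j] unit_cube_coord[OF that(2) j]])
      show "schur (unit_cube s) (\<lambda>x y. (\<Sum>\<tau>\<in>?T. ?f \<tau> * (?p \<tau> (x j) * ?p \<tau> (y j))) + ?c * ?C (x j - y j))"
        by (rule schur_add[OF schur_sum[OF fT schur_mult[OF schur_const schur_rank_one]] schur_mult[OF schur_const schur_cos_series[OF mu]]]) simp_all
    qed
    show "(\<lambda>n. sob \<alpha> (X n) (Y n)) \<longlonglongrightarrow> sob \<alpha> x y"
      if "\<And>n :: nat. X n \<in> {0..1}" "\<And>n. Y n \<in> {0..1}" "x \<in> {0..1}" "y \<in> {0..1}" "X \<longlonglongrightarrow> x" "Y \<longlonglongrightarrow> y" for X Y x y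
      unfolding sob_eq[OF \<alpha> that(1,2)] sob_eq[OF \<alpha> that(3,4)]
      by (intro tendsto_add tendsto_sum tendsto_mult tendsto_const bernpoly_tendsto cos_series_tendsto mu tendsto_diff that)
    show "\<bar>sob \<alpha> x x\<bar> \<le> (\<Sum>\<tau>\<in>?T. ?f \<tau> * (B \<tau> * B \<tau>)) + ?c * ?Z" if x: "x \<in> {0..1}" for x
    proof -
      have "\<bar>\<Sum>\<tau>\<in>?T. ?f \<tau> * (?p \<tau> x * ?p \<tau> x)\<bar> \<le> (\<Sum>\<tau>\<in>?T. ?f \<tau> * (B \<tau> * B \<tau>))"
      proof (rule order_trans[OF sum_abs sum_mono])
        show "\<bar>?f \<tau> * (?p \<tau> x * ?p \<tau> x)\<bar> \<le> ?f \<tau> * (B \<tau> * B \<tau>)" for \<tau>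
          unfolding abs_mult using B[OF x, of \<tau>] B0[of \<tau>] by (intro mult_mono) auto
      qed
      moreover have "\<bar>?c * ?C (x - x)\<bar> = ?c * ?Z"
        using zeta_pos[OF mu] by (simp add: cos_series_0)
      ultimately show ?thesis unfolding sob_eq[OF \<alpha> x x] by linarith
    qed
    show "\<bar>(\<Sum>i<Suc M. sob \<alpha> x (real i / real (Suc M))) / real (Suc M)\<bar>
        \<le> ((\<Sum>\<tau>\<in>?T. ?f \<tau> * (B \<tau> * L \<tau>)) + ?c * ?Z) / real (Suc M)" if x: "x \<in> {0..1}" for x M
    proof -
      let ?n = "real (Suc M)"
      let ?b = "\<lambda>\<tau>. (\<Sum>i<Suc M. ?p \<tau> (real i / ?n)) / ?n"
      let ?s = "(\<Sum>i<Suc M. ?C (x - real i / ?n)) / ?n"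
      have "(\<Sum>i<Suc M. sob \<alpha> x (real i / ?n)) = (\<Sum>i<Suc M. (\<Sum>\<tau>\<in>?T. ?f \<tau> * (?p \<tau> x * ?p \<tau> (real i / ?n)))
          + ?c * ?C (x - real i / ?n))"
        by (intro sum.cong refl sob_eq \<alpha> x) (auto simp: divide_le_eq)
      also have "\<dots> = (\<Sum>\<tau>\<in>?T. \<Sum>i<Suc M. ?f \<tau> * (?p \<tau> x * ?p \<tau> (real i / ?n)))
          + (\<Sum>i<Suc M. ?c * ?C (x - real i / ?n))"
        unfolding sum.distrib by (subst sum.swap) (rule refl)
      finally have eq: "(\<Sum>i<Suc M. sob \<alpha> x (real i / ?n)) / ?n = (\<Sum>\<tau>\<in>?T. ?f \<tau> * (?p \<tau> x * ?b \<tau>)) + ?c * ?s"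
        by (simp only: add_divide_distrib sum_divide_distrib sum_distrib_left times_divide_eq_right)
      have "\<bar>\<Sum>\<tau>\<in>?T. ?f \<tau> * (?p \<tau> x * ?b \<tau>)\<bar> \<le> (\<Sum>\<tau>\<in>?T. ?f \<tau> * (B \<tau> * (L \<tau> / ?n)))"
      proof (rule order_trans[OF sum_abs sum_mono])
        fix \<tau> assume "\<tau> \<in> ?T"
        from L[OF this, of M] B[OF x, of \<tau>] B0[of \<tau>]
        show "\<bar>?f \<tau> * (?p \<tau> x * ?b \<tau>)\<bar> \<le> ?f \<tau> * (B \<tau> * (L \<tau> / ?n))"
          unfolding abs_mult by (intro mult_mono) auto
      qed
      also have "\<dots> = (\<Sum>\<tau>\<in>?T. ?f \<tau> * (B \<tau> * L \<tau>)) / ?n"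
        by (simp only: sum_divide_distrib times_divide_eq_right)
      finally have 1: "\<bar>\<Sum>\<tau>\<in>?T. ?f \<tau> * (?p \<tau> x * ?b \<tau>)\<bar> \<le> \<dots>" .
      have "\<bar>?c * ?s\<bar> = ?c * \<bar>?s\<bar>" by (simp only: abs_mult) simp
      also have "\<dots> \<le> ?c * (?Z / ?n)"
        by (intro mult_left_mono cos_series_grid mu) simp_all
      finally have "\<bar>?c * ?s\<bar> \<le> ?c * ?Z / ?n" by (simp only: times_divide_eq_right)
      with 1 show ?thesis unfolding eq add_divide_distrib by linarith
    qed
  qed
  then show ?thesis by blast
qed

subsection \<open>Power sums\<close>

text \<open>After division by \<open>x + y\<close> both summands lie in [0, 1], where a power with
  exponent at most 1 does not decrease a number.\<close>

lemma powr_add_le: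
  fixes x y :: real
  assumes "0 \<le> x" "0 \<le> y" "0 < l" "l \<le> 1"
  shows "(x + y) powr l \<le> x powr l + y powr l"
proof (cases "x + y = 0")
  case True then show ?thesis using assms by simp
next
  case False
  then have s: "x + y > 0" using assms by simp
  have *: "t / (x + y) \<le> (t / (x + y)) powr l" if "0 \<le> t" "t \<le> x + y" for t
  proof (cases "t = 0")
    case False
    then have "(t / (x + y)) powr 1 \<le> (t / (x + y)) powr l"
      using that s assms by (intro powr_mono') auto
    then show ?thesis using that s by simp
  qed simp
  have "1 = x / (x + y) + y / (x + y)" using s by (simp add: add_divide_distrib[symmetric])
  also have "\<dots> \<le> (x / (x + y)) powr l + (y / (x + y)) powr l"
    using assms by (intro add_mono *) auto
  also have "\<dots> = (x powr l + y powr l) / (x + y) powr l"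
    using assms s by (simp add: powr_divide add_divide_distrib)
  finally show ?thesis using s by (simp add: le_divide_eq)
qed

lemma powr_sum_le:
  fixes f :: "'a \<Rightarrow> real"
  assumes "finite A" "\<And>x. x \<in> A \<Longrightarrow> 0 \<le> f x" "0 < l" "l \<le> 1"
  shows "(\<Sum>x\<in>A. f x) powr l \<le> (\<Sum>x\<in>A. f x powr l)"
  using assms(1,2)
proof (induction A rule: finite_induct)
  case (insert x A)
  have "(f x + (\<Sum>x\<in>A. f x)) powr l \<le> f x powr l + (\<Sum>x\<in>A. f x) powr l"
    using insert assms by (intro powr_add_le sum_nonneg) auto
  also have "\<dots> \<le> f x powr l + (\<Sum>x\<in>A. f x powr l)" using insert by (intro add_left_mono insert.IH) auto
  finally show ?case using insert by simp
qed simp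

text \<open>Subadditivity is applied to the partial sums; raising to the power \<open>1 / l\<close>
  gives a bound independent of their length, which then holds for the series.\<close>

lemma rho_powr_le:
  assumes \<mu>: "1 < \<mu>" and l: "0 < l" "l \<le> 1" "1 < \<mu> * l"
  shows "rho N \<mu> a powr l \<le> rho N (\<mu> * l) a"
proof -
  let ?f = "\<lambda>n. if Suc n mod N = a then 1 / real (Suc n) powr \<mu> else 0"
  let ?g = "\<lambda>n. if Suc n mod N = a then 1 / real (Suc n) powr (\<mu> * l) else 0"
  have fg: "?f n powr l = ?g n" for n by (simp add: powr_divide powr_powr)
  have part: "(\<Sum>n<m. ?f n) \<le> rho N (\<mu> * l) a powr (1 / l)" for m
  proof -
    have f0: "0 \<le> (\<Sum>n<m. ?f n)" by (intro sum_nonneg) auto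
    have "(\<Sum>n<m. ?f n) powr l \<le> (\<Sum>n<m. ?f n powr l)" using l by (intro powr_sum_le) auto
    also have "\<dots> = (\<Sum>n<m. ?g n)" by (simp only: fg)
    also have "\<dots> \<le> rho N (\<mu> * l) a" unfolding rho_def
      by (intro sum_le_suminf rho_summable l) auto
    finally have "((\<Sum>n<m. ?f n) powr l) powr (1 / l) \<le> rho N (\<mu> * l) a powr (1 / l)"
      using l by (intro powr_mono2) auto
    then show ?thesis using l f0 by (simp only: powr_powr) simp
  qed
  have "rho N \<mu> a \<le> rho N (\<mu> * l) a powr (1 / l)"
    unfolding rho_def[of N \<mu>] by (rule suminf_le_const[OF rho_summable[OF \<mu>] part])
  then have "rho N \<mu> a powr l \<le> (rho N (\<mu> * l) a powr (1 / l)) powr l"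
    using l rho_nonneg[OF \<mu>] by (intro powr_mono2) auto
  then show ?thesis using l rho_nonneg[OF l(3)] by (simp add: powr_powr)
qed

subsection \<open>Means of products of cosines over the lattice\<close>

text \<open>In the applications \<open>t\<close> is the index of a lattice point, or a difference of
  two, and \<open>b j\<close> is a frequency times a component of the generating vector. The extra
  frequency \<open>k\<close> accumulates the signed \<open>b j\<close> during inductions on
  \<open>u\<close>.\<close>

definition cos_prod :: "nat \<Rightarrow> (nat \<Rightarrow> int) \<Rightarrow> nat set \<Rightarrow> int \<Rightarrow> int \<Rightarrow> real" where
  "cos_prod N b u k t = cos (2 * pi * of_int k * of_int t / real N) *
     (\<Prod>j\<in>u. 2 * cos (2 * pi * of_int (b j) * of_int t / real N))"

text \<open>The product-to-sum formula; its two terms are the two signs of the new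
  frequency.\<close>

lemma cos_prod_insert:
  assumes "finite u" "j \<notin> u"
  shows "cos_prod N b (insert j u) k t = cos_prod N b u (k + b j) t + cos_prod N b u (k - b j) t"
proof -
  let ?x = "2 * pi * of_int k * of_int t / real N" and ?y = "2 * pi * of_int (b j) * of_int t / real N"
  have "2 * pi * of_int (k + b j) * of_int t / real N = ?x + ?y"
    "2 * pi * of_int (k - b j) * of_int t / real N = ?x - ?y"
    by (simp_all add: algebra_simps add_divide_distrib diff_divide_distrib)
  moreover have "a * (2 * c * P) = (a * c - d * e) * P + (a * c + d * e) * P" for a c d e P :: real
    by algebra
  ultimately show ?thesis unfolding cos_prod_def prod.insert[OF assms] by (simp only: cos_add cos_diff)
qed

text \<open>Every product of cosines is a sum of pure cosines, so agreement on the latter is enough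
  for additive functionals. This serves to compare single means with means over differences.\<close>

lemma cos_prod_mean_unique:
  fixes A A' :: "(int \<Rightarrow> real) \<Rightarrow> real"
  assumes "finite u"
    and "\<And>f g. A (\<lambda>t. f t + g t) = A f + A g" "\<And>f g. A' (\<lambda>t. f t + g t) = A' f + A' g"
    and "\<And>k. A (\<lambda>t. cos (2 * pi * of_int k * of_int t / real N)) = A' (\<lambda>t. cos (2 * pi * of_int k * of_int t / real N))"
  shows "A (cos_prod N b u k) = A' (cos_prod N b u k)"
  using assms(1)
proof (induction u arbitrary: k rule: finite_induct)
  case empty then show ?case using assms(4) by (simp add: cos_prod_def[abs_def])
next
  case (insert j u)
  have "cos_prod N b (insert j u) k = (\<lambda>t. cos_prod N b u (k + b j) t + cos_prod N b u (k - b j) t)"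
    using insert by (intro ext cos_prod_insert)
  then show ?case using insert assms(2,3) by simp
qed

definition mean :: "nat \<Rightarrow> (int \<Rightarrow> real) \<Rightarrow> real" where
  "mean N f = (\<Sum>n<N. f (int n)) / real N"

lemma mean_add: "mean N (\<lambda>t. f t + g t) = mean N f + mean N g"
  by (simp add: mean_def sum.distrib add_divide_distrib)

lemma mean_cos: "N > 0 \<Longrightarrow> mean N (\<lambda>t. cos (2 * pi * of_int k * of_int t / real N)) = of_bool (int N dvd k)"
  using sum_cos_phase[of N 0 k] by (simp add: mean_def)

text \<open>The product splits into \<open>2 ^ card u\<close> pure cosines, each of mean 0 or
  1.\<close>

lemma mean_cos_prod:
  assumes "N > 0" "finite u"
  shows "\<exists>m :: nat. m \<le> 2 ^ card u \<and> mean N (cos_prod N b u k) = real m"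
  using assms(2)
proof (induction u arbitrary: k rule: finite_induct)
  case empty then show ?case using mean_cos[OF assms(1)]
    by (intro exI[of _ "of_bool (int N dvd k)"]) (simp add: cos_prod_def[abs_def])
next
  case (insert j u)
  have eq: "cos_prod N b (insert j u) k = (\<lambda>t. cos_prod N b u (k + b j) t + cos_prod N b u (k - b j) t)"
    using insert by (intro ext cos_prod_insert)
  obtain m m' where "m \<le> 2 ^ card u" "mean N (cos_prod N b u (k + b j)) = real m"
     "m' \<le> 2 ^ card u" "mean N (cos_prod N b u (k - b j)) = real m'" using insert.IH by metis
  then show ?case unfolding eq mean_add using insert by (intro exI[of _ "m + m'"]) auto
qed

text \<open>This counts the sign vectors \<open>\<epsilon> \<in> {-1, 1}\<^sup>u\<close> with \<open>N dvd (\<Sum>j\<in>u. \<epsilon> j * b j)\<close>; only its being a natural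
  number matters, since it makes \<open>t \<mapsto> t powr l\<close> harmless for \<open>l \<le> 1\<close>.\<close>

definition sign_count :: "nat \<Rightarrow> (nat \<Rightarrow> int) \<Rightarrow> nat set \<Rightarrow> real" where
  "sign_count N b u = mean N (cos_prod N b u 0)"

lemma sign_count_bounds: assumes "N > 0" "finite u"
  shows "0 \<le> sign_count N b u" "sign_count N b u \<le> 2 ^ card u"
    and sign_count_powr_le: "\<And>l. 0 < l \<Longrightarrow> l \<le> 1 \<Longrightarrow> sign_count N b u powr l \<le> sign_count N b u"
proof -
  obtain m where m: "m \<le> 2 ^ card u" "sign_count N b u = real m"
    unfolding sign_count_def using mean_cos_prod[OF assms] by blast
  show "0 \<le> sign_count N b u" using m by simp
  have "real m \<le> real (2 ^ card u)" using m(1) by (simp only: of_nat_le_iff)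
  then show "sign_count N b u \<le> 2 ^ card u" using m(2) by simp
  show "sign_count N b u powr l \<le> sign_count N b u" if "0 < l" "l \<le> 1" for l
  proof (cases "m = 0")
    case False
    then have "real m powr l \<le> real m powr 1" using that by (intro powr_mono) auto
    then show ?thesis using m by simp
  qed (use m in simp)
qed

lemma sign_count_cong: "(\<And>j. j \<in> u \<Longrightarrow> b j = b' j) \<Longrightarrow> sign_count N b u = sign_count N b' u"
  unfolding sign_count_def cos_prod_def[abs_def] by (simp cong: prod.cong)

text \<open>On a pure cosine of frequency \<open>k\<close> both the mean over all differences of
  indices and the mean over single indices detect whether \<open>N\<close> divides
  \<open>k\<close>.\<close>

lemma sign_count_double:
  assumes N: "N > 0" and u: "finite u"
  shows "(\<Sum>m<N. \<Sum>n<N. cos_prod N b u 0 (int m - int n)) / real N / real N = sign_count N b u"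
proof -
  define A where "A f = (\<Sum>m<N. \<Sum>n<N. f (int m - int n)) / real N / real N" for f :: "int \<Rightarrow> real"
  have "A (cos_prod N b u 0) = mean N (cos_prod N b u 0)"
  proof (rule cos_prod_mean_unique[OF u])
    show "A (\<lambda>t. f t + g t) = A f + A g" for f g
      by (simp add: A_def sum.distrib add_divide_distrib)
    show "A (\<lambda>t. cos (2 * pi * of_int k * of_int t / real N)) = mean N (\<lambda>t. cos (2 * pi * of_int k * of_int t / real N))" for k
    proof -
      have "(\<Sum>m<N. \<Sum>n<N. cos (2 * pi * of_int k * of_int (int m - int n) / real N)) =
          (\<Sum>m<N. \<Sum>n<N. cos (2 * pi * of_int k * real m / real N + 2 * pi * of_int (- k) * real n / real N))"
        by (intro sum.cong refl arg_cong[where f = cos]) (simp add: algebra_simps diff_divide_distrib)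
      also have "\<dots> = (\<Sum>m<N. if int N dvd - k then real N * cos (2 * pi * of_int k * real m / real N) else 0)"
        unfolding sum_cos_phase[OF N] ..
      also have "\<dots> = of_bool (int N dvd k) * real N * (\<Sum>m<N. cos (0 + 2 * pi * of_int k * real m / real N))"
        by (simp add: sum_distrib_left)
      also have "\<dots> = of_bool (int N dvd k) * real N * real N"
        unfolding sum_cos_phase[OF N] by simp
      finally show ?thesis using N unfolding A_def mean_cos[OF N] by simp
    qed
  qed (rule mean_add)
  then show ?thesis by (simp add: A_def sign_count_def)
qed

text \<open>Each one-dimensional series is folded to a sum over residues before the product is
  expanded, so all exchanges of summation are finite.\<close>

lemma expand_point:
  assumes \<mu>: "1 < \<mu>" and N: "N > 0" and u: "finite u"
  shows "(\<Prod>j\<in>u. 2 * cos_series \<mu> (of_int (t * int (z j)) / real N)) =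
    (\<Sum>a\<in>PiE u (\<lambda>_. {..<N}). (\<Prod>j\<in>u. rho N \<mu> (a j)) * cos_prod N (\<lambda>j. int (a j * z j)) u 0 t)"
proof -
  have "(\<Prod>j\<in>u. 2 * cos_series \<mu> (of_int (t * int (z j)) / real N)) =
    (\<Prod>j\<in>u. \<Sum>a<N. rho N \<mu> a * (2 * cos (2 * pi * real a * of_int (t * int (z j)) / real N)))"
    unfolding cos_series_lattice[OF \<mu> N] sum_distrib_left by (simp add: mult_ac)
  also have "\<dots> = (\<Sum>a\<in>PiE u (\<lambda>_. {..<N}). \<Prod>j\<in>u. rho N \<mu> (a j) * (2 * cos (2 * pi * real (a j) * of_int (t * int (z j)) / real N)))"
    by (rule prod_sum_PiE) (use u in auto)
  also have "\<dots> = (\<Sum>a\<in>PiE u (\<lambda>_. {..<N}). (\<Prod>j\<in>u. rho N \<mu> (a j)) * cos_prod N (\<lambda>j. int (a j * z j)) u 0 t)"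
    unfolding prod.distrib[of "\<lambda>j. rho N \<mu> (_ j)"] cos_prod_def by (simp add: mult_ac)
  finally show ?thesis .
qed

text \<open>For \<open>\<mu> > 1\<close> this is the sum of \<open>\<Prod>j\<in>u. \<bar>h j\<bar> powr - \<mu>\<close> over all \<open>h\<close> with nonzero integer entries
  and \<open>(\<Sum>j\<in>u. h j * z j) mod N = 0\<close>.\<close>

definition dual_sum :: "nat \<Rightarrow> real \<Rightarrow> (nat \<Rightarrow> nat) \<Rightarrow> nat set \<Rightarrow> real" where
  "dual_sum N \<mu> z u = mean N (\<lambda>t. \<Prod>j\<in>u. 2 * cos_series \<mu> (of_int (t * int (z j)) / real N))"

lemma dual_sum_cong: "(\<And>j. j \<in> u \<Longrightarrow> z j = z' j) \<Longrightarrow> dual_sum N \<mu> z u = dual_sum N \<mu> z' u"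
  by (simp add: dual_sum_def cong: prod.cong)

lemma dual_sum_expand:
  assumes \<mu>: "1 < \<mu>" and N: "N > 0" and u: "finite u"
  shows "dual_sum N \<mu> z u = (\<Sum>a\<in>PiE u (\<lambda>_. {..<N}). (\<Prod>j\<in>u. rho N \<mu> (a j)) * sign_count N (\<lambda>j. int (a j * z j)) u)"
  unfolding dual_sum_def expand_point[OF assms] sign_count_def mean_def
  by (subst sum.swap) (simp add: sum_divide_distrib sum_distrib_left)

lemma dual_sum_nonneg: assumes \<mu>: "1 < \<mu>" and N: "N > 0" and u: "finite u" shows "0 \<le> dual_sum N \<mu> z u"
  unfolding dual_sum_expand[OF assms]
  by (intro sum_nonneg mult_nonneg_nonneg prod_nonneg rho_nonneg \<mu> sign_count_bounds N u)

text \<open>Subadditivity passes the exponent to the single summands. There the weights obey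
  \<open>rho_powr_le\<close>, and \<open>sign_count\<close>, being a natural number, does not grow
  under it.\<close>

lemma dual_sum_powr_le:
  assumes \<mu>: "1 < \<mu>" and N: "N > 0" and u: "finite u" and l: "0 < l" "l \<le> 1" "1 < \<mu> * l"
  shows "dual_sum N \<mu> z u powr l \<le> dual_sum N (\<mu> * l) z u"
proof -
  let ?A = "PiE u (\<lambda>_. {..<N})"
  have "dual_sum N \<mu> z u powr l \<le> (\<Sum>a\<in>?A. ((\<Prod>j\<in>u. rho N \<mu> (a j)) * sign_count N (\<lambda>j. int (a j * z j)) u) powr l)"
    unfolding dual_sum_expand[OF \<mu> N u] using u l
    by (intro powr_sum_le mult_nonneg_nonneg prod_nonneg rho_nonneg \<mu> sign_count_bounds N finite_PiE) auto
  also have "\<dots> \<le> (\<Sum>a\<in>?A. (\<Prod>j\<in>u. rho N (\<mu> * l) (a j)) * sign_count N (\<lambda>j. int (a j * z j)) u)"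
  proof (rule sum_mono)
    fix a
    let ?p = "sign_count N (\<lambda>j. int (a j * z j)) u"
    have "((\<Prod>j\<in>u. rho N \<mu> (a j)) * ?p) powr l = (\<Prod>j\<in>u. rho N \<mu> (a j) powr l) * ?p powr l"
      by (simp add: powr_mult prod_powr_distrib rho_nonneg \<mu>)
    also have "\<dots> \<le> (\<Prod>j\<in>u. rho N (\<mu> * l) (a j)) * ?p"
      using rho_powr_le[OF \<mu> l] rho_nonneg[OF l(3)]
      by (intro mult_mono prod_mono sign_count_powr_le prod_nonneg N u l) auto
    finally show "((\<Prod>j\<in>u. rho N \<mu> (a j)) * ?p) powr l \<le> (\<Prod>j\<in>u. rho N (\<mu> * l) (a j)) * ?p" .
  qed
  finally show ?thesis unfolding dual_sum_expand[OF l(3) N u] .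
qed

section \<open>Summing over all choices of a new component\<close>

lemma sum_PiE_insert:
  assumes "j \<notin> u"
  shows "(\<Sum>a\<in>PiE (insert j u) (\<lambda>_. S). F a) = (\<Sum>c\<in>S. \<Sum>a\<in>PiE u (\<lambda>_. S). F (a(j := c)))"
proof -
  have inj: "inj_on (\<lambda>(c, a). a(j := c)) (S \<times> PiE u (\<lambda>_. S))"
    using inj_combinator[OF assms, of "\<lambda>_. S"] by simp
  show ?thesis unfolding PiE_insert_eq sum.reindex[OF inj] sum.cartesian_product
    by (simp add: case_prod_beta comp_def)
qed

lemma sum_prod_rho:
  assumes "1 < \<mu>" "N > 0" "finite u"
  shows "(\<Sum>a\<in>PiE u (\<lambda>_. {..<N}). \<Prod>j\<in>u. rho N \<mu> (a j)) = zeta \<mu> ^ card u"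
  by (subst prod_sum_PiE[symmetric]) (use assms sum_rho[OF assms(1,2)] in auto)

text \<open>The sum over \<open>k\<close> acts on the last cosine alone. For \<open>c = 0\<close>
  that cosine is constant; for other \<open>c\<close> primality leaves \<open>n = 0\<close> as the
  only index where the geometric sum is full, and the value of the product there is
  \<open>2 ^ card v\<close>.\<close>

lemma sign_count_insert_sum:
  assumes N: "prime N" and v: "finite v" "d \<notin> v" and c: "c < N"
  shows "(\<Sum>k=1..N-1. sign_count N (b(d := int (c * k))) (insert d v)) =
    (if c = 0 then 2 * (real N - 1) * sign_count N b v else 2 * (2 ^ card v - sign_count N b v))"
proof -
  have N0: "N > 0" and N2: "N \<ge> 2" using prime_gt_0_nat[OF N] prime_ge_2_nat[OF N] by auto
  let ?e = "\<lambda>n k. cos (2 * pi * of_int (int (c * n)) * real k / real N)"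
  have expand: "sign_count N (b(d := int (c * k))) (insert d v) =
    (\<Sum>n<N. cos_prod N b v 0 (int n) * (2 * ?e n k)) / real N" for k
  proof -
    have "(\<Prod>j\<in>v. 2 * cos (2 * pi * of_int ((b(d := int (c * k))) j) * of_int t / real N)) =
      (\<Prod>j\<in>v. 2 * cos (2 * pi * of_int (b j) * of_int t / real N))" for t :: int
      using v by (intro prod.cong) auto
    moreover have "2 * pi * of_int ((b(d := int (c * k))) d) * of_int (int n) / real N = 2 * pi * of_int (int (c * n)) * real k / real N" for n
      by (simp add: mult_ac)
    ultimately have "cos_prod N (b(d := int (c * k))) (insert d v) 0 (int n) =
      cos_prod N b v 0 (int n) * (2 * ?e n k)" for n
      unfolding cos_prod_def prod.insert[OF v] by (simp only: mult_ac)
    then show ?thesis by (simp only: sign_count_def mean_def)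
  qed
  \<comment> \<open>The missing term \<open>k = 0\<close>, equal to 1, completes a full
    period.\<close>
  have cs: "(\<Sum>k=1..N-1. ?e n k) = (if N dvd c * n then real N else 0) - 1" for n
  proof -
    have "{..<N} = insert 0 {1..N-1}" using N0 by auto
    then have "(\<Sum>k<N. ?e n k) =
      1 + (\<Sum>k=1..N-1. ?e n k)" by simp
    then show ?thesis using sum_cos_phase[OF N0, of 0 "int (c * n)"] by (simp only: add_0_left of_nat_dvd_iff cos_zero mult_1_right)
  qed
  have "(\<Sum>k=1..N-1. sign_count N (b(d := int (c * k))) (insert d v)) =
    (\<Sum>n<N. \<Sum>k=1..N-1. cos_prod N b v 0 (int n) * (2 * ?e n k)) / real N"
    unfolding expand sum_divide_distrib[symmetric] by (subst sum.swap) (rule refl)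
  also have "\<dots> = (\<Sum>n<N. cos_prod N b v 0 (int n) * (2 * ((if N dvd c * n then real N else 0) - 1))) / real N"
    unfolding sum_distrib_left[symmetric] cs ..
  also have "\<dots> = (if c = 0 then 2 * (real N - 1) * sign_count N b v else 2 * (2 ^ card v - sign_count N b v))"
  proof (cases "c = 0")
    case True
    then show ?thesis by (simp add: sign_count_def mean_def sum_distrib_right[symmetric] mult_ac)
  next
    case False
    have dvd: "N dvd c * n \<longleftrightarrow> n = 0" if "n < N" for n
      using N that c False by (auto simp: prime_dvd_mult_iff dest: dvd_imp_le)
    have "(\<Sum>n<N. cos_prod N b v 0 (int n) * (2 * ((if N dvd c * n then real N else 0) - 1))) =
      (\<Sum>n<N. (if n = 0 then 2 * real N * cos_prod N b v 0 (int n) else 0) - 2 * cos_prod N b v 0 (int n))"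
      by (rule sum.cong) (simp_all add: dvd right_diff_distrib)
    also have "\<dots> = 2 * real N * cos_prod N b v 0 0 - 2 * (\<Sum>n<N. cos_prod N b v 0 (int n))"
      using N0 by (simp add: sum_subtractf sum_distrib_left sum.delta)
    also have "cos_prod N b v 0 0 = 2 ^ card v" by (simp add: cos_prod_def)
    finally show ?thesis using False N0 by (simp add: sign_count_def mean_def diff_divide_distrib)
  qed
  finally show ?thesis .
qed

text \<open>The bound does not grow with \<open>N\<close>, so the best of the \<open>N - 1\<close>
  candidates gains a factor \<open>1 / (N - 1)\<close>. The class 0, where the new component has no
  effect, is light enough not to spoil this.\<close>

lemma dual_sum_sum_le:
  assumes N: "prime N" and \<mu>: "1 < \<mu>" and v: "finite v" "d \<notin> v"
  shows "(\<Sum>k=1..N-1. dual_sum N \<mu> (z(d := k)) (insert d v)) \<le> (2 * zeta \<mu>) ^ card (insert d v)"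
proof -
  have N0: "N > 0" and N2: "N \<ge> 2" using prime_gt_0_nat[OF N] prime_ge_2_nat[OF N] by auto
  let ?A = "PiE v (\<lambda>_. {..<N})"
  let ?r = "\<lambda>a. \<Prod>j\<in>v. rho N \<mu> (a j)"
  let ?b = "\<lambda>a j. int (a j * z j)"
  let ?S = "\<lambda>a c. \<Sum>k=1..N-1. sign_count N ((?b a)(d := int (c * k))) (insert d v)"
  have fv: "finite (insert d v)" using v by simp
  have dual_sum: "dual_sum N \<mu> (z(d := k)) (insert d v) =
     (\<Sum>c<N. \<Sum>a\<in>?A. rho N \<mu> c * ?r a * sign_count N ((?b a)(d := int (c * k))) (insert d v))" for k
    unfolding dual_sum_expand[OF \<mu> N0 fv] sum_PiE_insert[OF v(2)]
  proof (intro sum.cong refl arg_cong2[where f = "(*)"])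
    fix c and a :: "nat \<Rightarrow> nat"
    have "(\<Prod>j\<in>v. rho N \<mu> ((a(d := c)) j)) = ?r a" using v by (intro prod.cong) auto
    then show "(\<Prod>j\<in>insert d v. rho N \<mu> ((a(d := c)) j)) = rho N \<mu> c * ?r a" using v by simp
    show "sign_count N (\<lambda>j. int ((a(d := c)) j * (z(d := k)) j)) (insert d v) = sign_count N ((?b a)(d := int (c * k))) (insert d v)"
      by (rule sign_count_cong) auto
  qed
  have "(\<Sum>k=1..N-1. dual_sum N \<mu> (z(d := k)) (insert d v)) =
    (\<Sum>c<N. \<Sum>a\<in>?A. \<Sum>k=1..N-1. rho N \<mu> c * ?r a * sign_count N ((?b a)(d := int (c * k))) (insert d v))"
    unfolding dual_sum by (subst sum.swap) (intro sum.cong refl sum.swap)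
  also have "\<dots> = (\<Sum>a\<in>?A. ?r a * (\<Sum>c<N. rho N \<mu> c * ?S a c))"
    by (subst sum.swap) (simp only: sum_distrib_left mult_ac)
  also have "\<dots> \<le> (\<Sum>a\<in>?A. ?r a * (2 * zeta \<mu> * 2 ^ card v))"
  proof (intro sum_mono mult_left_mono prod_nonneg ballI rho_nonneg \<mu>)
    fix a
    let ?p = "sign_count N (?b a) v" and ?R = "rho N \<mu> 0"
    have p: "0 \<le> ?p" "?p \<le> 2 ^ card v" using sign_count_bounds[OF N0 v(1)] by auto
    have "(\<Sum>c<N. rho N \<mu> c * ?S a c) =
      (\<Sum>c<N. rho N \<mu> c * (if c = 0 then 2 * (real N - 1) * ?p else 2 * (2 ^ card v - ?p)))"
      by (intro sum.cong refl arg_cong2[where f = "(*)"] sign_count_insert_sum N v) simp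
    also have "\<dots> = ?R * (2 * (real N - 1) * ?p) + (\<Sum>c\<in>{..<N}-{0}. rho N \<mu> c * (2 * (2 ^ card v - ?p)))"
      using N0 by (subst sum.remove[of _ 0]) (auto intro!: sum.cong)
    also have "(\<Sum>c\<in>{..<N}-{0}. rho N \<mu> c * (2 * (2 ^ card v - ?p))) = (zeta \<mu> - ?R) * (2 * (2 ^ card v - ?p))"
      unfolding sum_distrib_right[symmetric] using N0 by (simp add: sum_diff1 sum_rho[OF \<mu> N0])
    \<comment> \<open>Collecting \<open>?p\<close> leaves it with a negative multiple of
      \<open>zeta \<mu> - ?R * real N\<close>, which is nonnegative by \<open>rho_zero_le\<close>;
      both subtracted terms may then be dropped.\<close>
    also have "?R * (2 * (real N - 1) * ?p) + \<dots> = 2 * zeta \<mu> * 2 ^ card v - 2 * ?R * 2 ^ card v - 2 * ?p * (zeta \<mu> - ?R * real N)"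
      by (simp add: algebra_simps)
    also have "\<dots> \<le> 2 * zeta \<mu> * 2 ^ card v"
    proof -
      have "?R * real N \<le> zeta \<mu>" using rho_zero_le[OF \<mu> N0] N0 by (simp add: field_simps)
      then have "0 \<le> 2 * ?p * (zeta \<mu> - ?R * real N)" using p by (intro mult_nonneg_nonneg) auto
      moreover have "0 \<le> 2 * ?R * 2 ^ card v" using rho_nonneg[OF \<mu>] by (intro mult_nonneg_nonneg) auto
      ultimately show ?thesis by linarith
    qed
    finally show "(\<Sum>c<N. rho N \<mu> c * ?S a c) \<le> 2 * zeta \<mu> * 2 ^ card v" .
  qed
  also have "\<dots> = zeta \<mu> ^ card v * (2 * zeta \<mu> * 2 ^ card v)"
    unfolding sum_distrib_right[symmetric] sum_prod_rho[OF \<mu> N0 v(1)] ..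
  also have "\<dots> = (2 * zeta \<mu>) ^ card (insert d v)" using v by (simp add: power_mult_distrib)
  finally show ?thesis .
qed

subsection \<open>Lattice points and the Korobov criterion\<close>

lemma cos_series_frac_diff: "cos_series \<mu> (frac x - frac y) = cos_series \<mu> (x - y)"
  using cos_series_add_int[of \<mu> "x - y" "\<lfloor>y\<rfloor> - \<lfloor>x\<rfloor>"] by (simp add: frac_def algebra_simps)

lemma cos_series_frac_add: "cos_series \<mu> (frac x + frac y) = cos_series \<mu> (x + y)"
  using cos_series_add_int[of \<mu> "x + y" "- \<lfloor>y\<rfloor> - \<lfloor>x\<rfloor>"] by (simp add: frac_def algebra_simps)

lemma cos_series_frac: "cos_series \<mu> (frac x) = cos_series \<mu> x"
  using cos_series_frac_diff[of \<mu> x 0] by simp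

lemma lattice_points_neq_empty: "N > 0 \<Longrightarrow> lattice_points s N z \<noteq> {#}"
  by (simp add: lattice_points_def mset_set_empty_iff)

lemma lattice_points_subset: "set_mset (lattice_points s N z) \<subseteq> unit_cube s"
  by (auto simp: lattice_points_def unit_cube_def less_imp_le[OF frac_lt_1])

lemma avg_lattice:
  "avg (lattice_points s N z) f = (\<Sum>n<N. f (\<lambda>j\<in>{1..s}. frac (real n * real (z j) / real N))) / real N"
  by (simp add: lattice_points_def avg_image_mset avg_mset_set atLeast0LessThan)

text \<open>The squared worst-case error in the Korobov space.\<close>

definition korobov_error :: "nat \<Rightarrow> real \<Rightarrow> (nat set \<Rightarrow> real) \<Rightarrow> nat \<Rightarrow> (nat \<Rightarrow> nat) \<Rightarrow> real" where
  "korobov_error N \<mu> \<eta> s z = (\<Sum>u\<in>Pow {1..s} - {{}}. \<eta> u * dual_sum N \<mu> z u)"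

lemma finite_Pow_mem: "u \<in> Pow {1..s :: nat} - {{}} \<Longrightarrow> finite u"
  using finite_subset by blast

text \<open>The kernel depends on differences of lattice points, which modulo 1 are again lattice
  points; \<open>sign_count_double\<close> collapses the double mean.\<close>

lemma korobov_double_mean:
  assumes \<mu>: "1 < \<mu>" and N: "N > 0" and u: "u \<subseteq> {1..s}"
  shows "avg (lattice_points s N z) (\<lambda>x. avg (lattice_points s N z) (\<lambda>y. \<Prod>j\<in>u. 2 * cos_series \<mu> (x j - y j))) = dual_sum N \<mu> z u"
proof -
  have fu: "finite u" using u finite_subset by blast
  let ?pt = "\<lambda>n. \<lambda>j\<in>{1..s}. frac (real n * real (z j) / real N)"
  let ?L = "lattice_points s N z" and ?A = "PiE u (\<lambda>_. {..<N})" and ?r = "\<lambda>a. \<Prod>j\<in>u. rho N \<mu> (a j)"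
  let ?c = "\<lambda>a m n. cos_prod N (\<lambda>j. int (a j * z j)) u 0 (int m - int n)"
  have pt: "(\<Prod>j\<in>u. 2 * cos_series \<mu> (?pt m j - ?pt n j)) =
    (\<Sum>a\<in>?A. ?r a * ?c a m n)" for m n
  proof -
    have "(\<Prod>j\<in>u. 2 * cos_series \<mu> (?pt m j - ?pt n j)) = (\<Prod>j\<in>u. 2 * cos_series \<mu> (of_int ((int m - int n) * int (z j)) / real N))"
    proof (intro prod.cong refl arg_cong2[where f = "(*)"])
      fix j assume "j \<in> u"
      then have "j \<in> {1..s}" using u by blast
      then show "cos_series \<mu> (?pt m j - ?pt n j) = cos_series \<mu> (of_int ((int m - int n) * int (z j)) / real N)"
        by (simp only: restrict_apply' cos_series_frac_diff)
           (simp add: left_diff_distrib diff_divide_distrib)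
    qed
    then show ?thesis unfolding expand_point[OF \<mu> N fu] .
  qed
  have "avg ?L (\<lambda>x. avg ?L (\<lambda>y. \<Prod>j\<in>u. 2 * cos_series \<mu> (x j - y j))) =
    (\<Sum>m<N. \<Sum>n<N. \<Sum>a\<in>?A. ?r a * ?c a m n) / real N / real N"
    unfolding avg_lattice pt sum_divide_distrib[symmetric] ..
  also have "\<dots> = (\<Sum>a\<in>?A. \<Sum>m<N. \<Sum>n<N. ?r a * ?c a m n) / real N / real N"
    by (subst (2) sum.swap, subst sum.swap) (rule refl)
  also have "\<dots> = (\<Sum>a\<in>?A. ?r a * ((\<Sum>m<N. \<Sum>n<N. ?c a m n) / real N / real N))"
    unfolding sum_divide_distrib[of _ "?A"] sum_distrib_left[symmetric] times_divide_eq_right ..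
  also have "\<dots> = dual_sum N \<mu> z u" unfolding sign_count_double[OF N fu] dual_sum_expand[OF \<mu> N fu] ..
  finally show ?thesis .
qed

lemma worst_case_error_korobov:
  assumes \<beta>: "1 < 2 * \<beta>" and N: "N > 0" and \<eta>: "\<And>u. u \<subseteq> {1..s} \<Longrightarrow> 0 \<le> \<eta> u"
  shows "worst_case_error s (lattice_points s N z) (korobov_space \<beta> \<eta> s) = ereal (sqrt (korobov_error N (2 * \<beta>) \<eta> s z))"
    and "0 \<le> korobov_error N (2 * \<beta>) \<eta> s z"
proof -
  interpret kernel_1d "\<lambda>x y. 2 * cos_series (2 * \<beta>) (x - y)" "2 * zeta (2 * \<beta>)" "2 * zeta (2 * \<beta>)"
    by (rule kernel_1d_korobov[OF \<beta>])
  interpret mean_one_kernel s "korobov_kernel \<beta> \<eta> s" "1 + (\<Sum>u\<in>Pow {1..s} - {{}}. \<eta> u * (2 * zeta (2 * \<beta>)) ^ card u)"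
    "\<lambda>M. \<Sum>u\<in>Pow {1..s} - {{}}. \<eta> u * (2 * zeta (2 * \<beta>) / real (Suc M)) ^ card u"
    unfolding korobov_kernel_eq[OF \<beta>] by (rule mean_one_product_kernel[OF \<eta>])
  let ?L = "lattice_points s N z"
  note ne = lattice_points_neq_empty[OF N, of s z]
  have "avg ?L (\<lambda>x. avg ?L (korobov_kernel \<beta> \<eta> s x)) - 1 =
    (\<Sum>u\<in>Pow {1..s} - {{}}. \<eta> u * avg ?L (\<lambda>x. avg ?L (\<lambda>y. \<Prod>j\<in>u. 2 * cos_series (2 * \<beta>) (x j - y j))))"
    unfolding korobov_kernel_eq[OF \<beta>] product_kernel_def avg_add avg_const[OF ne] avg_sum avg_cmult
    by (rule add_diff_cancel_left')
  also have "\<dots> = korobov_error N (2 * \<beta>) \<eta> s z"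
    unfolding korobov_error_def by (intro sum.cong refl arg_cong2[where f = "(*)"] korobov_double_mean \<beta> N) auto
  finally have eq: "avg ?L (\<lambda>x. avg ?L (korobov_kernel \<beta> \<eta> s x)) - 1 = korobov_error N (2 * \<beta>) \<eta> s z" .
  show "worst_case_error s ?L (korobov_space \<beta> \<eta> s) = ereal (sqrt (korobov_error N (2 * \<beta>) \<eta> s z))"
    "0 \<le> korobov_error N (2 * \<beta>) \<eta> s z"
    using worst_case_error_eq[OF ne lattice_points_subset] unfolding eq[symmetric] by auto
qed

subsection \<open>The component-by-component construction\<close>

lemma korobov_criterion_eq:
  assumes "1 < 2 * \<beta>" "N > 0" "\<And>u. u \<subseteq> {1..d} \<Longrightarrow> 0 \<le> \<eta> u"
  shows "korobov_criterion \<beta> \<eta> N d z = ereal (korobov_error N (2 * \<beta>) \<eta> d z)"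
  using worst_case_error_korobov[OF assms] by (simp add: korobov_criterion_def)

lemma korobov_criterion_cong:
  assumes "\<And>j. j \<in> {1..d} \<Longrightarrow> z j = z' j"
  shows "korobov_criterion \<beta> \<eta> N d z = korobov_criterion \<beta> \<eta> N d z'"
proof -
  have "lattice_points d N z = lattice_points d N z'"
    unfolding lattice_points_def using assms by (intro image_mset_cong restrict_ext) simp
  then show ?thesis by (simp add: korobov_criterion_def)
qed

text \<open>Appending a minimizer as last component leaves the criteria of lower dimension
  unchanged, so earlier choices remain minimal.\<close>

lemma cbc_output_exists:
  fixes crit :: "nat \<Rightarrow> (nat \<Rightarrow> nat) \<Rightarrow> 'b :: linorder"
  assumes "N \<ge> 2" and cong: "\<And>d z z'. (\<And>j. j \<in> {1..d} \<Longrightarrow> z j = z' j) \<Longrightarrow> crit d z = crit d z'"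
  shows "\<exists>z. cbc_output crit N s z"
proof (induction s)
  case 0
  then show ?case by (intro exI[of _ "\<lambda>_. 1"]) (simp add: cbc_output_def)
next
  case (Suc s)
  then obtain z where z: "cbc_output crit N s z" by blast
  show ?case
  proof (cases "s = 0")
    case True
    then show ?thesis by (intro exI[of _ "\<lambda>_. 1"]) (simp add: cbc_output_def)
  next
    case False
    let ?f = "\<lambda>k. crit (Suc s) (z(Suc s := k))"
    have fin: "finite {1..N - 1}" "{1..N - 1} \<noteq> {}" using assms(1) by auto
    define m where "m = arg_min_on ?f {1..N - 1}"
    have m: "is_arg_min ?f (\<lambda>k. k \<in> {1..N - 1}) m"
      unfolding is_arg_min_linorder m_def using arg_min_if_finite(1)[OF fin, of ?f] arg_min_least[OF fin, of _ ?f] by blast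
    have "cbc_output crit N (Suc s) (z(Suc s := m))"
      unfolding cbc_output_def
    proof (intro conjI ballI)
      show "(z(Suc s := m)) 1 = 1" using z False by (simp add: cbc_output_def)
      fix d assume d: "d \<in> {2..Suc s}"
      show "is_arg_min (\<lambda>k. crit d ((z(Suc s := m))(d := k))) (\<lambda>k. k \<in> {1..N - 1}) ((z(Suc s := m)) d)"
      proof (cases "d = Suc s")
        case True then show ?thesis using m by simp
      next
        case False
        then have "crit d ((z(Suc s := m))(d := k)) = crit d (z(d := k))" for k
          using d by (intro cong) auto
        then show ?thesis using z d False by (simp add: cbc_output_def)
      qed
    qed
    then show ?thesis by blast
  qed
qed

lemma sum_Pow_Suc:
  fixes F :: "nat set \<Rightarrow> real"
  shows "(\<Sum>u\<in>Pow {1..Suc d} - {{}}. F u) = (\<Sum>u\<in>Pow {1..d} - {{}}. F u) + (\<Sum>v\<in>Pow {1..d}. F (insert (Suc d) v))"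
proof -
  have "{1..Suc d} = insert (Suc d) {1..d}" by auto
  moreover have "(Pow A \<union> insert x ` Pow A) - {{}} = (Pow A - {{}}) \<union> insert x ` Pow A" for A :: "nat set" and x
    by auto
  ultimately have eq: "Pow {1..Suc d} - {{}} = (Pow {1..d} - {{}}) \<union> insert (Suc d) ` Pow {1..d}"
    by (simp only: Pow_insert)
  have notin: "Suc d \<notin> v" if "v \<in> Pow {1..d}" for v using that by auto
  have inj: "inj_on (insert (Suc d)) (Pow {1..d})"
    by (rule inj_onI) (simp only: insert_ident[OF notin notin])
  have "Suc d \<in> v" if "v \<in> insert (Suc d) ` Pow {1..d}" for v using that by auto
  then have disj: "(Pow {1..d} - {{}}) \<inter> insert (Suc d) ` Pow {1..d} = {}" using notin by auto
  have "(\<Sum>u\<in>Pow {1..Suc d} - {{}}. F u) = (\<Sum>u\<in>Pow {1..d} - {{}}. F u) + (\<Sum>u\<in>insert (Suc d) ` Pow {1..d}. F u)"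
    unfolding eq by (rule sum.union_disjoint[OF _ _ disj]) simp_all
  then show ?thesis by (simp only: sum.reindex[OF inj] comp_def)
qed

lemma korobov_error_Suc:
  "korobov_error N \<mu> \<eta> (Suc d) z = korobov_error N \<mu> \<eta> d z + (\<Sum>v\<in>Pow {1..d}. \<eta> (insert (Suc d) v) * dual_sum N \<mu> z (insert (Suc d) v))"
  unfolding korobov_error_def by (rule sum_Pow_Suc)

lemma korobov_error_cong: "(\<And>j. j \<in> {1..d} \<Longrightarrow> z j = z' j) \<Longrightarrow> korobov_error N \<mu> \<eta> d z = korobov_error N \<mu> \<eta> d z'"
  unfolding korobov_error_def by (intro sum.cong refl arg_cong2[where f = "(*)"] dual_sum_cong) auto

lemma korobov_error_nonneg:
  assumes "1 < \<mu>" "N > 0" "\<And>u. u \<subseteq> {1..d} \<Longrightarrow> 0 \<le> \<eta> u"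
  shows "0 \<le> korobov_error N \<mu> \<eta> d z"
  unfolding korobov_error_def using assms by (intro sum_nonneg mult_nonneg_nonneg dual_sum_nonneg) (auto intro: finite_subset)

text \<open>In dimension one the error is the same for every admissible \<open>k\<close>, because
  multiplication by \<open>k\<close> fixes only the class 0 as divisible by
  \<open>N\<close>.\<close>

lemma korobov_error_one:
  assumes N: "prime N" and \<mu>: "1 < \<mu>" and k: "k \<in> {1..N - 1}"
  shows "korobov_error N \<mu> \<eta> 1 (\<lambda>_. k) = \<eta> {1} * (2 * rho N \<mu> 0)"
proof -
  have N0: "N > 0" using prime_gt_0_nat[OF N] .
  have "dual_sum N \<mu> (\<lambda>_. k) {1} = mean N (\<lambda>t. \<Sum>a<N. rho N \<mu> a * (2 * cos (2 * pi * of_int (int (a * k)) * of_int t / real N)))"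
    unfolding dual_sum_def cos_series_lattice[OF \<mu> N0] by (simp add: sum_distrib_left mult_ac)
  also have "\<dots> = (\<Sum>a<N. rho N \<mu> a * (2 * mean N (\<lambda>t. cos (2 * pi * of_int (int (a * k)) * of_int t / real N))))"
    unfolding mean_def by (subst sum.swap) (simp add: sum_divide_distrib sum_distrib_left)
  also have "\<dots> = (\<Sum>a<N. if a = 0 then rho N \<mu> a * 2 else 0)"
  proof (intro sum.cong refl)
    fix a assume "a \<in> {..<N}"
    then have "int N dvd int (a * k) \<longleftrightarrow> a = 0"
      using N k by (auto simp: prime_dvd_mult_iff of_nat_dvd_iff simp del: of_nat_mult dest: dvd_imp_le)
    then show "rho N \<mu> a * (2 * mean N (\<lambda>t. cos (2 * pi * of_int (int (a * k)) * of_int t / real N))) = (if a = 0 then rho N \<mu> a * 2 else 0)"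
      unfolding mean_cos[OF N0] by simp
  qed
  also have "\<dots> = 2 * rho N \<mu> 0" using N0 by simp
  finally have D: "dual_sum N \<mu> (\<lambda>_. k) {1} = 2 * rho N \<mu> 0" .
  have "Pow {1..1 :: nat} - {{}} = {{1}}" by auto
  then show ?thesis unfolding korobov_error_def using D by simp
qed

text \<open>The prescribed first component 1 is also a minimizer, by
  \<open>korobov_error_one\<close>; hence the induction in \<open>cbc_bound\<close> treats all
  dimensions alike.\<close>

lemma cbc_minimal:
  assumes N: "prime N" and \<beta>: "1 < 2 * \<beta>" and \<eta>: "\<And>u. u \<subseteq> {1..s} \<Longrightarrow> 0 \<le> \<eta> u"
    and cbc: "cbc_output (korobov_criterion \<beta> \<eta> N) N s z"
    and d: "d \<in> {1..s}" and k: "k \<in> {1..N - 1}"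
  shows "korobov_error N (2 * \<beta>) \<eta> d z \<le> korobov_error N (2 * \<beta>) \<eta> d (z(d := k))"
proof (cases "d = 1")
  case True
  have z1: "z 1 = 1" using cbc by (simp add: cbc_output_def)
  have "1 \<in> {1..N - 1}" using k by simp
  have "korobov_error N (2 * \<beta>) \<eta> d z = korobov_error N (2 * \<beta>) \<eta> 1 (\<lambda>_. 1)"
    unfolding True using z1 by (intro korobov_error_cong) auto
  also have "\<dots> = korobov_error N (2 * \<beta>) \<eta> 1 (\<lambda>_. k)"
    using korobov_error_one[OF N \<beta> k] korobov_error_one[OF N \<beta> \<open>1 \<in> {1..N - 1}\<close>] by simp
  also have "\<dots> = korobov_error N (2 * \<beta>) \<eta> d (z(d := k))"
    unfolding True by (intro korobov_error_cong) auto
  finally show ?thesis by simp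
next
  case False
  then have "d \<in> {2..s}" using d by auto
  then have min: "is_arg_min (\<lambda>k. korobov_criterion \<beta> \<eta> N d (z(d := k))) (\<lambda>k. k \<in> {1..N - 1}) (z d)"
    using cbc by (auto simp: cbc_output_def)
  have crit: "korobov_criterion \<beta> \<eta> N d z = ereal (korobov_error N (2 * \<beta>) \<eta> d z)" for z
    using d by (intro korobov_criterion_eq \<beta> \<eta> prime_gt_0_nat N) auto
  have "korobov_criterion \<beta> \<eta> N d (z(d := z d)) \<le> korobov_criterion \<beta> \<eta> N d (z(d := k))"
    using min k unfolding is_arg_min_linorder by blast
  then show ?thesis unfolding crit by simp
qed

text \<open>Induction on the dimension. The sets containing the new coordinate are controlled by
  averaging over its candidates, the others by the induction hypothesis, and subadditivity joins the
  two parts.\<close>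

theorem cbc_bound:
  assumes N: "prime N" and \<beta>: "1 < 2 * \<beta>" and \<eta>: "\<And>u. u \<subseteq> {1..s} \<Longrightarrow> 0 \<le> \<eta> u"
    and cbc: "cbc_output (korobov_criterion \<beta> \<eta> N) N s z"
    and l: "0 < l" "l \<le> 1" "1 < 2 * \<beta> * l"
  shows "korobov_error N (2 * \<beta>) \<eta> s z powr l \<le>
    (\<Sum>u\<in>Pow {1..s} - {{}}. \<eta> u powr l * (2 * zeta (2 * \<beta> * l)) ^ card u) / (real N - 1)"
proof -
  let ?\<mu> = "2 * \<beta>" and ?Z = "2 * zeta (2 * \<beta> * l)"
  have N0: "N > 0" and N2: "N \<ge> 2" using prime_gt_0_nat[OF N] prime_ge_2_nat[OF N] by auto
  have "d \<le> s \<Longrightarrow> korobov_error N ?\<mu> \<eta> d z powr l \<le> (\<Sum>u\<in>Pow {1..d} - {{}}. \<eta> u powr l * ?Z ^ card u) / (real N - 1)" for d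
  proof (induction d)
    case 0 then show ?case by (simp add: korobov_error_def)
  next
    case (Suc d)
    have \<eta>d: "0 \<le> \<eta> u" if "u \<subseteq> {1..Suc d}" for u using that Suc.prems by (intro \<eta>) auto
    let ?w = "insert (Suc d)" and ?D = "\<lambda>k. dual_sum N (?\<mu> * l) (z(Suc d := k))"
    \<comment> \<open>The part of the error that involves the new coordinate; the rest is already
      fixed, so minimizing the criterion minimizes \<theta>.\<close>
    define \<theta> where "\<theta> z = (\<Sum>v\<in>Pow {1..d}. \<eta> (?w v) * dual_sum N ?\<mu> z (?w v))" for z
    have fv: "finite v" "Suc d \<notin> v" "insert (Suc d) v \<subseteq> {1..Suc d}" if "v \<in> Pow {1..d}" for v
      using that finite_subset by auto
    have term0: "0 \<le> \<eta> (?w v) * dual_sum N ?\<mu> z (?w v)" if "v \<in> Pow {1..d}" for v z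
      using fv[OF that] by (intro mult_nonneg_nonneg \<eta>d dual_sum_nonneg \<beta> N0) auto
    have \<theta>0: "0 \<le> \<theta> z" for z unfolding \<theta>_def by (intro sum_nonneg term0)
    have \<theta>_min: "\<theta> z \<le> \<theta> (z(Suc d := k))" if "k \<in> {1..N - 1}" for k
    proof -
      have "korobov_error N ?\<mu> \<eta> d (z(Suc d := k)) = korobov_error N ?\<mu> \<eta> d z" by (rule korobov_error_cong) auto
      then show ?thesis
        using cbc_minimal[OF N \<beta> \<eta> cbc _ that, of "Suc d"] Suc.prems unfolding korobov_error_Suc \<theta>_def by simp
    qed
    \<comment> \<open>The minimum is compared with all \<open>N - 1\<close> candidates at once,
      after taking powers, so that the sum over \<open>k\<close> can be moved inside.\<close>
    have "(real N - 1) * \<theta> z powr l = (\<Sum>k=1..N-1. \<theta> z powr l)" using N0 by (simp add: of_nat_diff)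
    also have "\<dots> \<le> (\<Sum>k=1..N-1. \<theta> (z(Suc d := k)) powr l)"
      using \<theta>0 \<theta>_min l by (intro sum_mono powr_mono2) auto
    also have "\<dots> \<le> (\<Sum>k=1..N-1. \<Sum>v\<in>Pow {1..d}. \<eta> (?w v) powr l * ?D k (?w v))"
    proof (rule sum_mono)
      fix k
      have "\<theta> (z(Suc d := k)) powr l \<le> (\<Sum>v\<in>Pow {1..d}. (\<eta> (?w v) * dual_sum N ?\<mu> (z(Suc d := k)) (?w v)) powr l)"
        unfolding \<theta>_def using l by (intro powr_sum_le term0) auto
      also have "\<dots> \<le> (\<Sum>v\<in>Pow {1..d}. \<eta> (?w v) powr l * ?D k (?w v))"
      proof (rule sum_mono)
        fix v assume v: "v \<in> Pow {1..d}"
        have "finite (?w v)" using fv[OF v] by simp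
        then show "(\<eta> (?w v) * dual_sum N ?\<mu> (z(Suc d := k)) (?w v)) powr l
          \<le> \<eta> (?w v) powr l * ?D k (?w v)"
          using \<eta>d[OF fv(3)[OF v]] dual_sum_nonneg[OF \<beta> N0] dual_sum_powr_le[OF \<beta> N0 _ l]
          by (simp add: powr_mult mult_left_mono)
      qed
      finally show "\<theta> (z(Suc d := k)) powr l \<le> \<dots>" .
    qed
    also have "\<dots> = (\<Sum>v\<in>Pow {1..d}. \<eta> (?w v) powr l * (\<Sum>k=1..N-1. ?D k (?w v)))"
      by (subst sum.swap) (simp only: sum_distrib_left)
    also have "\<dots> \<le> (\<Sum>v\<in>Pow {1..d}. \<eta> (?w v) powr l * ?Z ^ card (?w v))"
      using fv by (intro sum_mono mult_left_mono dual_sum_sum_le N l) auto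
    finally have "\<theta> z powr l \<le> (\<Sum>v\<in>Pow {1..d}. \<eta> (?w v) powr l * ?Z ^ card (?w v)) / (real N - 1)"
      using N2 by (simp add: pos_le_divide_eq mult.commute)
    moreover have "korobov_error N ?\<mu> \<eta> (Suc d) z powr l \<le> korobov_error N ?\<mu> \<eta> d z powr l + \<theta> z powr l"
    proof -
      have "0 \<le> korobov_error N ?\<mu> \<eta> d z" by (intro korobov_error_nonneg \<beta> N0 \<eta>d) (erule order_trans, simp)
      then show ?thesis unfolding korobov_error_Suc \<theta>_def[symmetric] using \<theta>0 l by (intro powr_add_le) auto
    qed
    moreover have "(\<Sum>u\<in>Pow {1..Suc d} - {{}}. \<eta> u powr l * ?Z ^ card u) =
      (\<Sum>u\<in>Pow {1..d} - {{}}. \<eta> u powr l * ?Z ^ card u) + (\<Sum>v\<in>Pow {1..d}. \<eta> (?w v) powr l * ?Z ^ card (?w v))"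
      by (rule sum_Pow_Suc)
    ultimately show ?case using Suc.IH Suc.prems by (simp add: add_divide_distrib)
  qed
  then show ?thesis by simp
qed

subsection \<open>Symmetrization\<close>

lemma avg_swap: "avg P (\<lambda>x. avg Q (\<lambda>y. F x y)) = avg Q (\<lambda>y. avg P (\<lambda>x. F x y))"
proof -
  have div: "(\<Sum>x\<in>#A. f x / c) = (\<Sum>x\<in>#A. f x) / c" for A :: "'c multiset" and f and c :: real
    by (induction A) (auto simp: add_divide_distrib)
  have "(\<Sum>x\<in>#P. \<Sum>y\<in>#Q. F x y) = (\<Sum>y\<in>#Q. \<Sum>x\<in>#P. F x y)" by (rule sum_mset.swap)
  then show ?thesis by (simp add: avg_def div mult.commute)
qed

lemma sum_mset_sum_mset: "finite U \<Longrightarrow> (\<Sum>x\<in>#(\<Sum>u\<in>U. M u). f x) = (\<Sum>u\<in>U. \<Sum>x\<in>#M u. f x)"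
  by (induction U rule: finite_induct) auto

lemma size_sum_multiset:
  fixes M :: "'a \<Rightarrow> 'b multiset"
  shows "finite U \<Longrightarrow> size (\<Sum>u\<in>U. M u) = (\<Sum>u\<in>U. size (M u))"
  by (induction U rule: finite_induct) auto

lemma size_symmetrized: "size (symmetrized_points s P) = 2 ^ s * size P"
  by (simp add: symmetrized_points_def size_sum_multiset card_Pow)

lemma avg_symmetrized:
  "avg (symmetrized_points s P) f = (\<Sum>v\<in>Pow {1..s}. avg P (\<lambda>x. f (sym_point s v x))) / 2 ^ s"
  unfolding avg_def size_symmetrized unfolding symmetrized_points_def
    by (subst sum_mset_sum_mset)
       (simp_all add: image_mset.compositionality comp_def sum_divide_distrib[symmetric] mult.commute)

text \<open>The reflections of different coordinates are independent, so the sum over all subsets is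
  the expansion of a product of two-term sums.\<close>

lemma avg_symmetrized_prod:
  assumes "u \<subseteq> {1..s}"
  shows "avg (symmetrized_points s P) (\<lambda>x. \<Prod>j\<in>u. h j (x j)) = avg P (\<lambda>x. \<Prod>j\<in>u. (h j (x j) + h j (1 - x j)) / 2)"
proof -
  have pt: "(\<Sum>v\<in>Pow {1..s}. \<Prod>j\<in>u. h j (sym_point s v x j)) / 2 ^ s = (\<Prod>j\<in>u. (h j (x j) + h j (1 - x j)) / 2)" for x
  proof -
    \<comment> \<open>Coordinates outside \<open>u\<close> get the value 1 twice, and the division
      by 2 removes them again.\<close>
    define f g where "f j = (if j \<in> u then h j (1 - x j) else 1)" and "g j = (if j \<in> u then h j (x j) else 1)" for j
    have "(\<Prod>j\<in>u. h j (sym_point s v x j)) = (\<Prod>j\<in>v. f j) * (\<Prod>j\<in>{1..s} - v. g j)" if "v \<in> Pow {1..s}" for v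
    proof -
      have "(\<Prod>j\<in>u. h j (sym_point s v x j)) = (\<Prod>j\<in>u. if j \<in> v then f j else g j)"
        using assms by (intro prod.cong) (auto simp: sym_point_def f_def g_def)
      also have "\<dots> = (\<Prod>j\<in>{1..s}. if j \<in> v then f j else g j)"
        using assms by (intro prod.mono_neutral_left) (auto simp: f_def g_def)
      also have "\<dots> = (\<Prod>j\<in>v. f j) * (\<Prod>j\<in>{1..s} - v. g j)"
        using that by (subst prod.If_cases) (auto simp: Int_absorb1 Diff_eq)
      finally show ?thesis .
    qed
    then have "(\<Sum>v\<in>Pow {1..s}. \<Prod>j\<in>u. h j (sym_point s v x j)) = (\<Sum>v\<in>Pow {1..s}. (\<Prod>j\<in>v. f j) * (\<Prod>j\<in>{1..s} - v. g j))"
      by (intro sum.cong refl)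
    also have "\<dots> = (\<Prod>j\<in>{1..s}. f j + g j)" by (rule prod_add[symmetric]) simp
    finally have "(\<Sum>v\<in>Pow {1..s}. \<Prod>j\<in>u. h j (sym_point s v x j)) / 2 ^ s = (\<Prod>j\<in>{1..s}. (f j + g j) / 2)"
      by (simp add: prod_dividef)
    also have "\<dots> = (\<Prod>j\<in>u. (h j (x j) + h j (1 - x j)) / 2)"
      using assms by (intro prod.mono_neutral_cong_right) (auto simp: f_def g_def)
    finally show ?thesis .
  qed
  show ?thesis unfolding avg_symmetrized avg_sum[symmetric] pt[symmetric]
    using avg_cmult[of P "1 / 2 ^ s"] by simp
qed

lemma symmetrized_subset:
  assumes "set_mset P \<subseteq> unit_cube s" shows "set_mset (symmetrized_points s P) \<subseteq> unit_cube s"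
proof
  fix y assume "y \<in># symmetrized_points s P"
  then obtain v x where y: "y = sym_point s v x" and x: "x \<in># P"
    by (auto simp: symmetrized_points_def set_mset_sum)
  have "x j \<in> {0..1}" if "j \<in> {1..s}" for j using assms x that unit_cube_coord by blast
  then show "y \<in> unit_cube s" unfolding y by (auto simp: unit_cube_def sym_point_def)
qed

lemma symmetrized_neq_empty: "P \<noteq> {#} \<Longrightarrow> symmetrized_points s P \<noteq> {#}"
  using size_symmetrized[of s P] by (metis mult_eq_0_iff power_eq_0_iff size_eq_0_iff_empty zero_neq_numeral)

text \<open>The nested halves are the form produced by two successive uses of
  \<open>avg_symmetrized_prod\<close>.\<close>

definition sym_sob :: "nat \<Rightarrow> real \<Rightarrow> real \<Rightarrow> real" where
  "sym_sob \<alpha> x y = ((sob \<alpha> x y + sob \<alpha> x (1 - y)) / 2 + (sob \<alpha> (1 - x) y + sob \<alpha> (1 - x) (1 - y)) / 2) / 2"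

text \<open>Among the four reflected terms odd degrees cancel and degree \<alpha> is invariant,
  while the argument \<open>x - y\<close> becomes, up to sign and integers, \<open>x - y\<close>
  twice and \<open>x + y\<close> twice.\<close>

lemma sym_sob_eq:
  assumes \<alpha>: "even \<alpha>" "0 < \<alpha>" and x: "x \<in> {0..1}" and y: "y \<in> {0..1}"
  shows "sym_sob \<alpha> x y = 4 / (2 * pi) ^ (2 * \<alpha>) * (cos_series (real \<alpha>) x * cos_series (real \<alpha>) y)
     + 1 / (2 * pi) ^ (2 * \<alpha>) * (cos_series (2 * real \<alpha>) (x - y) + cos_series (2 * real \<alpha>) (x + y))"
proof -
  let ?T = "{\<tau>. 1 \<le> \<tau> \<and> \<tau> \<le> \<alpha> \<and> (odd \<tau> \<or> \<tau> = \<alpha>)}"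
  let ?b = "\<lambda>\<tau> x. bernpoly \<tau> x" and ?f = "\<lambda>\<tau>. 1 / (fact \<tau>)\<^sup>2 :: real"
  let ?c = "2 / (2 * pi) ^ (2 * \<alpha>) :: real" and ?C = "cos_series (2 * real \<alpha>)"
  let ?S = "\<lambda>x y. \<Sum>\<tau>\<in>?T. ?f \<tau> * (?b \<tau> x * ?b \<tau> y)"
  have x': "1 - x \<in> {0..1}" and y': "1 - y \<in> {0..1}" using x y by auto
  have C: "?C (x - (1 - y)) = ?C (x + y)" "?C (1 - x - y) = ?C (x + y)" "?C (1 - x - (1 - y)) = ?C (x - y)"
  proof -
    have "x - (1 - y) = x + y + of_int (- 1)" by simp
    then show "?C (x - (1 - y)) = ?C (x + y)" by (simp only: cos_series_add_int)
    show "?C (1 - x - y) = ?C (x + y)"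
      using cos_series_add_int[of "2 * real \<alpha>" "- (x + y)" 1] cos_series_minus[of _ "x + y"] by (simp add: algebra_simps)
    show "?C (1 - x - (1 - y)) = ?C (x - y)" using cos_series_minus[of _ "x - y"] by simp
  qed
  have sum: "?S x y + ?S x (1 - y) + ?S (1 - x) y + ?S (1 - x) (1 - y) = ?f \<alpha> * (4 * (?b \<alpha> x * ?b \<alpha> y))"
  proof -
    have even_reflect: "?b \<alpha> (1 - t) = ?b \<alpha> t" if t: "0 \<le> t" "t \<le> 1" for t
    proof -
      have "cos_series (real \<alpha>) (1 - t) = cos_series (real \<alpha>) t"
        using cos_series_add_int[of "real \<alpha>" "- t" 1] cos_series_minus[of _ t] by simp
      then have "?b \<alpha> (1 - t) / fact \<alpha> = ?b \<alpha> t / fact \<alpha>"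
        using bernpoly_even_fourier[OF \<alpha>, of t] bernpoly_even_fourier[OF \<alpha>, of "1 - t"] t by simp
      then show ?thesis by simp
    qed
    have "?S x y + ?S x (1 - y) + ?S (1 - x) y + ?S (1 - x) (1 - y) = (\<Sum>\<tau>\<in>?T. ?f \<tau> * ((?b \<tau> x + ?b \<tau> (1 - x)) * (?b \<tau> y + ?b \<tau> (1 - y))))"
      unfolding sum.distrib[symmetric] by (intro sum.cong refl) algebra
    also have "\<dots> = (\<Sum>\<tau>\<in>?T. if \<tau> = \<alpha> then ?f \<alpha> * (4 * (?b \<alpha> x * ?b \<alpha> y)) else 0)"
    proof (intro sum.cong refl)
      fix \<tau> assume \<tau>: "\<tau> \<in> ?T"
      show "?f \<tau> * ((?b \<tau> x + ?b \<tau> (1 - x)) * (?b \<tau> y + ?b \<tau> (1 - y))) = (if \<tau> = \<alpha> then ?f \<alpha> * (4 * (?b \<alpha> x * ?b \<alpha> y)) else 0)"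
      proof (cases "\<tau> = \<alpha>")
        case True
        have "?b \<alpha> (1 - x) = ?b \<alpha> x" "?b \<alpha> (1 - y) = ?b \<alpha> y" using x y by (auto intro!: even_reflect)
        then show ?thesis using True by simp
      next
        case False
        then have "odd \<tau>" using \<tau> by simp
        then have "?b \<tau> (1 - x) = - ?b \<tau> x" using x by (intro bernpoly_odd_reflect) auto
        then show ?thesis using False by simp
      qed
    qed
    also have "\<dots> = ?f \<alpha> * (4 * (?b \<alpha> x * ?b \<alpha> y))" using \<alpha> by (simp add: sum.delta)
    finally show ?thesis .
  qed
  have bb: "?f \<alpha> * (?b \<alpha> x * ?b \<alpha> y) = 4 / (2 * pi) ^ (2 * \<alpha>) * (cos_series (real \<alpha>) x * cos_series (real \<alpha>) y)"
  proof -
    \<comment> \<open>The sign in the Fourier expansion of degree \<alpha> enters twice and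
      disappears.\<close>
    have sign: "(-1) ^ m * (-1) ^ m = (1 :: real)" for m by (induction m) auto
    have fx: "?b \<alpha> x / fact \<alpha> = (-1) ^ (\<alpha> div 2 + 1) * (2 / (2 * pi) ^ \<alpha>) * cos_series (real \<alpha>) x"
      using x by (intro bernpoly_even_fourier \<alpha>) auto
    have fy: "?b \<alpha> y / fact \<alpha> = (-1) ^ (\<alpha> div 2 + 1) * (2 / (2 * pi) ^ \<alpha>) * cos_series (real \<alpha>) y"
      using y by (intro bernpoly_even_fourier \<alpha>) auto
    have "?f \<alpha> * (?b \<alpha> x * ?b \<alpha> y) = (?b \<alpha> x / fact \<alpha>) * (?b \<alpha> y / fact \<alpha>)" by (simp add: power2_eq_square)
    also have "\<dots> = ((-1) ^ (\<alpha> div 2 + 1) * (-1) ^ (\<alpha> div 2 + 1)) * (2 / (2 * pi) ^ \<alpha> * (2 / (2 * pi) ^ \<alpha>)) * (cos_series (real \<alpha>) x * cos_series (real \<alpha>) y)"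
      unfolding fx fy by (simp only: mult_ac)
    also have "(-1) ^ (\<alpha> div 2 + 1) * (-1) ^ (\<alpha> div 2 + 1) = (1 :: real)"
      using sign .
    also have "2 / (2 * pi) ^ \<alpha> * (2 / (2 * pi) ^ \<alpha>) = 4 / (2 * pi) ^ (2 * \<alpha>)"
      unfolding mult_2[of \<alpha>] power_add times_divide_times_eq by simp
    finally show ?thesis by simp
  qed
  have arith: "(((S1 + c * C1) + (S2 + c * C2)) / 2 + ((S3 + c * C2) + (S4 + c * C1)) / 2) / 2 = w + c / 2 * (C1 + C2)"
    if "S1 + S2 + S3 + S4 = f * (4 * p)" "f * p = w" for S1 S2 S3 S4 C1 C2 c f p w :: real
  proof -
    have "(((S1 + c * C1) + (S2 + c * C2)) / 2 + ((S3 + c * C2) + (S4 + c * C1)) / 2) / 2 = (S1 + S2 + S3 + S4) / 4 + c / 2 * (C1 + C2)"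
      by (simp add: field_simps)
    also have "\<dots> = f * p + c / 2 * (C1 + C2)" unfolding that(1) by simp
    finally show ?thesis unfolding that(2) .
  qed
  have "?c / 2 = 1 / (2 * pi) ^ (2 * \<alpha>)" by simp
  then show ?thesis
    using arith[OF sum bb, of ?c "?C (x - y)" "?C (x + y)"]
    unfolding sym_sob_def sob_eq[OF \<alpha> x y] sob_eq[OF \<alpha> x y'] sob_eq[OF \<alpha> x' y] sob_eq[OF \<alpha> x' y'] C by (simp only:)
qed

text \<open>Both kernels are expanded over pairs of residues, one for each argument. Their
  coefficients are compared pair by pair, which is legitimate because the means of the cosine
  products are nonnegative.\<close>

lemma sobolev_double_mean_le:
  assumes \<alpha>: "even \<alpha>" "0 < \<alpha>" and N: "N > 0" and u: "u \<subseteq> {1..s}"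
  shows "avg (symmetrized_points s (lattice_points s N z)) (\<lambda>x. avg (symmetrized_points s (lattice_points s N z)) (\<lambda>y. \<Prod>j\<in>u. sob \<alpha> (x j) (y j)))
    \<le> (3 / (2 ^ (2 * \<alpha> + 1) * pi ^ (2 * \<alpha>))) ^ card u * (dual_sum N (real \<alpha>) z u)\<^sup>2"
proof -
  let ?L = "lattice_points s N z" and ?S = "symmetrized_points s (lattice_points s N z)"
  let ?NN = "{..<N} \<times> {..<N}" and ?i = "\<lambda>n j. int n * int (z j)"
  have fu: "finite u" using u finite_subset by blast
  have a1: "1 < real \<alpha>" using \<alpha> by (cases "\<alpha> = 1") auto
  then have a2: "1 < 2 * real \<alpha>" by simp
  let ?pt = "\<lambda>n. \<lambda>j\<in>{1..s}. frac (real n * real (z j) / real N)"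
  define q where "q = 1 / (2 * pi) ^ (2 * \<alpha>)"
  have q0: "0 \<le> q" by (simp add: q_def)
  let ?r = "rho N (real \<alpha>)" and ?r2 = "rho N (2 * real \<alpha>)"
  define co where "co a j n = cos (2 * pi * real a * of_int (?i n j) / real N)" for a j n
  have cs_co: "cos_series (real \<alpha>) (of_int (?i n j) / real N) = (\<Sum>a<N. ?r a * co a j n)" for j n
    unfolding cos_series_lattice[OF a1 N] co_def ..
  have prod_co: "(\<Sum>a<N. ?r a * co a j m) * (\<Sum>b<N. ?r b * co b j n) =
    (\<Sum>p\<in>?NN. ?r (fst p) * ?r (snd p) * (co (fst p) j m * co (snd p) j n))" for j m n
    unfolding sum_product sum.cartesian_product by (simp add: case_prod_beta mult_ac)
  let ?cc = "\<lambda>p j m n. co (fst p) j m * co (snd p) j n" and ?C = "cos_series (real \<alpha>)" and ?C2 = "cos_series (2 * real \<alpha>)"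
  \<comment> \<open>The 4 stems from degree \<alpha>; the diagonal part stems from degree 2
    \<alpha>, where the cosines of difference and sum add up to \<open>2 * cos * cos\<close> with
    equal frequencies.\<close>
  define W where "W p = q * (4 * (?r (fst p) * ?r (snd p)) + (if fst p = snd p then 2 * ?r2 (fst p) else 0))" for p
  have "avg ?S (\<lambda>x. avg ?S (\<lambda>y. \<Prod>j\<in>u. sob \<alpha> (x j) (y j))) =
    avg ?L (\<lambda>x. avg ?L (\<lambda>y. \<Prod>j\<in>u. sym_sob \<alpha> (x j) (y j)))"
  proof -
    have "avg ?S (\<lambda>x. avg ?S (\<lambda>y. \<Prod>j\<in>u. sob \<alpha> (x j) (y j))) =
      avg ?S (\<lambda>x. avg ?L (\<lambda>y. \<Prod>j\<in>u. (sob \<alpha> (x j) (y j) + sob \<alpha> (x j) (1 - y j)) / 2))"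
      by (subst avg_symmetrized_prod[OF u]) (rule refl)
    also have "\<dots> = avg ?L (\<lambda>y. avg ?S (\<lambda>x. \<Prod>j\<in>u. (sob \<alpha> (x j) (y j) + sob \<alpha> (x j) (1 - y j)) / 2))"
      by (rule avg_swap)
    also have "\<dots> = avg ?L (\<lambda>y. avg ?L (\<lambda>x. \<Prod>j\<in>u. sym_sob \<alpha> (x j) (y j)))"
      unfolding sym_sob_def
      by (subst avg_symmetrized_prod[OF u, where h = "\<lambda>j t. (sob \<alpha> t (_ j) + sob \<alpha> t (1 - _ j)) / 2"]) (rule refl)
    finally show ?thesis by (subst (asm) avg_swap)
  qed
  also have "\<dots> = (\<Sum>m<N. \<Sum>n<N. \<Prod>j\<in>u. sym_sob \<alpha> (?pt m j) (?pt n j)) / real N / real N"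
    unfolding avg_lattice sum_divide_distrib[symmetric] ..
  also have "\<dots> = (\<Sum>m<N. \<Sum>n<N. \<Prod>j\<in>u. \<Sum>p\<in>?NN. W p * ?cc p j m n) / real N / real N"
  proof (intro arg_cong2[where f = "(/)"] sum.cong prod.cong refl)
    fix m n j assume "j \<in> u"
    then have j: "j \<in> {1..s}" using u by blast
    let ?x = "real m * real (z j) / real N" and ?y = "real n * real (z j) / real N"
    have x: "?x = of_int (?i m j) / real N" and y: "?y = of_int (?i n j) / real N" by simp_all
    have d: "?x - ?y = of_int (?i m j - ?i n j) / real N"
      and s: "?x + ?y = of_int (?i m j + ?i n j) / real N"
      by (simp_all add: diff_divide_distrib add_divide_distrib)
    have fr: "frac t \<in> {0..1}" for t :: real using frac_lt_1[of t] by (simp add: less_imp_le)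
    have cc: "?C2 (?x - ?y) + ?C2 (?x + ?y) = (\<Sum>a<N. 2 * ?r2 a * (co a j m * co a j n))"
    proof -
      have "cos (2 * pi * real a * of_int (?i m j - ?i n j) / real N) + cos (2 * pi * real a * of_int (?i m j + ?i n j) / real N)
        = 2 * (co a j m * co a j n)" for a
      proof -
        have "2 * pi * real a * of_int (?i m j - ?i n j) / real N = 2 * pi * real a * of_int (?i m j) / real N - 2 * pi * real a * of_int (?i n j) / real N"
          "2 * pi * real a * of_int (?i m j + ?i n j) / real N = 2 * pi * real a * of_int (?i m j) / real N + 2 * pi * real a * of_int (?i n j) / real N"
          by (simp_all add: algebra_simps diff_divide_distrib add_divide_distrib)
        then show ?thesis unfolding co_def by (simp only: cos_add cos_diff)
      qed
      then have "?r2 a * cos (2 * pi * real a * of_int (?i m j - ?i n j) / real N) + ?r2 a * cos (2 * pi * real a * of_int (?i m j + ?i n j) / real N)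
        = 2 * ?r2 a * (co a j m * co a j n)" for a unfolding distrib_left[symmetric] by simp
      then show ?thesis unfolding d s cos_series_lattice[OF a2 N] sum.distrib[symmetric] by (simp only:)
    qed
    have "sym_sob \<alpha> (?pt m j) (?pt n j) = 4 * q * (?C ?x * ?C ?y) + q * (?C2 (?x - ?y) + ?C2 (?x + ?y))"
      using j by (simp only: restrict_apply' sym_sob_eq[OF \<alpha> fr fr] cos_series_frac cos_series_frac_diff cos_series_frac_add) (simp add: q_def)
    also have "\<dots> = 4 * q * ((\<Sum>a<N. ?r a * co a j m) * (\<Sum>b<N. ?r b * co b j n)) + q * (\<Sum>a<N. 2 * ?r2 a * (co a j m * co a j n))"
      unfolding cc unfolding x y cs_co ..
    also have "(\<Sum>a<N. ?r a * co a j m) * (\<Sum>b<N. ?r b * co b j n) = (\<Sum>p\<in>?NN. ?r (fst p) * ?r (snd p) * ?cc p j m n)"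
      by (rule prod_co)
    also have "(\<Sum>a<N. 2 * ?r2 a * (co a j m * co a j n)) = (\<Sum>p\<in>?NN. (if fst p = snd p then 2 * ?r2 (fst p) else 0) * ?cc p j m n)"
    proof -
      have "(\<Sum>p\<in>?NN. (if fst p = snd p then 2 * ?r2 (fst p) else 0) * ?cc p j m n) =
        (\<Sum>a<N. \<Sum>b<N. if a = b then 2 * ?r2 a * (co a j m * co b j n) else 0)"
        unfolding sum.cartesian_product by (intro sum.cong) auto
      also have "\<dots> = (\<Sum>a<N. 2 * ?r2 a * (co a j m * co a j n))" by (intro sum.cong) auto
      finally show ?thesis ..
    qed
    also have "4 * q * (\<Sum>p\<in>?NN. ?r (fst p) * ?r (snd p) * ?cc p j m n) + q * \<dots> =
      (\<Sum>p\<in>?NN. W p * ?cc p j m n)"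
      unfolding sum_distrib_left sum.distrib[symmetric] W_def by (intro sum.cong refl) (simp add: algebra_simps)
    finally show "sym_sob \<alpha> (?pt m j) (?pt n j) = (\<Sum>p\<in>?NN. W p * ?cc p j m n)" .
  qed
  also have "\<dots> \<le> (\<Sum>m<N. \<Sum>n<N. \<Prod>j\<in>u. \<Sum>p\<in>?NN. (6 * q * (?r (fst p) * ?r (snd p))) * ?cc p j m n) / real N / real N"
  proof -
    define M where "M p = (\<Sum>m<N. \<Sum>n<N. \<Prod>j\<in>u. ?cc (p j) j m n)" for p :: "nat \<Rightarrow> nat \<times> nat"
    have expand: "(\<Sum>m<N. \<Sum>n<N. \<Prod>j\<in>u. \<Sum>p\<in>?NN. V p * ?cc p j m n) =
      (\<Sum>p\<in>PiE u (\<lambda>_. ?NN). (\<Prod>j\<in>u. V (p j)) * M p)" for V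
    proof -
      have "(\<Prod>j\<in>u. \<Sum>p\<in>?NN. V p * ?cc p j m n) =
        (\<Sum>p\<in>PiE u (\<lambda>_. ?NN). (\<Prod>j\<in>u. V (p j)) * (\<Prod>j\<in>u. ?cc (p j) j m n))" for m n
        unfolding prod.distrib[symmetric] by (rule prod_sum_PiE) (use fu in auto)
      then have "(\<Sum>m<N. \<Sum>n<N. \<Prod>j\<in>u. \<Sum>p\<in>?NN. V p * ?cc p j m n) =
        (\<Sum>m<N. \<Sum>n<N. \<Sum>p\<in>PiE u (\<lambda>_. ?NN). (\<Prod>j\<in>u. V (p j)) * (\<Prod>j\<in>u. ?cc (p j) j m n))"
        by (simp only:)
      also have "\<dots> = (\<Sum>p\<in>PiE u (\<lambda>_. ?NN). (\<Prod>j\<in>u. V (p j)) * M p)"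
        unfolding M_def sum_distrib_left by (subst (2) sum.swap, subst sum.swap) (rule refl)
      finally show ?thesis .
    qed
    have co_pm: "0 \<le> (\<Sum>n<N. \<Prod>j\<in>u. co (c j) j n)" for c
    proof -
      have "(\<Prod>j\<in>u. 2 * cos (2 * pi * of_int (int (c j * z j)) * of_int (int n) / real N)) = 2 ^ card u * (\<Prod>j\<in>u. co (c j) j n)" for n
        unfolding prod.distrib prod_constant co_def by (simp add: mult_ac)
      then have "sign_count N (\<lambda>j. int (c j * z j)) u = 2 ^ card u * (\<Sum>n<N. \<Prod>j\<in>u. co (c j) j n) / real N"
        unfolding sign_count_def mean_def cos_prod_def by (simp add: sum_distrib_left)
      then have "(\<Sum>n<N. \<Prod>j\<in>u. co (c j) j n) = sign_count N (\<lambda>j. int (c j * z j)) u * real N / 2 ^ card u"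
        using N by simp
      then show ?thesis using sign_count_bounds(1)[OF N fu, of "\<lambda>j. int (c j * z j)"]
        by (simp only:) simp
    qed
    \<comment> \<open>The double sum factors into a sum over \<open>m\<close> and one over
      \<open>n\<close>, each a positive multiple of a \<open>sign_count\<close>.\<close>
    have M0: "0 \<le> M p" for p
    proof -
      have "M p = (\<Sum>m<N. \<Prod>j\<in>u. co (fst (p j)) j m) * (\<Sum>n<N. \<Prod>j\<in>u. co (snd (p j)) j n)"
        unfolding M_def prod.distrib sum_product ..
      then show ?thesis using co_pm[of "\<lambda>j. fst (p j)"] co_pm[of "\<lambda>j. snd (p j)"] by simp
    qed
    have W0: "0 \<le> W p" for p unfolding W_def
      using q0 rho_nonneg[OF a1] rho_nonneg[OF a2] by (intro mult_nonneg_nonneg add_nonneg_nonneg) auto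
    \<comment> \<open>Exponent 1/2 in \<open>rho_powr_le\<close>: the root of a sum is at most the
      sum of the roots.\<close>
    have r2: "?r2 a \<le> ?r a * ?r a" for a
    proof -
      have "?r2 a powr (1 / 2) \<le> ?r a" using rho_powr_le[OF a2, of "1 / 2" N a] a1 by simp
      then have "sqrt (?r2 a) \<le> ?r a" by (simp add: powr_half_sqrt rho_nonneg[OF a2])
      then show ?thesis using sqrt_le_D by (fastforce simp: power2_eq_square)
    qed
    have WV: "W p \<le> 6 * q * (?r (fst p) * ?r (snd p))" for p
    proof -
      have "(if fst p = snd p then 2 * ?r2 (fst p) else 0) \<le> 2 * (?r (fst p) * ?r (snd p))"
        using r2[of "fst p"] rho_nonneg[OF a1, of N] by auto
      then have "W p \<le> q * (4 * (?r (fst p) * ?r (snd p)) + 2 * (?r (fst p) * ?r (snd p)))"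
        unfolding W_def using q0 by (intro mult_left_mono add_left_mono)
      then show ?thesis by simp
    qed
    show ?thesis unfolding expand
      by (intro divide_right_mono sum_mono mult_right_mono prod_mono conjI W0 WV M0) auto
  qed
  also have "\<dots> = (6 * q) ^ card u * ((\<Sum>m<N. \<Prod>j\<in>u. ?C (of_int (?i m j) / real N)) / real N)\<^sup>2"
  proof -
    have "(\<Sum>p\<in>?NN. (6 * q * (?r (fst p) * ?r (snd p))) * ?cc p j m n) =
      6 * q * (?C (of_int (?i m j) / real N) * ?C (of_int (?i n j) / real N))" for j m n
      unfolding cs_co prod_co unfolding sum_distrib_left by (simp only: mult.assoc)
    then have "(\<Prod>j\<in>u. \<Sum>p\<in>?NN. (6 * q * (?r (fst p) * ?r (snd p))) * ?cc p j m n) =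
      (6 * q) ^ card u * ((\<Prod>j\<in>u. ?C (of_int (?i m j) / real N)) *
      (\<Prod>j\<in>u. ?C (of_int (?i n j) / real N)))" for m n
      by (simp only: prod.distrib prod_constant power_mult_distrib)
    then have "(\<Sum>m<N. \<Sum>n<N. \<Prod>j\<in>u. \<Sum>p\<in>?NN. (6 * q * (?r (fst p) * ?r (snd p))) * ?cc p j m n) =
      (6 * q) ^ card u * ((\<Sum>m<N. \<Prod>j\<in>u. ?C (of_int (?i m j) / real N)) *
      (\<Sum>n<N. \<Prod>j\<in>u. ?C (of_int (?i n j) / real N)))"
      unfolding sum_product unfolding sum_distrib_left by (simp only:)
    then show ?thesis by (simp only: power2_eq_square) simp
  qed
  also have "\<dots> = (3 / (2 ^ (2 * \<alpha> + 1) * pi ^ (2 * \<alpha>))) ^ card u * (dual_sum N (real \<alpha>) z u)\<^sup>2"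
  proof -
    have "dual_sum N (real \<alpha>) z u = 2 ^ card u * ((\<Sum>m<N. \<Prod>j\<in>u. ?C (of_int (?i m j) / real N)) / real N)"
      unfolding dual_sum_def mean_def prod.distrib prod_constant by (simp add: sum_distrib_left)
    \<comment> \<open>The factor 4 split off here becomes the square of the
      \<open>2 ^ card u\<close> contained in \<open>dual_sum\<close>.\<close>
    moreover have "6 * q = 3 / (2 ^ (2 * \<alpha> + 1) * pi ^ (2 * \<alpha>)) * 4"
      by (simp add: q_def power_mult_distrib)
    moreover have "(4 :: real) ^ card u = (2 ^ card u)\<^sup>2"
      using power_even_eq[of "2 :: real" "card u"] power_mult[of "2 :: real" 2 "card u"] by simp
    ultimately show ?thesis by (simp only: power_mult_distrib mult_ac)
  qed
  finally show ?thesis .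
qed

text \<open>The weights are scaled so that each summand of the squared error is at most the square
  of a Korobov summand; as these are nonnegative, the sum of their squares is at most the square of
  their sum.\<close>

lemma worst_case_error_sobolev_le:
  assumes \<alpha>: "even \<alpha>" "0 < \<alpha>" and N: "N > 0" and \<gamma>: "\<And>u. u \<subseteq> {1..s} \<Longrightarrow> 0 \<le> \<gamma> u"
  shows "worst_case_error s (symmetrized_points s (lattice_points s N z)) (sobolev_space \<alpha> \<gamma> s)
    \<le> ereal (korobov_error N (real \<alpha>) (sqrt_scaled_weights \<alpha> \<gamma>) s z)"
proof -
  let ?S = "symmetrized_points s (lattice_points s N z)" and ?U = "Pow {1..s} - {{}}"
  let ?\<eta> = "sqrt_scaled_weights \<alpha> \<gamma>"
  have a1: "1 < real \<alpha>" using \<alpha> by (cases "\<alpha> = 1") auto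
  obtain C D where "kernel_1d (sob \<alpha>) C D" using kernel_1d_sobolev[OF \<alpha>] by blast
  then interpret kernel_1d "sob \<alpha>" C D .
  interpret mean_one_kernel s "sobolev_kernel \<alpha> \<gamma> s" "1 + (\<Sum>u\<in>?U. \<gamma> u * C ^ card u)"
    "\<lambda>M. \<Sum>u\<in>?U. \<gamma> u * (D / real (Suc M)) ^ card u"
    unfolding sobolev_kernel_eq by (rule mean_one_product_kernel[OF \<gamma>])
  note ne = symmetrized_neq_empty[OF lattice_points_neq_empty[OF N, of s z], of s]
  have "avg ?S (\<lambda>x. avg ?S (sobolev_kernel \<alpha> \<gamma> s x)) - 1 =
    (\<Sum>u\<in>?U. \<gamma> u * avg ?S (\<lambda>x. avg ?S (\<lambda>y. \<Prod>j\<in>u. sob \<alpha> (x j) (y j))))"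
    unfolding sobolev_kernel_eq product_kernel_def avg_add avg_const[OF ne] avg_sum avg_cmult
    by (rule add_diff_cancel_left')
  also have "\<dots> \<le> (\<Sum>u\<in>?U. (?\<eta> u * dual_sum N (real \<alpha>) z u)\<^sup>2)"
  proof (rule sum_mono)
    fix u assume u: "u \<in> ?U"
    have "\<gamma> u * avg ?S (\<lambda>x. avg ?S (\<lambda>y. \<Prod>j\<in>u. sob \<alpha> (x j) (y j))) \<le>
      \<gamma> u * ((3 / (2 ^ (2 * \<alpha> + 1) * pi ^ (2 * \<alpha>))) ^ card u * (dual_sum N (real \<alpha>) z u)\<^sup>2)"
      using u \<gamma> by (intro mult_left_mono sobolev_double_mean_le \<alpha> N) auto
    also have "\<dots> = (?\<eta> u * dual_sum N (real \<alpha>) z u)\<^sup>2"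
      using u \<gamma>[of u] by (simp add: sqrt_scaled_weights_def scaled_weights_def power_mult_distrib)
    finally show "\<gamma> u * avg ?S (\<lambda>x. avg ?S (\<lambda>y. \<Prod>j\<in>u. sob \<alpha> (x j) (y j))) \<le> (?\<eta> u * dual_sum N (real \<alpha>) z u)\<^sup>2" .
  qed
  also have "\<dots> \<le> (korobov_error N (real \<alpha>) ?\<eta> s z)\<^sup>2"
  proof -
    have nn: "0 \<le> ?\<eta> u * dual_sum N (real \<alpha>) z u" if "u \<in> ?U" for u
      using that \<gamma>[of u] finite_Pow_mem[OF that]
      by (intro mult_nonneg_nonneg dual_sum_nonneg a1 N) (auto simp: sqrt_scaled_weights_def scaled_weights_def)
    have "(\<Sum>u\<in>?U. (?\<eta> u * dual_sum N (real \<alpha>) z u)\<^sup>2) \<le> (\<Sum>u\<in>?U. ?\<eta> u * dual_sum N (real \<alpha>) z u * korobov_error N (real \<alpha>) ?\<eta> s z)"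
      unfolding power2_eq_square korobov_error_def
      by (intro sum_mono mult_left_mono nn member_le_sum) auto
    then show ?thesis by (simp add: power2_eq_square korobov_error_def sum_distrib_right)
  qed
  finally have "sqrt (avg ?S (\<lambda>x. avg ?S (sobolev_kernel \<alpha> \<gamma> s x)) - 1) \<le> korobov_error N (real \<alpha>) ?\<eta> s z"
    using \<gamma> by (intro real_le_lsqrt korobov_error_nonneg a1 N) (auto simp: sqrt_scaled_weights_def scaled_weights_def)
  then show ?thesis
    unfolding worst_case_error_eq(1)[OF ne symmetrized_subset[OF lattice_points_subset]] by simp
qed

theorem corollary2:
  fixes N s \<alpha> :: nat and \<gamma> :: "nat set \<Rightarrow> real"
  assumes "prime N" and "1 \<le> s" and "even \<alpha>" and "0 < \<alpha>"
    and "\<And>u. u \<subseteq> {1..s} \<Longrightarrow> 0 \<le> \<gamma> u"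
  shows
    "(\<exists>z. cbc_output (korobov_criterion (real \<alpha> / 2) (sqrt_scaled_weights \<alpha> \<gamma>) N) N s z) \<and>
     (\<forall>z. cbc_output (korobov_criterion (real \<alpha> / 2) (sqrt_scaled_weights \<alpha> \<gamma>) N) N s z \<longrightarrow>
       (\<forall>j\<in>{1..s}. z j \<in> {1..N - 1}) \<and>
       (\<forall>lam :: real. 1 / real \<alpha> < lam \<and> lam \<le> 1 \<longrightarrow>
         worst_case_error s (symmetrized_points s (lattice_points s N z)) (sobolev_space \<alpha> \<gamma> s)
           \<le> (worst_case_error s (lattice_points s N z) (korobov_space (real \<alpha> / 2) (sqrt_scaled_weights \<alpha> \<gamma>) s))\<^sup>2 \<and>
         (worst_case_error s (lattice_points s N z) (korobov_space (real \<alpha> / 2) (sqrt_scaled_weights \<alpha> \<gamma>) s))\<^sup>2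
           \<le> ereal (1 / (real N - 1) powr (1 / lam) *
               (\<Sum>u\<in>Pow {1..s} - {{}}. \<gamma> u powr (lam / 2) *
                 (3 powr (lam / 2) * zeta (real \<alpha> * lam)
                   / (2 powr ((2 * real \<alpha> + 1) * lam / 2 - 1) * pi powr (real \<alpha> * lam))) ^ card u)
               powr (1 / lam))))"
proof (intro conjI allI impI)
  let ?\<eta> = "sqrt_scaled_weights \<alpha> \<gamma>" and ?crit = "korobov_criterion (real \<alpha> / 2) (sqrt_scaled_weights \<alpha> \<gamma>) N"
  have N0: "N > 0" and N2: "N \<ge> 2" using prime_gt_0_nat prime_ge_2_nat assms(1) by auto
  have a1: "1 < real \<alpha>" using assms(3,4) by (cases "\<alpha> = 1") auto
  have \<eta>: "0 \<le> ?\<eta> u" if "u \<subseteq> {1..s}" for u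
    using assms(5)[OF that] by (simp add: sqrt_scaled_weights_def scaled_weights_def)
  show "\<exists>z. cbc_output ?crit N s z"
    by (rule cbc_output_exists[OF N2 korobov_criterion_cong])
  fix z assume cbc: "cbc_output ?crit N s z"
  show "\<forall>j\<in>{1..s}. z j \<in> {1..N - 1}"
  proof
    fix j assume "j \<in> {1..s}"
    then consider "j = 1" | "j \<in> {2..s}" by fastforce
    then show "z j \<in> {1..N - 1}"
      using cbc N2 by cases (auto simp: cbc_output_def is_arg_min_def)
  qed
  fix lam :: real assume lam: "1 / real \<alpha> < lam \<and> lam \<le> 1"
  have lam0: "0 < lam" using lam a1 by (intro less_trans[OF _ conjunct1[OF lam]]) simp
  have al: "1 < real \<alpha> * lam" using lam a1 by (simp add: field_simps)
  have sq: "(worst_case_error s (lattice_points s N z) (korobov_space (real \<alpha> / 2) ?\<eta> s))\<^sup>2 = ereal (korobov_error N (real \<alpha>) ?\<eta> s z)"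
    using korobov_criterion_eq[of "real \<alpha> / 2" N s ?\<eta> z] a1 N0 \<eta> by (simp add: korobov_criterion_def)
  show "worst_case_error s (symmetrized_points s (lattice_points s N z)) (sobolev_space \<alpha> \<gamma> s)
       \<le> (worst_case_error s (lattice_points s N z) (korobov_space (real \<alpha> / 2) ?\<eta> s))\<^sup>2"
    unfolding sq using assms N0 by (intro worst_case_error_sobolev_le)
  let ?c = "3 powr (lam / 2) * zeta (real \<alpha> * lam) / (2 powr ((2 * real \<alpha> + 1) * lam / 2 - 1) * pi powr (real \<alpha> * lam))"
  let ?R = "\<Sum>u\<in>Pow {1..s} - {{}}. \<gamma> u powr (lam / 2) * ?c ^ card u"
  \<comment> \<open>The exponent is \<open>lam / 2\<close> because the weights are square roots; the
    factor 2 of \<open>2 * zeta\<close> becomes the -1 in the exponent of 2 in the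
    denominator.\<close>
  have c: "(3 / (2 ^ (2 * \<alpha> + 1) * pi ^ (2 * \<alpha>))) powr (lam / 2) * (2 * zeta (real \<alpha> * lam)) = ?c"
  proof -
    have "(2 :: real) ^ (2 * \<alpha> + 1) = 2 powr (2 * real \<alpha> + 1)" "pi ^ (2 * \<alpha>) = pi powr (2 * real \<alpha>)"
      using powr_realpow[of 2 "2 * \<alpha> + 1"] powr_realpow[of pi "2 * \<alpha>"] by (simp_all add: add.commute)
    moreover have "(2 * real \<alpha> + 1) * lam / 2 = (2 * real \<alpha> + 1) * (lam / 2)" "real \<alpha> * lam = 2 * real \<alpha> * (lam / 2)" by simp_all
    ultimately show ?thesis
      by (simp only: powr_divide powr_mult powr_powr powr_diff) simp
  qed
  have weights: "?\<eta> u powr lam * (2 * zeta (real \<alpha> * lam)) ^ card u = \<gamma> u powr (lam / 2) * ?c ^ card u"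
    if "u \<in> Pow {1..s} - {{}}" for u
  proof -
    let ?k = "3 / (2 ^ (2 * \<alpha> + 1) * pi ^ (2 * \<alpha>)) :: real"
    have k0: "0 < ?k" by simp
    have g0: "0 \<le> \<gamma> u" using that assms(5) by blast
    have "?\<eta> u = (\<gamma> u * ?k ^ card u) powr (1 / 2)"
      using g0 k0 unfolding sqrt_scaled_weights_def scaled_weights_def by (subst powr_half_sqrt) (auto intro!: mult_nonneg_nonneg)
    then have "?\<eta> u powr lam = (\<gamma> u * ?k ^ card u) powr (lam / 2)" by (simp add: powr_powr)
    also have "\<dots> = \<gamma> u powr (lam / 2) * (?k ^ card u) powr (lam / 2)" by (rule powr_mult)
    also have "(?k ^ card u) powr (lam / 2) = (?k powr (lam / 2)) ^ card u"
      using k0 by (simp only: powr_realpow[symmetric] powr_powr powr_gt_zero mult.commute)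
    finally show ?thesis unfolding c[symmetric] power_mult_distrib by simp
  qed
  have bound: "korobov_error N (real \<alpha>) ?\<eta> s z powr lam \<le> ?R / (real N - 1)"
    using cbc_bound[OF assms(1) _ \<eta> cbc lam0] lam a1 al weights by simp
  have E0: "0 \<le> korobov_error N (real \<alpha>) ?\<eta> s z" by (intro korobov_error_nonneg a1 N0 \<eta>)
  have R0: "0 \<le> ?R" using zeta_pos[OF al] by (intro sum_nonneg mult_nonneg_nonneg zero_le_power) auto
  have "korobov_error N (real \<alpha>) ?\<eta> s z = (korobov_error N (real \<alpha>) ?\<eta> s z powr lam) powr (1 / lam)"
    using E0 lam0 by (simp add: powr_powr)
  also have "\<dots> \<le> (?R / (real N - 1)) powr (1 / lam)"
    using bound lam0 by (intro powr_mono2) auto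
  also have "\<dots> = 1 / (real N - 1) powr (1 / lam) * ?R powr (1 / lam)"
    using R0 N2 by (simp add: powr_divide)
  finally show "(worst_case_error s (lattice_points s N z) (korobov_space (real \<alpha> / 2) ?\<eta> s))\<^sup>2
    \<le> ereal (1 / (real N - 1) powr (1 / lam) * ?R powr (1 / lam))"
    unfolding sq by simp
qed

end
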